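(* Let $\Gamma$ be a group and let $\rho:\Gamma\to\mathrm{Diff}(\mathbb{S}^1)$ be a non elementary representation that preserves a smooth volume form on $\mathcal{C}=\mathbb{S}^1\times\mathbb{S}^1\setminus\Delta$. Then there is $h\in\mathrm{Diff}(\mathbb{S}^1)$ such that $S(h\circ\rho(\gamma)\circ h^{-1})(x)=0$ for all $\gamma\in\Gamma$ and all $x\in L_{h\rho(\Gamma)h^{-1}}$.
   Context: $\mathrm{Diff}(\mathbb{S}^1)$ is the group of orientation-preserving $C^\infty$ diffeomorphisms of $\mathbb{S}^1\approx\mathbb{R}\mathbb{P}^1$; $\Delta$ is the diagonal. $\rho$ is non elementary if $\rho(\Gamma)$ has no finite orbit on $\mathbb{S}^1$. A subgroup $G\subset\mathrm{Diff}(\mathbb{S}^1)$ with no finite orbit has a unique minimal nonempty closed invariant set $L_G\subset\mathbb{S}^1$, its limit set. $\rho$ preserves the volume form $\omega(x,y)\,dx\wedge dy$ (with $\omega>0$) if every $f\in\rho(\Gamma)$ satisfies $\omega(f(x),f(y))f'(x)f'(y)=\omega(x,y)$ for all $x\ne y$. The Schwarzian derivative of $f\in\mathrm{Diff}(\mathbb{S}^1)$ is the quadratic differential $S(f)=\left(\frac{f'''}{f'}-\frac32\left(\frac{f''}{f'}\right)^2\right)dx^2$, computed in projective charts of $\mathbb{R}\mathbb{P}^1$; it vanishes identically exactly when $f\in\mathrm{PSL}(2,\mathbb{R})$. *)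

theory Defs
  imports "HOL-Analysis.Analysis" "HOL-Algebra.Group_Action"
begin

text \<open>Meant for open \<open>U\<close> in a finite-dimensional space, where \<open>C_on k U\<close> is the usual class of
  \<open>C\<^sup>k\<close> maps.\<close>

primrec C_on :: "nat \<Rightarrow> 'a::real_normed_vector set \<Rightarrow> ('a \<Rightarrow> 'b::real_normed_vector) \<Rightarrow> bool" where
  "C_on 0 U f \<longleftrightarrow> continuous_on U f"
| "C_on (Suc k) U f \<longleftrightarrow>
     (\<forall>x\<in>U. f differentiable (at x)) \<and> (\<forall>v. C_on k U (\<lambda>x. frechet_derivative f (at x) v))"

definition smooth_on :: "'a::real_normed_vector set \<Rightarrow> ('a \<Rightarrow> 'b::real_normed_vector) \<Rightarrow> bool" where
  "smooth_on U f \<longleftrightarrow> (\<forall>k. C_on k U f)"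

text \<open>The circle is the unit circle of the complex plane. Its smooth structure is the one of an
  embedded submanifold, for which \<open>cis\<close> is a local diffeomorphism from the line onto the circle.\<close>

abbreviation S1 :: "complex set" where
  "S1 \<equiv> sphere 0 1"

definition smooth_circle_map :: "(complex \<Rightarrow> complex) \<Rightarrow> bool" where
  "smooth_circle_map f \<longleftrightarrow> f ` S1 \<subseteq> S1 \<and> smooth_on UNIV (\<lambda>t::real. f (cis t))"

text \<open>The derivative with respect to the angular coordinate on source and target: if
  \<open>f (z * cis t) = f z * cis (F t)\<close> near \<open>t = 0\<close>, with \<open>F\<close> smooth and \<open>F 0 = 0\<close>, this is the
  derivative of \<open>F\<close> at \<open>0\<close>.\<close>

definition circle_deriv :: "(complex \<Rightarrow> complex) \<Rightarrow> complex \<Rightarrow> real" where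
  "circle_deriv f z = Re (vector_derivative (\<lambda>t. f (z * cis t)) (at 0) / (\<i> * f z))"

definition Diff_S1 :: "(complex \<Rightarrow> complex) monoid" where
  "Diff_S1 = (BijGroup S1)\<lparr>carrier := {f \<in> Bij S1.
     smooth_circle_map f \<and> smooth_circle_map (restrict (inv_into S1 f) S1) \<and>
     (\<forall>z\<in>S1. circle_deriv f z > 0)}\<rparr>"

text \<open>\<open>h \<circ> f \<circ> h\<^sup>-\<^sup>1\<close>, computed in the group of all bijections of the circle.\<close>

definition conj_by :: "(complex \<Rightarrow> complex) \<Rightarrow> (complex \<Rightarrow> complex) \<Rightarrow> complex \<Rightarrow> complex" where
  "conj_by h f = h \<otimes>\<^bsub>BijGroup S1\<^esub> f \<otimes>\<^bsub>BijGroup S1\<^esub> inv\<^bsub>BijGroup S1\<^esub> h"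

definition non_elementary :: "('g, 'm) monoid_scheme \<Rightarrow> ('g \<Rightarrow> complex \<Rightarrow> complex) \<Rightarrow> bool" where
  "non_elementary \<Gamma> \<rho> \<longleftrightarrow> (\<forall>x\<in>S1. infinite (orbit \<Gamma> \<rho> x))"

definition closed_invariant :: "(complex \<Rightarrow> complex) set \<Rightarrow> complex set \<Rightarrow> bool" where
  "closed_invariant G K \<longleftrightarrow> K \<noteq> {} \<and> K \<subseteq> S1 \<and> closed K \<and> (\<forall>g\<in>G. g ` K = K)"

text \<open>Only meaningful for a group \<open>G\<close> of circle diffeomorphisms without finite orbit, for which
  the minimal set is unique.\<close>

definition limit_set :: "(complex \<Rightarrow> complex) set \<Rightarrow> complex set" where
  "limit_set G = (THE L. closed_invariant G L \<and>
     (\<forall>K. closed_invariant G K \<and> K \<subseteq> L \<longrightarrow> K = L))"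

text \<open>The angular coordinates \<open>s\<close>, \<open>t\<close> give a global coframe \<open>ds\<close>, \<open>dt\<close> of the torus, so a volume
  form on the complement of the diagonal is \<open>\<omega> ds \<and> dt\<close> for a global function \<open>\<omega>\<close>. The values of
  \<open>\<omega>\<close> on the diagonal play no role.\<close>

definition smooth_volume_form :: "(complex \<times> complex \<Rightarrow> real) \<Rightarrow> bool" where
  "smooth_volume_form \<omega> \<longleftrightarrow>
     smooth_on {(s, t). cis s \<noteq> cis t} (\<lambda>(s, t). \<omega> (cis s, cis t)) \<and>
     (\<forall>x\<in>S1. \<forall>y\<in>S1. x \<noteq> y \<longrightarrow> \<omega> (x, y) > 0)"

definition preserves_volume_form ::
  "(complex \<Rightarrow> complex) set \<Rightarrow> (complex \<times> complex \<Rightarrow> real) \<Rightarrow> bool" where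
  "preserves_volume_form G \<omega> \<longleftrightarrow> (\<forall>f\<in>G. \<forall>x\<in>S1. \<forall>y\<in>S1. x \<noteq> y \<longrightarrow>
     \<omega> (f x, f y) * circle_deriv f x * circle_deriv f y = \<omega> (x, y))"

text \<open>The identification of the circle with the projective line sends \<open>cis \<theta>\<close> to the line spanned
  by \<open>(cos (\<theta>/2), sin (\<theta>/2))\<close>. The affine coordinate \<open>Y/X\<close> of that line is \<open>tan (\<theta>/2)\<close>, that is
  \<open>Im z / (1 + Re z)\<close> for \<open>z = cis \<theta>\<close>. Precomposing with rotations, which are projective, gives an
  atlas of projective charts: \<open>proj_chart p\<close> is defined on the circle minus \<open>- p\<close>, maps \<open>p\<close> to \<open>0\<close>,
  and has inverse \<open>proj_param p\<close>.\<close>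

definition proj_chart :: "complex \<Rightarrow> complex \<Rightarrow> real" where
  "proj_chart p z = Im (z / p) / (1 + Re (z / p))"

definition proj_param :: "complex \<Rightarrow> real \<Rightarrow> complex" where
  "proj_param p x = p * cis (2 * arctan x)"

definition schwarzian :: "(real \<Rightarrow> real) \<Rightarrow> real \<Rightarrow> real" where
  "schwarzian g x = (deriv ^^ 3) g x / deriv g x - 3 / 2 * ((deriv ^^ 2) g x / deriv g x)\<^sup>2"

text \<open>The coefficient of \<open>dx\<^sup>2\<close> in the quadratic differential \<open>S(f)\<close> at \<open>z\<close>, for \<open>x\<close> the chart
  \<open>proj_chart p\<close> near \<open>z\<close>, with \<open>f\<close> read in the chart \<open>proj_chart q\<close> near \<open>f z\<close>. The
  choice of \<open>q\<close> does not matter, and that of \<open>p\<close> only rescales the coefficient.\<close>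

definition schwarzian_coeff ::
  "complex \<Rightarrow> complex \<Rightarrow> (complex \<Rightarrow> complex) \<Rightarrow> complex \<Rightarrow> real" where
  "schwarzian_coeff p q f z = schwarzian (proj_chart q \<circ> f \<circ> proj_param p) (proj_chart p z)"

definition schwarzian_vanishes_at :: "(complex \<Rightarrow> complex) \<Rightarrow> complex \<Rightarrow> bool" where
  "schwarzian_vanishes_at f z \<longleftrightarrow>
     (\<forall>p\<in>S1. \<forall>q\<in>S1. z \<noteq> - p \<and> f z \<noteq> - q \<longrightarrow> schwarzian_coeff p q f z = 0)"

end

theory Submission
  imports Defs
begin

text \<open>Write the volume form as \<open>W ds \<and> dt\<close> in angular coordinates and set \<open>u = \<partial>\<^sub>s log W\<close>. For fixed
  \<open>t\<close>, the density \<open>W (\<cdot>, t)\<close> is an affine structure on the circle minus a point, with Schwarzian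
  \<open>P = \<partial>\<^sub>s u - u\<^sup>2 / 2\<close>. Invariance of \<open>W\<close> gives
  \<open>P (s, t) = P (f s, f t) f'(s)\<^sup>2 + S(f)(s)\<close>, while the curvature \<open>K = \<partial>\<^sub>t u / W\<close> is an invariant
  function and \<open>\<partial>\<^sub>t P = W \<partial>\<^sub>s K\<close>.

  If the group contracts some arc to arbitrarily small length, then it contains a hyperbolic element
  (a volume preserving group cannot contract two disjoint arcs to distinct points). \<open>K\<close> is then
  constant on the pairs whose first point is its repelling fixed point, hence on all pairs whose first
  point \<open>x\<close> is in the limit set \<open>L\<close>. As \<open>L\<close> is perfect, \<open>\<partial>\<^sub>s K\<close> vanishes there, and \<open>P (x, y)\<close> does
  not depend on \<open>y\<close>. So it is enough that \<open>h\<close> induces the projective structure \<open>P (\<cdot>, y)\<close> on \<open>L\<close>. If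
  \<open>L\<close> has a gap, take for \<open>h\<close> the affine parameter of a point of the gap, modified in the gap. If \<open>L\<close> is
  the circle, \<open>W\<close> has to be \<open>k dX dY / (X - Y)\<^sup>2\<close> for the affine parameter \<open>X\<close> of the repelling
  fixed point, and \<open>X\<close> extends to a diffeomorphism onto the projective line.

  If no arc is contracted, the derivatives of the elements of the group are uniformly bounded, and their
  infimum is a continuous invariant density. In the coordinate defined by this density the group acts
  by rotations, and comparing it with \<open>W\<close> at the vertices of equilateral triangles shows that it is
  smooth.\<close>

section \<open>Smooth maps\<close>

text \<open>Where \<open>P (s, t)\<close> does not depend on \<open>t\<close>, its transformation
  rule makes the Schwarzian of the group a coboundary, so any diffeomorphism with Schwarzian
  \<open>P\<close> there, in projective target charts, is a solution. The obstacle is global: the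
  developing map \<open>2 * arctan X\<close> must close up after exactly one turn. A gap leaves room
  to correct the total angle. Without a gap there is no freedom, and both the closing up and the
  smoothness at the pole of \<open>X\<close> must be extracted from \<open>W\<close>:
  \<open>X\<close> is onto the line, and a change of base point inverts the affine parameter up to
  scale. Without contraction the difficulty is regularity, since the infimum of the derivatives is a
  priori only Lipschitz. The ratio \<open>W (x, y) * W (x, z) / W (y, z)\<close> transforms under
  \<open>F\<close> by the square of the derivative at \<open>x\<close> alone, so it can be compared
  with the square of the invariant density. The vertices of a moving triangle then solve an
  autonomous differential equation with smooth right-hand side, which upgrades continuity to
  smoothness. All of this is done with lifts to the line, where arcs are ordered intervals.\<close>

lemma C_on_cong:
  assumes "open U" "C_on k U f" "\<And>x. x \<in> U \<Longrightarrow> f x = g x"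
  shows "C_on k U g"
  using assms(2,3)
proof (induction k arbitrary: f g)
  case 0
  then show ?case by (auto cong: continuous_on_cong)
next
  case (Suc k)
  have d: "f differentiable (at x)" if "x \<in> U" for x
    using Suc.prems(1) that by simp
  have e: "frechet_derivative f (at x) = frechet_derivative g (at x)" if "x \<in> U" for x
    using frechet_derivative_transform_within_open[OF d[OF that] assms(1) that] Suc.prems(2) by auto
  have "g differentiable (at x)" if "x \<in> U" for x
    using d[OF that] Suc.prems(2) that assms(1)
    by (meson differentiable_def has_derivative_transform_within_open)
  moreover have "C_on k U (\<lambda>x. frechet_derivative g (at x) v)" for v
    by (rule Suc.IH[of "\<lambda>x. frechet_derivative f (at x) v"]) (use Suc.prems(1) e in auto)
  ultimately show ?case by simp
qed

lemma C_on_subset: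
  assumes "C_on k U f" "V \<subseteq> U"
  shows "C_on k V f"
  using assms by (induction k arbitrary: f) (auto intro: continuous_on_subset)

lemma C_on_Suc_imp: "C_on (Suc k) U f \<Longrightarrow> C_on k U f"
proof (induction k arbitrary: f)
  case 0
  then show ?case
    by (auto intro!: continuous_at_imp_continuous_on differentiable_imp_continuous_within)
next
  case (Suc k)
  then show ?case by (metis C_on.simps(2))
qed

lemma C_on_local:
  assumes "\<And>x. x \<in> U \<Longrightarrow> \<exists>V. open V \<and> x \<in> V \<and> C_on k V f"
  shows "C_on k U f"
  using assms
proof (induction k arbitrary: f)
  case 0
  then show ?case
    by (auto intro!: continuous_at_imp_continuous_on simp: continuous_on_eq_continuous_at)
      (metis continuous_on_eq_continuous_at)
next
  case (Suc k)
  then show ?case unfolding C_on.simps by (metis (no_types, lifting))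
qed

lemma C_on_SucI:
  assumes "open U" "\<And>x. x \<in> U \<Longrightarrow> (f has_derivative f' x) (at x)" "\<And>v. C_on k U (\<lambda>x. f' x v)"
  shows "C_on (Suc k) U f"
proof -
  have "frechet_derivative f (at x) = f' x" if "x \<in> U" for x
    using assms(2)[OF that] by (metis frechet_derivative_at)
  then have "C_on k U (\<lambda>x. frechet_derivative f (at x) v)" for v
    by (intro C_on_cong[OF assms(1) assms(3)[of v]]) simp
  then show ?thesis using assms(2) by (auto simp: differentiable_def)
qed

lemma C_on_Suc_has_derivative:
  assumes "C_on (Suc k) U f" "x \<in> U"
  shows "(f has_derivative frechet_derivative f (at x)) (at x)"
  using assms by (simp add: frechet_derivative_works)

lemma C_on_const: "open U \<Longrightarrow> C_on k U (\<lambda>x. c)"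
proof (induction k arbitrary: c)
  case (Suc k)
  show ?case by (rule C_on_SucI[where f' = "\<lambda>x v. 0"]) (use Suc in auto)
qed simp

lemma C_on_bounded_linear:
  assumes "open U" "bounded_linear f"
  shows "C_on k U f"
proof (cases k)
  case 0
  then show ?thesis using assms by (simp add: linear_continuous_on)
next
  case (Suc n)
  show ?thesis unfolding Suc
    by (rule C_on_SucI[where f' = "\<lambda>x. f"])
      (use assms C_on_const in \<open>auto simp: bounded_linear_imp_has_derivative\<close>)
qed

lemma C_on_add:
  assumes "open U" "C_on k U f" "C_on k U g"
  shows "C_on k U (\<lambda>x. f x + g x)"
  using assms(2,3)
proof (induction k arbitrary: f g)
  case (Suc k)
  show ?case
    by (rule C_on_SucI[OF assms(1) has_derivative_add[OF C_on_Suc_has_derivative[OF Suc.prems(1)]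
            C_on_Suc_has_derivative[OF Suc.prems(2)]]])
      (use Suc in auto)
qed (simp add: continuous_on_add)

lemma C_on_bilinear:
  assumes "open U" "C_on k U f" "C_on k U g" "bounded_bilinear p"
  shows "C_on k U (\<lambda>x. p (f x) (g x))"
  using assms(2,3)
proof (induction k arbitrary: f g)
  case 0
  then show ?case using bounded_bilinear.continuous_on[OF assms(4)] by auto
next
  case (Suc k)
  show ?case
    by (rule C_on_SucI[OF assms(1) bounded_bilinear.FDERIV[OF assms(4) C_on_Suc_has_derivative[OF Suc.prems(1)]
            C_on_Suc_has_derivative[OF Suc.prems(2)]]])
      (use Suc Suc.prems[THEN C_on_Suc_imp] in \<open>auto intro!: C_on_add assms(1)\<close>)
qed

lemma C_on_sum:
  assumes "open U" "finite A" "\<And>i. i \<in> A \<Longrightarrow> C_on k U (f i)"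
  shows "C_on k U (\<lambda>x. \<Sum>i\<in>A. f i x)"
  using assms(2,3)
  by (induction A rule: finite_induct) (auto intro: C_on_const C_on_add assms(1))

text \<open>Expanding the derivative of \<open>f\<close> in a basis turns the chain rule into a
  finite sum of products of \<open>frechet_derivative f (at (g x)) b\<close> with components of the
  derivative of \<open>g\<close>. The first factors are again compositions with the same
  \<open>g\<close>, so the induction hypothesis covers them; this is what the Euclidean middle space
  is for.\<close>

lemma C_on_compose:
  fixes f :: "'b::euclidean_space \<Rightarrow> 'c::real_normed_vector" and g :: "'a::real_normed_vector \<Rightarrow> 'b"
  assumes "open U" "open V" "g ` U \<subseteq> V" "C_on k V f" "C_on k U g"
  shows "C_on k U (\<lambda>x. f (g x))"
  using assms(4,5)
proof (induction k arbitrary: f)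
  case 0
  then show ?case using assms(3) by (auto intro: continuous_on_compose2)
next
  case (Suc k)
  let ?f' = "\<lambda>x. frechet_derivative f (at x)" and ?g' = "\<lambda>x. frechet_derivative g (at x)"
  have f': "(f has_derivative ?f' y) (at y)" if "y \<in> V" for y
    using C_on_Suc_has_derivative[OF Suc.prems(1) that] .
  have g': "(g has_derivative ?g' y) (at y)" if "y \<in> U" for y
    using C_on_Suc_has_derivative[OF Suc.prems(2) that] .
  have d: "((\<lambda>x. f (g x)) has_derivative (\<lambda>v. \<Sum>b\<in>Basis. (?g' x v \<bullet> b) *\<^sub>R ?f' (g x) b)) (at x)" if "x \<in> U" for x
  proof -
    have "g x \<in> V" using that assms(3) by auto
    then have 1: "((\<lambda>x. f (g x)) has_derivative (\<lambda>v. ?f' (g x) (?g' x v))) (at x)"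
      using has_derivative_compose[OF g'[OF that] f'] by simp
    have l: "linear (?f' (g x))" using f'[OF \<open>g x \<in> V\<close>] has_derivative_linear by blast
    have "?f' (g x) w = (\<Sum>b\<in>Basis. (w \<bullet> b) *\<^sub>R ?f' (g x) b)" for w
      by (subst euclidean_representation[of w, symmetric])
        (simp only: linear_sum[OF l] linear_cmul[OF l])
    then have "(\<lambda>v. ?f' (g x) (?g' x v)) = (\<lambda>v. \<Sum>b\<in>Basis. (?g' x v \<bullet> b) *\<^sub>R ?f' (g x) b)"
      by (intro ext)
    then show ?thesis using 1 by (simp only:)
  qed
  show ?case
  proof (rule C_on_SucI[OF assms(1) d])
    fix v
    have 1: "C_on k U (\<lambda>x. ?f' (g x) b)" for b
      using Suc.IH[of "\<lambda>y. ?f' y b"] Suc.prems C_on_Suc_imp by auto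
    have 2: "C_on k U (\<lambda>x. ?g' x v \<bullet> b)" for b
      using C_on_bilinear[OF assms(1) _ C_on_const[OF assms(1)] bounded_bilinear_inner, of k "\<lambda>x. ?g' x v" b]
        Suc.prems(2) by simp
    show "C_on k U (\<lambda>x. \<Sum>b\<in>Basis. (?g' x v \<bullet> b) *\<^sub>R ?f' (g x) b)"
      by (intro C_on_sum assms(1) finite_Basis C_on_bilinear[OF _ _ _ bounded_bilinear_scaleR] 1 2)
  qed auto
qed

lemma C_on_Suc_vector:
  fixes f :: "real \<Rightarrow> 'a::real_normed_vector"
  assumes "open U" "\<And>x. x \<in> U \<Longrightarrow> (f has_vector_derivative f' x) (at x)" "C_on k U f'"
  shows "C_on (Suc k) U f"
proof (rule C_on_SucI[OF assms(1)])
  show "(f has_derivative (\<lambda>v. v *\<^sub>R f' x)) (at x)" if "x \<in> U" for x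
    using assms(2)[OF that] by (simp add: has_vector_derivative_def)
  show "C_on k U (\<lambda>x. v *\<^sub>R f' x)" for v
    by (intro C_on_bilinear[OF _ _ _ bounded_bilinear_scaleR] C_on_const assms)
qed

lemma C_on_vector_derivative:
  fixes f :: "real \<Rightarrow> 'a::real_normed_vector"
  assumes "open U" "C_on (Suc k) U f"
  shows "C_on k U (\<lambda>x. vector_derivative f (at x))"
    and "x \<in> U \<Longrightarrow> (f has_vector_derivative vector_derivative f (at x)) (at x)"
proof -
  have d: "f differentiable at x" if "x \<in> U" for x
    using assms that by simp
  have "C_on k U (\<lambda>x. frechet_derivative f (at x) 1)" using assms by simp
  then show "C_on k U (\<lambda>x. vector_derivative f (at x))"
    by (rule C_on_cong[OF assms(1)]) (simp add: frechet_derivative_eq_vector_derivative[OF d])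
  show "x \<in> U \<Longrightarrow> (f has_vector_derivative vector_derivative f (at x)) (at x)"
    using d vector_derivative_works by blast
qed

lemma smooth_on_cong: "open U \<Longrightarrow> smooth_on U f \<Longrightarrow> (\<And>x. x \<in> U \<Longrightarrow> f x = g x) \<Longrightarrow> smooth_on U g"
  unfolding smooth_on_def by (blast intro: C_on_cong)

lemma smooth_on_subset: "smooth_on U f \<Longrightarrow> V \<subseteq> U \<Longrightarrow> smooth_on V f"
  unfolding smooth_on_def by (blast intro: C_on_subset)

lemma smooth_on_local:
  "(\<And>x. x \<in> U \<Longrightarrow> \<exists>V. open V \<and> x \<in> V \<and> smooth_on V f) \<Longrightarrow> smooth_on U f"
  unfolding smooth_on_def by (rule allI, rule C_on_local) fastforce

lemma smooth_on_imp_continuous_on: "smooth_on U f \<Longrightarrow> continuous_on U f"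
  unfolding smooth_on_def by (drule spec[where x = 0], simp)

lemma smooth_on_has_derivative:
  "smooth_on U f \<Longrightarrow> x \<in> U \<Longrightarrow> (f has_derivative frechet_derivative f (at x)) (at x)"
  unfolding smooth_on_def by (rule C_on_Suc_has_derivative[where k = 0]) blast+

lemma smooth_on_frechet_derivative: "smooth_on U f \<Longrightarrow> smooth_on U (\<lambda>x. frechet_derivative f (at x) v)"
  unfolding smooth_on_def
proof
  fix k
  assume "\<forall>k. C_on k U f"
  then have "C_on (Suc k) U f" by blast
  then show "C_on k U (\<lambda>x. frechet_derivative f (at x) v)" by simp
qed

lemma smooth_on_const [simp]: "open U \<Longrightarrow> smooth_on U (\<lambda>x. c)"
  unfolding smooth_on_def by (simp add: C_on_const)

lemma smooth_on_bounded_linear: "open U \<Longrightarrow> bounded_linear f \<Longrightarrow> smooth_on U f"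
  unfolding smooth_on_def by (simp add: C_on_bounded_linear)

lemma smooth_on_ident [simp]: "open U \<Longrightarrow> smooth_on U (\<lambda>x. x)"
  by (simp add: smooth_on_bounded_linear)

lemma smooth_on_add: "open U \<Longrightarrow> smooth_on U f \<Longrightarrow> smooth_on U g \<Longrightarrow> smooth_on U (\<lambda>x. f x + g x)"
  unfolding smooth_on_def by (simp add: C_on_add)

lemma smooth_on_bilinear:
  "open U \<Longrightarrow> smooth_on U f \<Longrightarrow> smooth_on U g \<Longrightarrow> bounded_bilinear p \<Longrightarrow> smooth_on U (\<lambda>x. p (f x) (g x))"
  unfolding smooth_on_def by (simp add: C_on_bilinear)

lemma smooth_on_mult:
  fixes f g :: "'a::real_normed_vector \<Rightarrow> 'b::real_normed_algebra"
  shows "open U \<Longrightarrow> smooth_on U f \<Longrightarrow> smooth_on U g \<Longrightarrow> smooth_on U (\<lambda>x. f x * g x)"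
  by (simp add: smooth_on_bilinear bounded_bilinear_mult)

lemma smooth_on_compose:
  fixes f :: "'b::euclidean_space \<Rightarrow> 'c::real_normed_vector" and g :: "'a::real_normed_vector \<Rightarrow> 'b"
  shows "open U \<Longrightarrow> open V \<Longrightarrow> smooth_on V f \<Longrightarrow> smooth_on U g \<Longrightarrow> (\<And>x. x \<in> U \<Longrightarrow> g x \<in> V) \<Longrightarrow>
    smooth_on U (\<lambda>x. f (g x))"
  unfolding smooth_on_def by (rule allI, rule C_on_compose[of U V]) auto

lemma smooth_on_linear_compose:
  fixes f :: "'a::real_normed_vector \<Rightarrow> 'b::euclidean_space"
  shows "open U \<Longrightarrow> smooth_on U f \<Longrightarrow> bounded_linear l \<Longrightarrow> smooth_on U (\<lambda>x. l (f x))"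
  by (rule smooth_on_compose[OF _ open_UNIV]) (auto simp: smooth_on_bounded_linear)

lemma smooth_on_diff:
  fixes f g :: "'a::real_normed_vector \<Rightarrow> real"
  shows "open U \<Longrightarrow> smooth_on U f \<Longrightarrow> smooth_on U g \<Longrightarrow> smooth_on U (\<lambda>x. f x - g x)"
  using smooth_on_add[of U f "\<lambda>x. (-1) * g x"] smooth_on_mult[of U "\<lambda>x. -1" g] by simp

lemma smooth_on_Pair:
  fixes f :: "'a::real_normed_vector \<Rightarrow> 'b::euclidean_space" and g :: "'a \<Rightarrow> 'c::euclidean_space"
  assumes "open U" "smooth_on U f" "smooth_on U g"
  shows "smooth_on U (\<lambda>x. (f x, g x))"
proof -
  have "smooth_on U (\<lambda>x. (f x, 0) + (0, g x))"
    by (intro smooth_on_add smooth_on_linear_compose[OF _ assms(2)] smooth_on_linear_compose[OF _ assms(3)] assms(1))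
      (auto intro!: bounded_linear_Pair bounded_linear_zero bounded_linear_ident)
  then show ?thesis by simp
qed

lemma smooth_on_real:
  fixes f :: "real \<Rightarrow> 'a::real_normed_vector"
  assumes "open U" "\<And>x. x \<in> U \<Longrightarrow> (f has_vector_derivative f' x) (at x)" "smooth_on U f'"
  shows "smooth_on U f"
  unfolding smooth_on_def
proof
  fix k
  have "C_on k U f'" using assms(3) by (simp add: smooth_on_def)
  then show "C_on k U f" by (intro C_on_Suc_imp[OF C_on_Suc_vector[OF assms(1,2)]])
qed

lemma smooth_on_vector_derivative:
  fixes f :: "real \<Rightarrow> 'a::real_normed_vector"
  assumes "open U" "smooth_on U f"
  shows "smooth_on U (\<lambda>x. vector_derivative f (at x))"
    and "x \<in> U \<Longrightarrow> (f has_vector_derivative vector_derivative f (at x)) (at x)"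
  using C_on_vector_derivative[OF assms(1)] assms(2) unfolding smooth_on_def by blast+

lemma smooth_on_deriv:
  fixes f :: "real \<Rightarrow> real"
  assumes "open U" "smooth_on U f"
  shows "smooth_on U (deriv f)"
    and "x \<in> U \<Longrightarrow> (f has_real_derivative deriv f x) (at x)"
proof -
  have 1: "(f has_real_derivative deriv f x) (at x)" if "x \<in> U" for x
    using smooth_on_vector_derivative(2)[OF assms that]
    by (metis DERIV_imp_deriv has_real_derivative_iff_has_vector_derivative)
  then show "x \<in> U \<Longrightarrow> (f has_real_derivative deriv f x) (at x)" .
  show "smooth_on U (deriv f)"
    by (rule smooth_on_cong[OF assms(1) smooth_on_vector_derivative(1)[OF assms]])
      (use 1 in \<open>metis has_real_derivative_iff_has_vector_derivative vector_derivative_at\<close>)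
qed

lemma smooth_on_realI:
  fixes f :: "real \<Rightarrow> real"
  shows "open U \<Longrightarrow> (\<And>x. x \<in> U \<Longrightarrow> (f has_real_derivative f' x) (at x)) \<Longrightarrow> smooth_on U f' \<Longrightarrow> smooth_on U f"
  by (rule smooth_on_real) (auto simp: has_real_derivative_iff_has_vector_derivative)

text \<open>A function satisfying a smooth autonomous differential equation gains one derivative from
  each use of the equation.\<close>

lemma smooth_on_ode:
  fixes f :: "real \<Rightarrow> 'a::euclidean_space"
  assumes "open U" "open V" "smooth_on V v" "\<And>x. x \<in> U \<Longrightarrow> f x \<in> V"
    and d: "\<And>x. x \<in> U \<Longrightarrow> (f has_vector_derivative v (f x)) (at x)"
  shows "smooth_on U f"
  unfolding smooth_on_def
proof
  fix k
  show "C_on k U f"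
  proof (induction k)
    case 0
    then show ?case using d
      by (auto intro!: continuous_at_imp_continuous_on has_vector_derivative_continuous)
  next
    case (Suc k)
    have "C_on k U (\<lambda>x. v (f x))"
      by (rule C_on_compose[OF assms(1,2) _ _ Suc]) (use assms in \<open>auto simp: smooth_on_def\<close>)
    with d show ?case by (rule C_on_Suc_vector[OF assms(1)])
  qed
qed

text \<open>The functions \<open>inverse\<close>, \<open>exp\<close>, \<open>cis\<close>,
  \<open>tan\<close> and later the inverse of a lift all solve an autonomous equation, so each is
  smooth by one use of \<open>smooth_on_ode\<close>.\<close>

lemma smooth_on_inverse_fun: "smooth_on {x. x \<noteq> 0} (inverse :: real \<Rightarrow> real)"
proof (rule smooth_on_ode[where V = UNIV and v = "\<lambda>y. - (y * y)"])
  show "smooth_on UNIV (\<lambda>y::real. - (y * y))"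
    using smooth_on_diff[of UNIV "\<lambda>y::real. 0" "\<lambda>y. y * y"] by (simp add: smooth_on_mult)
  show "(inverse has_vector_derivative - (inverse x * inverse x)) (at x)" if "x \<in> {x. x \<noteq> 0}" for x :: real
    using that by (auto simp: has_real_derivative_iff_has_vector_derivative[symmetric]
        intro!: derivative_eq_intros)
qed (auto simp: open_Collect_neq)

lemma smooth_on_inverse:
  fixes f :: "'a::real_normed_vector \<Rightarrow> real"
  shows "open U \<Longrightarrow> smooth_on U f \<Longrightarrow> (\<And>x. x \<in> U \<Longrightarrow> f x \<noteq> 0) \<Longrightarrow> smooth_on U (\<lambda>x. inverse (f x))"
  by (rule smooth_on_compose[OF _ _ smooth_on_inverse_fun]) (auto simp: open_Collect_neq)

lemma smooth_on_divide:
  fixes f :: "'a::real_normed_vector \<Rightarrow> real"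
  shows "open U \<Longrightarrow> smooth_on U f \<Longrightarrow> smooth_on U g \<Longrightarrow> (\<And>x. x \<in> U \<Longrightarrow> g x \<noteq> 0) \<Longrightarrow> smooth_on U (\<lambda>x. f x / g x)"
  by (simp add: divide_inverse smooth_on_mult smooth_on_inverse)

lemma smooth_on_exp_fun: "smooth_on UNIV (exp :: real \<Rightarrow> real)"
  by (rule smooth_on_ode[where V = UNIV and v = "\<lambda>y. y"])
    (auto simp: has_real_derivative_iff_has_vector_derivative[symmetric])

lemma smooth_on_exp:
  fixes f :: "'a::real_normed_vector \<Rightarrow> real"
  shows "open U \<Longrightarrow> smooth_on U f \<Longrightarrow> smooth_on U (\<lambda>x. exp (f x))"
  by (rule smooth_on_compose[OF _ _ smooth_on_exp_fun]) auto

lemma smooth_on_ln_fun: "smooth_on {0<..} (ln :: real \<Rightarrow> real)"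
  by (rule smooth_on_realI[where f' = inverse])
    (auto intro: smooth_on_subset[OF smooth_on_inverse_fun] intro!: derivative_eq_intros simp: divide_inverse)

lemma smooth_on_ln:
  fixes f :: "'a::real_normed_vector \<Rightarrow> real"
  shows "open U \<Longrightarrow> smooth_on U f \<Longrightarrow> (\<And>x. x \<in> U \<Longrightarrow> f x > 0) \<Longrightarrow> smooth_on U (\<lambda>x. ln (f x))"
  by (rule smooth_on_compose[OF _ _ smooth_on_ln_fun]) auto

lemma smooth_on_sqrt:
  fixes f :: "'a::real_normed_vector \<Rightarrow> real"
  assumes "open U" "smooth_on U f" "\<And>x. x \<in> U \<Longrightarrow> f x > 0"
  shows "smooth_on U (\<lambda>x. sqrt (f x))"
proof (rule smooth_on_cong[OF assms(1)])
  show "smooth_on U (\<lambda>x. exp ((1/2) * ln (f x)))"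
    by (intro smooth_on_exp smooth_on_mult smooth_on_ln smooth_on_const assms) auto
  show "exp ((1/2) * ln (f x)) = sqrt (f x)" if "x \<in> U" for x
    using assms(3)[OF that] by (simp add: powr_half_sqrt[symmetric] powr_def)
qed

lemma has_vector_derivative_cis: "(cis has_vector_derivative \<i> * cis t) (at t)"
  unfolding has_vector_derivative_complex_iff by (auto intro!: derivative_eq_intros)

lemma smooth_on_cis_fun: "smooth_on UNIV cis"
  by (rule smooth_on_ode[where V = UNIV and v = "\<lambda>y. \<i> * y"])
    (auto intro!: smooth_on_bounded_linear bounded_linear_intros has_vector_derivative_cis)

lemma smooth_on_cis:
  fixes f :: "'a::real_normed_vector \<Rightarrow> real"
  shows "open U \<Longrightarrow> smooth_on U f \<Longrightarrow> smooth_on U (\<lambda>x. cis (f x))"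
  by (rule smooth_on_compose[OF _ _ smooth_on_cis_fun]) auto

text \<open>Two applications of the mean value theorem, in either order of the variables, write the
  same second difference \<open>D\<close> over a small square as \<open>h * h\<close> times a value
  of \<open>f12\<close> or of \<open>f21\<close> near the corner. Continuity then leaves no room for
  different values at the corner.\<close>

lemma mixed_partials_commute:
  fixes f :: "real \<times> real \<Rightarrow> real"
  assumes U: "open U" "(a, b) \<in> U"
    and d1: "\<And>x y. (x, y) \<in> U \<Longrightarrow> ((\<lambda>s. f (s, y)) has_real_derivative f1 (x, y)) (at x)"
    and d2: "\<And>x y. (x, y) \<in> U \<Longrightarrow> ((\<lambda>t. f (x, t)) has_real_derivative f2 (x, y)) (at y)"
    and d12: "\<And>x y. (x, y) \<in> U \<Longrightarrow> ((\<lambda>t. f1 (x, t)) has_real_derivative f12 (x, y)) (at y)"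
    and d21: "\<And>x y. (x, y) \<in> U \<Longrightarrow> ((\<lambda>s. f2 (s, y)) has_real_derivative f21 (x, y)) (at x)"
    and c: "continuous_on U f12" "continuous_on U f21"
  shows "f12 (a, b) = f21 (a, b)"
proof (rule ccontr)
  assume ne: "f12 (a, b) \<noteq> f21 (a, b)"
  define e where "e = \<bar>f12 (a, b) - f21 (a, b)\<bar> / 2"
  have e: "e > 0" using ne by (simp add: e_def)
  have "isCont f12 (a, b)" "isCont f21 (a, b)"
    using c U continuous_on_eq_continuous_at by blast+
  then obtain r1 r2 where r: "r1 > 0" "\<And>p. dist p (a, b) < r1 \<Longrightarrow> dist (f12 p) (f12 (a, b)) < e"
    "r2 > 0" "\<And>p. dist p (a, b) < r2 \<Longrightarrow> dist (f21 p) (f21 (a, b)) < e"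
    using e unfolding continuous_at_eps_delta by metis
  obtain r3 where r3: "r3 > 0" "ball (a, b) r3 \<subseteq> U" using U openE by blast
  define h where "h = min r1 (min r2 r3) / 3"
  have h: "h > 0" "2 * h < r1" "2 * h < r2" "2 * h < r3" using r r3 by (auto simp: h_def)
  have near: "dist (x, y) (a, b) \<le> 2 * h" if "x \<in> {a..a+h}" "y \<in> {b..b+h}" for x y
  proof -
    have "dist (x, y) (a, b) \<le> dist x a + dist y b"
      unfolding dist_prod_def by (simp add: sqrt_sum_squares_le_sum)
    then show ?thesis using that by (auto simp: dist_real_def)
  qed
  have inU: "(x, y) \<in> U" if "x \<in> {a..a+h}" "y \<in> {b..b+h}" for x y
    using near[OF that] r3(2) h(4) by (auto simp: dist_commute subset_iff)
  define D where "D = f (a+h, b+h) - f (a, b+h) - f (a+h, b) + f (a, b)"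
  have "\<exists>x. a < x \<and> x < a + h \<and>
      (f (a+h, b+h) - f (a+h, b)) - (f (a, b+h) - f (a, b)) = (a + h - a) * (f1 (x, b+h) - f1 (x, b))"
    by (rule MVT2) (use h inU in \<open>auto intro!: DERIV_diff d1\<close>)
  then obtain x where x: "a < x" "x < a + h" "D = h * (f1 (x, b+h) - f1 (x, b))"
    by (auto simp: D_def)
  have "\<exists>y. b < y \<and> y < b + h \<and> f1 (x, b+h) - f1 (x, b) = (b + h - b) * f12 (x, y)"
    by (rule MVT2) (use h x inU in \<open>auto intro!: d12\<close>)
  then obtain y where y: "b < y" "y < b + h" "D = h * (h * f12 (x, y))"
    using x by auto
  have "\<exists>y. b < y \<and> y < b + h \<and>
      (f (a+h, b+h) - f (a, b+h)) - (f (a+h, b) - f (a, b)) = (b + h - b) * (f2 (a+h, y) - f2 (a, y))"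
    by (rule MVT2) (use h inU in \<open>auto intro!: DERIV_diff d2\<close>)
  then obtain y' where y': "b < y'" "y' < b + h" "D = h * (f2 (a+h, y') - f2 (a, y'))"
    by (auto simp: D_def)
  have "\<exists>x. a < x \<and> x < a + h \<and> f2 (a+h, y') - f2 (a, y') = (a + h - a) * f21 (x, y')"
    by (rule MVT2) (use h y' inU in \<open>auto intro!: d21\<close>)
  then obtain x' where x': "a < x'" "x' < a + h" "D = h * (h * f21 (x', y'))"
    using y' by auto
  have "f12 (x, y) = f21 (x', y')" using y x' h by simp
  moreover have "dist (f12 (x, y)) (f12 (a, b)) < e"
    by (rule r(2), rule le_less_trans[OF near]) (use x y h in auto)
  moreover have "dist (f21 (x', y')) (f21 (a, b)) < e"
    by (rule r(4), rule le_less_trans[OF near]) (use x' y' h in auto)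
  ultimately show False by (auto simp: dist_real_def e_def abs_if split: if_splits)
qed

section \<open>A smooth cutoff function\<close>

text \<open>The powers of 1/x make the family closed under differentiation, so one induction on the
  order, with \<open>n\<close> arbitrary, treats all derivatives of exp(-1/x) at once.\<close>

definition flat :: "nat \<Rightarrow> real \<Rightarrow> real" where
  "flat n x = (if x > 0 then exp (- inverse x) * inverse x ^ n else 0)"

text \<open>A single term of the exponential series at 1/x, the one of order \<open>n + 2\<close>,
  already suffices. The two spare powers give a quadratic bound, hence derivative zero at the
  origin.\<close>

lemma flat_bound: "\<bar>flat n x\<bar> \<le> fact (n + 2) * x\<^sup>2"
proof (cases "x > 0")
  case True
  let ?y = "inverse x"
  have y: "?y > 0" using True by simp
  have e: "(\<lambda>k. ?y ^ k /\<^sub>R fact k) sums exp ?y" by (rule exp_converges)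
  have "?y ^ (n+2) /\<^sub>R fact (n+2) \<le> exp ?y"
    using sum_le_suminf[OF sums_summable[OF e], of "{n+2}"] y sums_unique[OF e] by (simp del: fact_Suc)
  then have "?y ^ (n+2) \<le> exp ?y * fact (n+2)"
    using pos_divide_le_eq[of "fact (n+2)" "?y ^ (n+2)" "exp ?y"] by (simp add: divide_inverse mult.commute del: fact_Suc)
  then have "exp (- ?y) * ?y ^ (n+2) \<le> fact (n+2)"
    using mult_left_mono[of "?y ^ (n+2)" "exp ?y * fact (n+2)" "exp (- ?y)"]
    by (simp add: exp_minus field_simps del: fact_Suc power_inverse)
  then have "exp (- ?y) * ?y ^ (n+2) * x\<^sup>2 \<le> fact (n+2) * x\<^sup>2"
    by (rule mult_right_mono) simp
  moreover have "exp (- ?y) * ?y ^ (n+2) * x\<^sup>2 = exp (- ?y) * ?y ^ n"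
    using True by (simp add: power_add field_simps power2_eq_square)
  ultimately have "exp (- ?y) * ?y ^ n \<le> fact (n+2) * x\<^sup>2" by argo
  then show ?thesis using True by (simp add: flat_def del: fact_Suc)
qed (simp add: flat_def)

lemma has_derivative_flat:
  "(flat n has_real_derivative flat (n + 2) x - of_nat n * flat (n + 1) x) (at x)"
proof -
  consider "x > 0" | "x < 0" | "x = 0" by linarith
  then show ?thesis
  proof cases
    case 1
    have "((\<lambda>x. exp (- inverse x) * inverse x ^ n) has_real_derivative flat (n + 2) x - of_nat n * flat (n + 1) x) (at x)"
      using 1 by (auto intro!: derivative_eq_intros simp: flat_def)
        (cases n; simp add: field_simps power2_eq_square)
    then show ?thesis
      by (rule has_field_derivative_transform_within_open[of _ _ _ "{0<..}"]) (use 1 in \<open>auto simp: flat_def\<close>)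
  next
    case 2
    have "((\<lambda>x. 0) has_real_derivative flat (n + 2) x - of_nat n * flat (n + 1) x) (at x)"
      using 2 by (auto simp: flat_def)
    then show ?thesis
      by (rule has_field_derivative_transform_within_open[of _ _ _ "{..<0}"]) (use 2 in \<open>auto simp: flat_def\<close>)
  next
    case 3
    have lim: "((\<lambda>h. fact (n + 2) * \<bar>h\<bar>) \<longlongrightarrow> 0) (at (0::real))"
      by (intro tendsto_eq_intros) auto
    have "((\<lambda>h. (flat n (0 + h) - flat n 0) / h) \<longlongrightarrow> 0) (at 0)"
    proof (rule Lim_null_comparison[OF _ lim], rule always_eventually, rule allI)
      fix h :: real
      show "norm ((flat n (0 + h) - flat n 0) / h) \<le> fact (n + 2) * \<bar>h\<bar>"
        using flat_bound[of n h]
        by (cases "h = 0") (auto simp: flat_def[of n 0] divide_simps power2_eq_square abs_mult mult.assoc simp del: fact_Suc)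
    qed
    then show ?thesis using 3 by (simp add: DERIV_def flat_def)
  qed
qed

lemma smooth_on_flat: "smooth_on UNIV (flat n)"
proof -
  have "C_on k UNIV (flat n)" for k
  proof (induction k arbitrary: n)
    case 0
    then show ?case using has_derivative_flat
      by (auto intro!: continuous_at_imp_continuous_on DERIV_isCont)
  next
    case (Suc k)
    have "C_on k UNIV (\<lambda>x. flat (n + 2) x + - of_nat n * flat (n + 1) x)"
      using Suc by (intro C_on_add C_on_bilinear[OF _ _ _ bounded_bilinear_mult] C_on_const) auto
    then show ?case
      by (intro C_on_Suc_vector[where f' = "\<lambda>x. flat (n + 2) x - of_nat n * flat (n + 1) x"])
        (use has_derivative_flat in \<open>auto simp: has_real_derivative_iff_has_vector_derivative\<close>)
  qed
  then show ?thesis by (simp add: smooth_on_def)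
qed

lemma smooth_cutoff:
  assumes "(a::real) < b"
  shows "\<exists>\<theta>. smooth_on UNIV \<theta> \<and> (\<forall>x. 0 \<le> \<theta> x) \<and> (\<forall>x. \<theta> x \<le> (1::real)) \<and>
    (\<forall>x\<le>a. \<theta> x = 0) \<and> (\<forall>x\<ge>b. \<theta> x = 1)"
proof (intro exI conjI allI impI)
  let ?p = "\<lambda>x. flat 0 (x - a)" and ?q = "\<lambda>x. flat 0 (b - x)"
  have nn: "flat 0 x \<ge> 0" for x by (simp add: flat_def)
  have pos: "?p x + ?q x > 0" for x
    using assms by (auto simp: flat_def add_pos_pos)
  have s: "smooth_on UNIV ?p" "smooth_on UNIV ?q"
    by (rule smooth_on_compose[OF _ _ smooth_on_flat]; simp add: smooth_on_diff)+
  show "smooth_on UNIV (\<lambda>x. ?p x / (?p x + ?q x))"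
    by (intro smooth_on_divide smooth_on_add s) (use pos in \<open>auto simp: less_imp_neq[THEN not_sym]\<close>)
  show "0 \<le> ?p x / (?p x + ?q x)" "?p x / (?p x + ?q x) \<le> 1" for x
    using nn pos[of x] by (auto intro!: divide_nonneg_nonneg)
  show "?p x / (?p x + ?q x) = 0" if "x \<le> a" for x using that by (simp add: flat_def)
  show "?p x / (?p x + ?q x) = 1" if "x \<ge> b" for x using that pos[of x] by (simp add: flat_def)
qed

section \<open>Lifts of circle diffeomorphisms\<close>

lemma cis_eq_iff: "cis s = cis t \<longleftrightarrow> (\<exists>k::int. s = t + 2 * pi * of_int k)"
  using sin_cos_eq_iff[of s t] by (auto simp: complex_eq_iff)

lemma cis_less_2pi: "s < t \<Longrightarrow> t < s + 2 * pi \<Longrightarrow> cis s \<noteq> cis t"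
proof
  assume "s < t" "t < s + 2 * pi" "cis s = cis t"
  then obtain k :: int where k: "s = t + 2 * pi * of_int k" by (auto simp: cis_eq_iff)
  then have "2 * pi * of_int k < 0" "2 * pi * (of_int k + 1) > 0"
    using \<open>s < t\<close> \<open>t < s + 2 * pi\<close> by (auto simp: algebra_simps)
  then have "(of_int k :: real) < 0" "(of_int k :: real) + 1 > 0"
    by (simp_all add: mult_less_0_iff zero_less_mult_iff)
  then have "k < 0" "k + 1 > 0" by linarith+
  then show False by simp
qed

lemma cis_reduce: obtains k :: int where "a \<le> t - 2 * pi * of_int k" "t - 2 * pi * of_int k < a + 2 * pi"
proof
  let ?k = "\<lfloor>(t - a) / (2 * pi)\<rfloor>"
  have "of_int ?k \<le> (t - a) / (2 * pi)" by linarith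
  then have "of_int ?k * (2 * pi) \<le> t - a" by (subst (asm) pos_le_divide_eq) auto
  then show "a \<le> t - 2 * pi * of_int ?k" by argo
  have "(t - a) / (2 * pi) < of_int ?k + 1" by linarith
  then have "t - a < (of_int ?k + 1) * (2 * pi)" by (subst (asm) pos_divide_less_eq) auto
  then show "t - 2 * pi * of_int ?k < a + 2 * pi" by (simp add: algebra_simps)
qed

lemma cis_period [simp]: "cis (t + 2 * pi * of_int k) = cis t" "cis (t - 2 * pi * of_int k) = cis t"
  by (auto simp: cis_eq_iff intro: exI[of _ "k"] exI[of _ "-k"])

lemma S1_cis: "z \<in> S1 \<longleftrightarrow> (\<exists>t. z = cis t)"
proof
  assume "z \<in> S1"
  then have "z = cis (Arg z)" using rcis_cmod_Arg[of z] by (simp add: rcis_def)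
  then show "\<exists>t. z = cis t" by blast
qed auto

definition circle_lift :: "(real \<Rightarrow> real) \<Rightarrow> bool" where
  "circle_lift F \<longleftrightarrow> smooth_on UNIV F \<and> (\<forall>t. deriv F t > 0) \<and> (\<forall>t. F (t + 2 * pi) = F t + 2 * pi)"

lemma periodic_int:
  fixes F :: "real \<Rightarrow> real"
  assumes "\<And>t. F (t + 2 * pi) = F t + c"
  shows "F (t + 2 * pi * of_int k) = F t + c * of_int k"
proof -
  have n: "F (t + 2 * pi * of_nat n) = F t + c * of_nat n" for n t
  proof (induction n)
    case (Suc n)
    have "F (t + 2 * pi * of_nat (Suc n)) = F ((t + 2 * pi * of_nat n) + 2 * pi)" by (simp add: algebra_simps)
    also have "\<dots> = F (t + 2 * pi * of_nat n) + c" by (rule assms)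
    finally show ?case using Suc by (simp add: algebra_simps)
  qed simp
  show ?thesis
  proof (cases "k \<ge> 0")
    case True
    then show ?thesis using n[of t "nat k"] by simp
  next
    case False
    then show ?thesis using n[of "t + 2 * pi * of_int k" "nat (- k)"] by (simp add: algebra_simps)
  qed
qed

lemma circle_lift_smooth: "circle_lift F \<Longrightarrow> smooth_on UNIV F"
  by (simp add: circle_lift_def)

lemma circle_lift_DERIV: "circle_lift F \<Longrightarrow> (F has_real_derivative deriv F t) (at t)"
  using smooth_on_deriv(2)[OF open_UNIV, of F t] by (simp add: circle_lift_def)

lemma circle_lift_pos: "circle_lift F \<Longrightarrow> deriv F t > 0"
  by (simp add: circle_lift_def)

lemma circle_lift_period: "circle_lift F \<Longrightarrow> F (t + 2 * pi) = F t + 2 * pi"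
  by (simp add: circle_lift_def)

lemma circle_lift_period_int: "circle_lift F \<Longrightarrow> F (t + 2 * pi * of_int k) = F t + 2 * pi * of_int k"
  by (rule periodic_int) (simp add: circle_lift_period)

lemma circle_lift_less: "circle_lift F \<Longrightarrow> F s < F t \<longleftrightarrow> s < t"
proof -
  assume F: "circle_lift F"
  have "F s < F t" if "s < t" for s t
    by (rule DERIV_pos_imp_increasing[OF that]) (use F circle_lift_DERIV circle_lift_pos in blast)
  then show ?thesis by (metis less_asym linorder_neqE_linordered_idom)
qed

lemma circle_lift_le: "circle_lift F \<Longrightarrow> F s \<le> F t \<longleftrightarrow> s \<le> t"
  by (metis circle_lift_less not_le)

lemma circle_lift_eq: "circle_lift F \<Longrightarrow> F s = F t \<longleftrightarrow> s = t"
  by (metis circle_lift_less less_irrefl linorder_neqE_linordered_idom)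

lemma circle_lift_isCont: "circle_lift F \<Longrightarrow> isCont F t"
  using circle_lift_DERIV DERIV_isCont by blast

lemma circle_lift_cis: "circle_lift F \<Longrightarrow> cis (F s) = cis (F t) \<longleftrightarrow> cis s = cis t"
  unfolding cis_eq_iff by (metis circle_lift_eq circle_lift_period_int)

lemma circle_lift_surj:
  assumes "circle_lift F"
  shows "\<exists>t. F t = y"
proof -
  obtain k :: int where "F 0 \<le> y - 2 * pi * of_int k" "y - 2 * pi * of_int k < F 0 + 2 * pi"
    using cis_reduce .
  moreover have "F (0 + 2 * pi) = F 0 + 2 * pi" using circle_lift_period[OF assms] .
  ultimately obtain t where "F t = y - 2 * pi * of_int k"
    using IVT'[of F 0 "y - 2 * pi * of_int k" "2 * pi"] circle_lift_isCont[OF assms]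
    by (auto simp: continuous_at_imp_continuous_on)
  then show ?thesis using circle_lift_period_int[OF assms, of t k] by auto
qed

lemma circle_lift_inverse:
  assumes F: "circle_lift F"
  obtains G where "circle_lift G" "\<And>t. G (F t) = t" "\<And>t. F (G t) = t"
proof
  define G where "G = inv_into UNIV F"
  show FG: "F (G t) = t" for t
    unfolding G_def using circle_lift_surj[OF F] by (metis f_inv_into_f rangeI)
  show GF: "G (F t) = t" for t
    using FG circle_lift_eq[OF F] by blast
  have cont: "isCont G y" for y
    using isCont_inverse_function[of 1 "G y" G F] GF circle_lift_isCont[OF F] FG by auto
  have d: "(G has_real_derivative inverse (deriv F (G y))) (at y)" for y
    by (rule DERIV_inverse_function[where a = "y - 1" and b = "y + 1"])
      (use circle_lift_DERIV[OF F] circle_lift_pos[OF F, of "G y"] FG cont in auto)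
  have s: "smooth_on UNIV (deriv F)" using F smooth_on_deriv by (simp add: circle_lift_def)
  have "smooth_on UNIV G"
    by (rule smooth_on_ode[where V = UNIV and v = "\<lambda>x. inverse (deriv F x)"])
      (use d s circle_lift_pos[OF F] in \<open>auto intro!: smooth_on_inverse
        simp: has_real_derivative_iff_has_vector_derivative[symmetric] less_imp_neq[THEN not_sym]\<close>)
  moreover have "deriv G y > 0" for y
    using DERIV_imp_deriv[OF d] circle_lift_pos[OF F] by simp
  moreover have "G (y + 2 * pi) = G y + 2 * pi" for y
    using circle_lift_period[OF F, of "G y"] FG GF by metis
  ultimately show "circle_lift G" by (simp add: circle_lift_def)
qed

lemma deriv_compose:
  fixes f g :: "real \<Rightarrow> real"
  assumes "(g has_real_derivative g') (at x)" "(f has_real_derivative f') (at (g x))"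
  shows "deriv (\<lambda>x. f (g x)) x = f' * g'"
  by (rule DERIV_imp_deriv) (use DERIV_chain2[OF assms(2,1)] in simp)

lemma circle_lift_compose:
  assumes "circle_lift F" "circle_lift G"
  shows "circle_lift (\<lambda>t. F (G t))" "deriv (\<lambda>t. F (G t)) t = deriv F (G t) * deriv G t"
proof -
  show d: "deriv (\<lambda>t. F (G t)) t = deriv F (G t) * deriv G t" for t
    by (intro deriv_compose circle_lift_DERIV assms)
  show "circle_lift (\<lambda>t. F (G t))"
    unfolding circle_lift_def d using assms
    using smooth_on_compose[OF open_UNIV open_UNIV circle_lift_smooth circle_lift_smooth, of F G]
    by (auto simp: circle_lift_period circle_lift_pos)
qed

lemma circle_lift_shift: "circle_lift (\<lambda>t. t + c)" "deriv (\<lambda>t. t + c) t = 1"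
proof -
  show d: "deriv (\<lambda>t. t + c) t = 1" for t
    by (rule DERIV_imp_deriv) (auto intro!: derivative_eq_intros)
  show "circle_lift (\<lambda>t. t + c)"
    unfolding circle_lift_def d by (auto intro!: smooth_on_add)
qed

text \<open>Restricting to \<open>S1\<close> makes the map extensional, as membership in
  \<open>Bij S1\<close> demands.\<close>

definition circle_map :: "(real \<Rightarrow> real) \<Rightarrow> complex \<Rightarrow> complex" where
  "circle_map F = (\<lambda>z\<in>S1. cis (F (Arg z)))"

lemma circle_map_cis:
  assumes "circle_lift F"
  shows "circle_map F (cis t) = cis (F t)"
proof -
  have "cis (Arg (cis t)) = cis t" using rcis_cmod_Arg[of "cis t"] by (simp add: rcis_def)
  then show ?thesis using circle_lift_cis[OF assms] by (simp add: circle_map_def)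
qed

lemma circle_map_Bij:
  assumes F: "circle_lift F"
  shows "circle_map F \<in> Bij S1"
proof -
  have "inj_on (circle_map F) S1"
  proof (rule inj_onI)
    fix z w assume "z \<in> S1" "w \<in> S1" and eq: "circle_map F z = circle_map F w"
    then obtain s t where "z = cis s" "w = cis t" using S1_cis by blast
    then show "z = w" using eq by (simp add: circle_map_cis[OF F] circle_lift_cis[OF F])
  qed
  moreover have "circle_map F ` S1 = S1"
  proof (intro equalityI subsetI)
    show "z \<in> circle_map F ` S1 \<Longrightarrow> z \<in> S1" for z
      by (auto simp: circle_map_def)
    fix z assume "z \<in> S1"
    then obtain t where "z = cis (F t)" using S1_cis circle_lift_surj[OF F] by metis
    then show "z \<in> circle_map F ` S1" using circle_map_cis[OF F, of t]
      by (intro image_eqI[of _ _ "cis t"]) auto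
  qed
  ultimately show ?thesis by (auto simp: Bij_def bij_betw_def circle_map_def)
qed

lemma circle_deriv_cis:
  assumes "(F has_real_derivative F') (at s)" "\<And>t. f (cis t) = cis (F t)"
  shows "circle_deriv f (cis s) = F'"
proof -
  have 1: "(\<lambda>t. f (cis s * cis t)) = (\<lambda>t. cis (F (s + t)))"
    by (simp add: cis_mult assms)
  have "((\<lambda>t. F (s + t)) has_real_derivative F') (at 0)"
    using assms(1) using DERIV_shift[of F F' 0 s] by (simp add: add.commute[of s])
  then have "((\<lambda>t. F (s + t)) has_derivative (\<lambda>v. v * F')) (at 0)"
    by (simp add: has_field_derivative_def mult_commute_abs)
  from has_derivative_cis[OF this] have "((\<lambda>t. cis (F (s + t))) has_vector_derivative F' *\<^sub>R (\<i> * cis (F s))) (at 0)"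
    by (simp add: has_vector_derivative_def)
  from vector_derivative_at[OF this] show ?thesis
    unfolding circle_deriv_def 1 by (simp add: assms(2) scaleR_conv_of_real)
qed

lemma circle_map_Diff_S1:
  assumes F: "circle_lift F"
  shows "circle_map F \<in> carrier Diff_S1"
proof -
  have smooth: "smooth_circle_map f" if "circle_lift F" "\<And>t. f (cis t) = cis (F t)" for f F
  proof -
    have "f z \<in> S1" if "z \<in> S1" for z
      using that \<open>\<And>t. f (cis t) = cis (F t)\<close> S1_cis by metis
    then show ?thesis
      unfolding smooth_circle_map_def
      using that(2) smooth_on_cis[OF open_UNIV circle_lift_smooth[OF that(1)]] by auto
  qed
  obtain G where G: "circle_lift G" "\<And>t. G (F t) = t" "\<And>t. F (G t) = t"
    using circle_lift_inverse[OF F] by blast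
  have inj: "inj_on (circle_map F) S1" using circle_map_Bij[OF F] by (simp add: Bij_def bij_betw_def)
  have "inv_into S1 (circle_map F) (cis t) = cis (G t)" for t
    using inv_into_f_f[OF inj, of "cis (G t)"] circle_map_cis[OF F, of "G t"] G(3) by simp
  then have "smooth_circle_map (restrict (inv_into S1 (circle_map F)) S1)"
    by (intro smooth[OF G(1)]) simp
  moreover have "circle_deriv (circle_map F) z > 0" if "z \<in> S1" for z
    using that circle_deriv_cis[OF circle_lift_DERIV[OF F] circle_map_cis[OF F]] circle_lift_pos[OF F] S1_cis
    by metis
  ultimately show ?thesis
    using circle_map_Bij[OF F] smooth[OF F circle_map_cis[OF F]] by (simp add: Diff_S1_def)
qed

lemma smooth_antiderivative:
  fixes f :: "real \<Rightarrow> real"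
  assumes "smooth_on UNIV f"
  obtains F where "\<And>t. (F has_real_derivative f t) (at t)" "smooth_on UNIV F" "F a = c"
proof -
  have "continuous_on UNIV f" using smooth_on_imp_continuous_on[OF assms] .
  then obtain g where g: "\<And>t. (g has_real_derivative f t) (at t)"
    using einterval_antiderivative[of "-\<infinity>" "\<infinity>" f]
    by (auto simp: continuous_on_eq_continuous_at has_real_derivative_iff_has_vector_derivative)
  show thesis
  proof
    show 1: "((\<lambda>t. g t - g a + c) has_real_derivative f t) (at t)" for t
      using g by (auto intro!: derivative_eq_intros)
    show "smooth_on UNIV (\<lambda>t. g t - g a + c)"
      by (rule smooth_on_realI[OF _ 1 assms]) simp
  qed simp
qed

text \<open>A curve \<open>g\<close> on the unit circle satisfies g' = i \<phi> g with real angular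
  speed \<open>\<phi>\<close>. Integrating \<open>\<phi>\<close> from an angle of \<open>g 0\<close>
  gives the lift, since \<open>g t * cis (- F t)\<close> has derivative zero. Over a period
  \<open>F\<close> grows by a positive multiple of \<open>2 * pi\<close> because
  \<open>\<phi>\<close> is positive, and injectivity of \<open>f\<close> makes it a single
  turn.\<close>

lemma Diff_S1_lift:
  assumes f: "f \<in> carrier Diff_S1"
  obtains F where "circle_lift F" "\<And>t. f (cis t) = cis (F t)"
proof -
  define g where "g = (\<lambda>t. f (cis t))"
  define g' where "g' = (\<lambda>t. vector_derivative g (at t))"
  have bij: "bij_betw f S1 S1" and sm: "smooth_on UNIV g"
    and pos: "\<And>z. z \<in> S1 \<Longrightarrow> circle_deriv f z > 0"
    using f by (auto simp: Diff_S1_def Bij_def smooth_circle_map_def g_def)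
  have g1: "norm (g t) = 1" for t
    using bij_betwE[OF bij] by (simp add: g_def)
  have d: "(g has_vector_derivative g' t) (at t)" for t
    unfolding g'_def using smooth_on_vector_derivative(2)[OF open_UNIV sm] by simp
  have sg': "smooth_on UNIV g'"
    unfolding g'_def using smooth_on_vector_derivative(1)[OF open_UNIV sm] .
  define \<phi> where "\<phi> = (\<lambda>t. Im (cnj (g t) * g' t))"
  have s\<phi>: "smooth_on UNIV \<phi>"
    unfolding \<phi>_def
    by (intro smooth_on_linear_compose[OF _ _ bounded_linear_Im] smooth_on_mult
      smooth_on_linear_compose[OF _ sm bounded_linear_cnj] sg') auto
  have cnj1: "g t * cnj (g t) = 1" for t
    using g1[of t] by (simp add: complex_norm_square[symmetric])
  have "((\<lambda>t. g t * cnj (g t)) has_vector_derivative g t * cnj (g' t) + g' t * cnj (g t)) (at t)" for t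
    by (intro has_vector_derivative_mult d has_vector_derivative_cnj)
  then have "((\<lambda>t. 1) has_vector_derivative g t * cnj (g' t) + g' t * cnj (g t)) (at t)" for t
    by (simp add: cnj1)
  then have "g t * cnj (g' t) + g' t * cnj (g t) = 0" for t
    using vector_derivative_unique_at has_vector_derivative_const by metis
  then have "2 * Re (cnj (g t) * g' t) = 0" for t
    by (simp add: complex_eq_iff algebra_simps)
  then have "Re (cnj (g t) * g' t) = 0" for t by (metis mult_eq_0_iff zero_neq_numeral)
  then have "cnj (g t) * g' t = \<i> * \<phi> t" for t
    by (simp add: complex_eq_iff \<phi>_def)
  then have g'eq: "g' t = \<i> * \<phi> t * g t" for t
    using cnj1[of t] by (metis (no_types, lifting) mult.assoc mult.commute mult.left_neutral)
  have "norm (g 0) = 1" by (rule g1)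
  then obtain c where c: "g 0 = cis c" using S1_cis[of "g 0"] by auto
  obtain F where F: "\<And>t. (F has_real_derivative \<phi> t) (at t)" "smooth_on UNIV F" "F 0 = c"
    using smooth_antiderivative[OF s\<phi>, where a = 0 and c = c] by blast
  have "((\<lambda>t. g t * cis (- F t)) has_vector_derivative 0) (at t)" for t
  proof -
    have "((\<lambda>t. - F t) has_derivative (\<lambda>v. v *\<^sub>R (- \<phi> t))) (at t)"
      using DERIV_minus[OF F(1)[of t]]
      unfolding has_real_derivative_iff_has_vector_derivative has_vector_derivative_def .
    from has_derivative_cis[OF this] have "((\<lambda>t. cis (- F t)) has_vector_derivative (- \<phi> t) *\<^sub>R (\<i> * cis (- F t))) (at t)"
      by (simp add: has_vector_derivative_def)
    from has_vector_derivative_mult[OF d this] show ?thesis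
      by (simp add: g'eq scaleR_conv_of_real algebra_simps)
  qed
  then obtain k where k: "\<And>t. g t * cis (- F t) = k"
    using has_vector_derivative_zero_constant[of UNIV "\<lambda>t. g t * cis (- F t)"] by auto
  have "k = 1" using k[of 0] F(3) c by (simp add: cis_mult)
  then have gF: "g t = cis (F t)" for t
    using k[of t] by (simp add: cis_inverse[symmetric] field_simps)
  have dF: "deriv F t = \<phi> t" for t using DERIV_imp_deriv[OF F(1)] .
  have \<phi>pos: "\<phi> t > 0" for t
    using circle_deriv_cis[OF F(1), of f t] gF pos[of "cis t"] by (simp add: g_def)
  have mono: "F s < F t" if "s < t" for s t
    by (rule DERIV_pos_imp_increasing[OF that]) (use F(1) \<phi>pos in blast)
  have inj: "cis s = cis t" if "cis (F s) = cis (F t)" for s t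
    using that gF bij_betw_imp_inj_on[OF bij] by (auto simp: inj_on_def g_def)
  have cont: "isCont F t" for t using F(1) DERIV_isCont by blast
  have "F (t + 2 * pi) = F t + 2 * pi" for t
  proof -
    have "cis (t + 2 * pi) = cis t" using cis_period(1)[of t 1] by simp
    then have "g (t + 2 * pi) = g t" by (simp add: g_def)
    then have "cis (F (t + 2 * pi)) = cis (F t)" by (simp only: gF)
    then obtain m :: int where m: "F (t + 2 * pi) = F t + 2 * pi * of_int m" using cis_eq_iff by blast
    have "2 * pi * of_int m > 0" using mono[of t "t + 2 * pi"] m by simp
    then have "m > 0" by (simp add: zero_less_mult_iff)
    \<comment> \<open>With two or more turns the value \<open>F t + 2 * pi\<close> would be taken
      strictly inside the period, so \<open>f\<close> would take one value twice.\<close>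
    moreover have "\<not> m > 1"
    proof
      assume "m > 1"
      then have "2 * pi * 1 < 2 * pi * of_int m" by (intro mult_strict_left_mono) auto
      then obtain s where s: "t \<le> s" "s \<le> t + 2 * pi" "F s = F t + 2 * pi"
        using IVT'[of F t "F t + 2 * pi" "t + 2 * pi"] m cont by (auto simp: continuous_at_imp_continuous_on)
      then have "s \<noteq> t" "s \<noteq> t + 2 * pi" using m \<open>2 * pi * 1 < 2 * pi * of_int m\<close> by auto
      moreover have "cis (F t) = cis (F s)" using s(3) cis_period(1)[of "F t" 1] by simp
      ultimately have "t < s" "s < t + 2 * pi" "cis t = cis s" using inj[of t s] s by auto
      then show False using cis_less_2pi by blast
    qed
    ultimately have "m = 1" by simp
    then show ?thesis using m by simp
  qed
  then have "circle_lift F" using F(2) \<phi>pos dF by (simp add: circle_lift_def)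
  then show thesis using that gF by (simp add: g_def)
qed

section \<open>The Schwarzian derivative and its cocycle rule\<close>

definition nonlin :: "(real \<Rightarrow> real) \<Rightarrow> real \<Rightarrow> real" where
  "nonlin f s = deriv (deriv f) s / deriv f s"

text \<open>Written through the nonlinearity, the composition rule follows by differentiating
  \<open>nonlin_compose\<close> once; \<open>schwarzian_eq_sch\<close> gives the agreement with
  \<open>schwarzian\<close>.\<close>

definition sch :: "(real \<Rightarrow> real) \<Rightarrow> real \<Rightarrow> real" where
  "sch f s = deriv (nonlin f) s - (nonlin f s)\<^sup>2 / 2"

lemma deriv_cong_open:
  fixes f g :: "real \<Rightarrow> real"
  assumes "open U" "\<And>x. x \<in> U \<Longrightarrow> f x = g x" "x \<in> U"
  shows "deriv f x = deriv g x"
  by (rule deriv_cong_ev) (use assms in \<open>auto simp: eventually_nhds\<close>)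

lemma nonlin_cong_open:
  assumes "open U" "\<And>x. x \<in> U \<Longrightarrow> f x = g x" "x \<in> U"
  shows "nonlin f x = nonlin g x"
proof -
  have 1: "deriv f x = deriv g x" if "x \<in> U" for x
    using deriv_cong_open[OF assms(1,2) that] .
  show ?thesis
    using deriv_cong_open[OF assms(1) 1 assms(3)] 1[OF assms(3)] by (simp add: nonlin_def)
qed

lemma sch_cong_open:
  assumes "open U" "\<And>x. x \<in> U \<Longrightarrow> f x = g x" "x \<in> U"
  shows "sch f x = sch g x"
proof -
  have 1: "nonlin f x = nonlin g x" if "x \<in> U" for x
    using nonlin_cong_open[OF assms(1,2) that] .
  show ?thesis
    using deriv_cong_open[OF assms(1) 1 assms(3)] 1[OF assms(3)] by (simp add: sch_def)
qed

lemma nonlin_shift: "nonlin (\<lambda>t. t + c) s = 0"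
proof -
  have "deriv (\<lambda>t. t + c) = (\<lambda>_. 1)" using circle_lift_shift(2) by auto
  then show ?thesis by (simp add: nonlin_def)
qed

lemma sch_shift: "sch (\<lambda>t. t + c) s = 0"
proof -
  have "nonlin (\<lambda>t. t + c) = (\<lambda>_. 0)" using nonlin_shift by auto
  then show ?thesis by (simp add: sch_def)
qed

lemma smooth_on_nonlin:
  assumes "open U" "smooth_on U f" "\<And>x. x \<in> U \<Longrightarrow> deriv f x \<noteq> 0"
  shows "smooth_on U (nonlin f)"
  unfolding nonlin_def by (intro smooth_on_divide smooth_on_deriv(1) assms)

lemma smooth_on_sch:
  assumes "open U" "smooth_on U f" "\<And>x. x \<in> U \<Longrightarrow> deriv f x \<noteq> 0"
  shows "smooth_on U (sch f)"
proof -
  have "smooth_on U (\<lambda>s. deriv (nonlin f) s - (nonlin f s * nonlin f s) * (1/2))"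
    by (intro smooth_on_diff smooth_on_mult smooth_on_const smooth_on_deriv(1) smooth_on_nonlin assms)
  then show ?thesis by (rule smooth_on_cong[OF assms(1)]) (simp add: sch_def power2_eq_square)
qed

lemma schwarzian_eq_sch:
  assumes "open U" "smooth_on U f" "\<And>x. x \<in> U \<Longrightarrow> deriv f x \<noteq> 0" "x \<in> U"
  shows "schwarzian f x = sch f x"
proof -
  have s1: "smooth_on U (deriv f)" and s2: "smooth_on U (deriv (deriv f))"
    using smooth_on_deriv(1) assms by blast+
  have d: "(deriv f has_real_derivative deriv (deriv f) x) (at x)"
    "(deriv (deriv f) has_real_derivative deriv (deriv (deriv f)) x) (at x)"
    using smooth_on_deriv(2) assms s1 s2 by blast+
  have "(nonlin f has_real_derivative
      (deriv (deriv (deriv f)) x * deriv f x - deriv (deriv f) x * deriv (deriv f) x) / (deriv f x * deriv f x)) (at x)"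
    unfolding nonlin_def by (rule DERIV_divide[OF d(2,1) assms(3)[OF assms(4)]])
  from DERIV_imp_deriv[OF this] show ?thesis
    using assms(3)[OF assms(4)]
    by (simp add: schwarzian_def sch_def nonlin_def numeral_3_eq_3 numeral_2_eq_2 field_simps)
qed

lemma deriv_compose_on:
  fixes f g :: "real \<Rightarrow> real"
  assumes "open U" "open V" "smooth_on V f" "smooth_on U g" "\<And>x. x \<in> U \<Longrightarrow> g x \<in> V" "x \<in> U"
  shows "deriv (\<lambda>x. f (g x)) x = deriv f (g x) * deriv g x"
  using assms by (intro deriv_compose smooth_on_deriv(2)) auto

lemma nonlin_compose:
  fixes f g :: "real \<Rightarrow> real"
  assumes "open U" "open V" "smooth_on V f" "smooth_on U g" "\<And>x. x \<in> U \<Longrightarrow> g x \<in> V" "x \<in> U"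
    "deriv f (g x) \<noteq> 0" "deriv g x \<noteq> 0"
  shows "nonlin (\<lambda>x. f (g x)) x = nonlin f (g x) * deriv g x + nonlin g x"
proof -
  have 1: "deriv (deriv (\<lambda>x. f (g x))) x = deriv (\<lambda>x. deriv f (g x) * deriv g x) x"
    using deriv_compose_on[OF assms(1-5)] by (intro deriv_cong_open[OF assms(1) _ assms(6)])
  have d: "((\<lambda>x. deriv f (g x)) has_real_derivative deriv (deriv f) (g x) * deriv g x) (at x)"
    using smooth_on_deriv(2)[OF assms(2) smooth_on_deriv(1)[OF assms(2,3)] assms(5)[OF assms(6)]]
      smooth_on_deriv(2)[OF assms(1,4,6)] by (rule DERIV_chain2)
  have "deriv (\<lambda>x. deriv f (g x) * deriv g x) x =
      deriv (deriv f) (g x) * deriv g x * deriv g x + deriv (deriv g) x * deriv f (g x)"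
    by (intro DERIV_imp_deriv DERIV_mult d smooth_on_deriv(2)[OF assms(1) smooth_on_deriv(1)[OF assms(1,4)] assms(6)])
  then show ?thesis
    using assms(7,8) 1 deriv_compose_on[OF assms(1-6)] by (simp add: nonlin_def field_simps)
qed

lemma sch_compose:
  fixes f g :: "real \<Rightarrow> real"
  assumes UV: "open U" "open V" and f: "smooth_on V f" and g: "smooth_on U g"
    and sub: "\<And>x. x \<in> U \<Longrightarrow> g x \<in> V" and x: "x \<in> U"
    and nz: "\<And>y. y \<in> V \<Longrightarrow> deriv f y \<noteq> 0" "\<And>x. x \<in> U \<Longrightarrow> deriv g x \<noteq> 0"
  shows "sch (\<lambda>x. f (g x)) x = sch f (g x) * (deriv g x)\<^sup>2 + sch g x"
proof -
  have n: "nonlin (\<lambda>x. f (g x)) x = nonlin f (g x) * deriv g x + nonlin g x" if "x \<in> U" for x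
    using nonlin_compose[OF UV f g sub that nz(1)[OF sub[OF that]] nz(2)[OF that]] .
  have d: "(nonlin f has_real_derivative deriv (nonlin f) (g x)) (at (g x))"
    "(nonlin g has_real_derivative deriv (nonlin g) x) (at x)"
    "(deriv g has_real_derivative deriv (deriv g) x) (at x)"
    "(g has_real_derivative deriv g x) (at x)"
    using smooth_on_deriv(2)[OF UV(2) smooth_on_nonlin[OF UV(2) f nz(1)] sub[OF x]]
      smooth_on_deriv(2)[OF UV(1) smooth_on_nonlin[OF UV(1) g nz(2)] x]
      smooth_on_deriv(2)[OF UV(1) smooth_on_deriv(1)[OF UV(1) g] x] smooth_on_deriv(2)[OF UV(1) g x] by auto
  have "((\<lambda>x. nonlin f (g x) * deriv g x + nonlin g x) has_real_derivative
      (deriv (nonlin f) (g x) * deriv g x) * deriv g x + deriv (deriv g) x * nonlin f (g x) + deriv (nonlin g) x) (at x)"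
    by (intro DERIV_add DERIV_mult d DERIV_chain2[OF d(1) d(4)])
  moreover have "deriv (nonlin (\<lambda>x. f (g x))) x = deriv (\<lambda>x. nonlin f (g x) * deriv g x + nonlin g x) x"
    using n by (rule deriv_cong_open[OF UV(1) _ x])
  ultimately have "deriv (nonlin (\<lambda>x. f (g x))) x =
      (deriv (nonlin f) (g x) * deriv g x) * deriv g x + deriv (deriv g) x * nonlin f (g x) + deriv (nonlin g) x"
    by (simp add: DERIV_imp_deriv)
  moreover have "deriv (deriv g) x = nonlin g x * deriv g x" using nz(2)[OF x] by (simp add: nonlin_def)
  ultimately show ?thesis
    using n[OF x] by (simp add: sch_def power2_eq_square field_simps)
qed

section \<open>The projective structure induced by a lift\<close>

lemma smooth_on_tan_fun: "smooth_on {x::real. cos x \<noteq> 0} tan"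
proof (rule smooth_on_ode[where V = UNIV and v = "\<lambda>y. 1 + y * y"])
  show "open {x::real. cos x \<noteq> 0}" by (intro open_Collect_neq continuous_intros)
  show "(tan has_vector_derivative 1 + tan x * tan x) (at x)" if "x \<in> {x. cos x \<noteq> 0}" for x :: real
    using that DERIV_tan[of x] tan_sec[of x]
    by (simp add: has_real_derivative_iff_has_vector_derivative[symmetric] power2_eq_square inverse_eq_divide)
qed (auto intro!: smooth_on_add smooth_on_mult)

text \<open>The chart \<open>proj_chart (cis b)\<close> read in the angular coordinate;
  \<open>tan2_dom b\<close> leaves out its poles.\<close>

definition tan2 :: "real \<Rightarrow> real \<Rightarrow> real" where
  "tan2 b t = tan ((t - b) / 2)"

definition tan2_dom :: "real \<Rightarrow> real set" where
  "tan2_dom b = {t. cos ((t - b) / 2) \<noteq> 0}"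

lemma open_tan2_dom: "open (tan2_dom b)"
  unfolding tan2_dom_def by (intro open_Collect_neq continuous_intros) auto

lemma smooth_on_tan2: "smooth_on (tan2_dom b) (tan2 b)"
proof -
  have 1: "smooth_on (tan2_dom b) (\<lambda>t. (t - b) * (1/2))"
    by (intro smooth_on_mult smooth_on_diff smooth_on_const smooth_on_ident open_tan2_dom)
  have "smooth_on (tan2_dom b) (\<lambda>t. tan ((t - b) * (1/2)))"
    by (rule smooth_on_compose[OF open_tan2_dom _ smooth_on_tan_fun 1])
      (auto simp: tan2_dom_def intro!: open_Collect_neq continuous_intros)
  then show ?thesis by (simp add: tan2_def[abs_def])
qed

lemma deriv_tan2: "t \<in> tan2_dom b \<Longrightarrow> deriv (tan2 b) t = (1 + (tan2 b t)\<^sup>2) / 2"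
proof -
  assume t: "t \<in> tan2_dom b"
  then have "cos ((t - b) / 2) \<noteq> 0" by (simp add: tan2_dom_def)
  then have "(tan2 b has_real_derivative inverse ((cos ((t - b) / 2))\<^sup>2) * (1/2)) (at t)"
    unfolding tan2_def[abs_def] by (auto intro!: derivative_eq_intros)
  then show ?thesis
    using \<open>cos ((t - b) / 2) \<noteq> 0\<close> tan_sec[of "(t - b) / 2"]
    by (simp add: DERIV_imp_deriv tan2_def inverse_eq_divide power_one_over)
qed

lemma deriv_tan2_pos: "t \<in> tan2_dom b \<Longrightarrow> deriv (tan2 b) t > 0"
  by (simp add: deriv_tan2 add_pos_nonneg)

text \<open>On its domain \<open>tan2 b\<close> is its own nonlinearity, so the squares cancel and
  only the constant term of \<open>deriv (tan2 b) t\<close> survives. It is the origin of the term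
  added to \<open>sch\<close> in \<open>proj_sch\<close>.\<close>

lemma sch_tan2:
  assumes t: "t \<in> tan2_dom b"
  shows "sch (tan2 b) t = 1 / 2"
proof -
  have D: "(tan2 b has_real_derivative (1 + (tan2 b t)\<^sup>2) / 2) (at t)" if "t \<in> tan2_dom b" for t
    using smooth_on_deriv(2)[OF open_tan2_dom smooth_on_tan2 that] deriv_tan2[OF that] by simp
  have "deriv (deriv (tan2 b)) t = tan2 b t * (1 + (tan2 b t)\<^sup>2) / 2" if t: "t \<in> tan2_dom b" for t
  proof -
    have "deriv (deriv (tan2 b)) t = deriv (\<lambda>t. (1 + (tan2 b t)\<^sup>2) / 2) t"
      by (rule deriv_cong_open[OF open_tan2_dom deriv_tan2 t])
    also have "\<dots> = tan2 b t * (1 + (tan2 b t)\<^sup>2) / 2"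
      by (rule DERIV_imp_deriv) (use D[OF t] in \<open>auto intro!: derivative_eq_intros\<close>)
    finally show ?thesis .
  qed
  then have nl: "nonlin (tan2 b) t = tan2 b t" if "t \<in> tan2_dom b" for t
    using deriv_tan2_pos[OF that] that by (simp add: nonlin_def deriv_tan2)
  have "deriv (nonlin (tan2 b)) t = (1 + (tan2 b t)\<^sup>2) / 2"
    using deriv_cong_open[OF open_tan2_dom nl t] deriv_tan2[OF t] by simp
  then show ?thesis using nl[OF t] by (simp add: sch_def field_simps)
qed

text \<open>The Schwarzian derivative of \<open>tan (H / 2)\<close>, that is of \<open>H\<close> read in a projective chart of the
  target.\<close>

definition proj_sch :: "(real \<Rightarrow> real) \<Rightarrow> real \<Rightarrow> real" where
  "proj_sch H s = sch H s + (deriv H s)\<^sup>2 / 2"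

lemma sch_tan2_compose:
  assumes "open U" "smooth_on U H" "\<And>s. s \<in> U \<Longrightarrow> deriv H s \<noteq> 0" "s \<in> U" "H s \<in> tan2_dom b"
  shows "sch (\<lambda>s. tan2 b (H s)) s = proj_sch H s"
proof -
  have U: "open (U \<inter> H -` tan2_dom b)"
    using continuous_open_preimage[OF smooth_on_imp_continuous_on[OF assms(2)] assms(1) open_tan2_dom] .
  have "sch (\<lambda>s. tan2 b (H s)) s = sch (tan2 b) (H s) * (deriv H s)\<^sup>2 + sch H s"
    by (rule sch_compose[OF U open_tan2_dom smooth_on_tan2])
      (use assms deriv_tan2_pos in \<open>auto intro: smooth_on_subset simp: less_imp_neq[THEN not_sym]\<close>)
  then show ?thesis using sch_tan2[OF assms(5)] by (simp add: proj_sch_def)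
qed

lemma proj_sch_compose:
  assumes H: "circle_lift H" and F: "circle_lift F"
  shows "proj_sch (\<lambda>s. H (F s)) s = proj_sch H (F s) * (deriv F s)\<^sup>2 + sch F s"
proof -
  have nz: "deriv H s \<noteq> 0" "deriv F s \<noteq> 0" for s
    using circle_lift_pos[OF H] circle_lift_pos[OF F] by (metis less_irrefl)+
  have "sch (\<lambda>s. H (F s)) s = sch H (F s) * (deriv F s)\<^sup>2 + sch F s"
    by (rule sch_compose[of UNIV UNIV]) (use nz in \<open>auto intro: circle_lift_smooth H F\<close>)
  then show ?thesis
    by (simp add: proj_sch_def circle_lift_compose(2)[OF H F] power_mult_distrib field_simps)
qed

lemma conj_by_cis:
  assumes H: "circle_lift H" and F: "circle_lift F" "f \<in> Bij S1" "\<And>t. f (cis t) = cis (F t)"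
  shows "conj_by (circle_map H) f (cis (H t)) = cis (H (F t))"
proof -
  have B: "circle_map H \<in> Bij S1" using circle_map_Bij[OF H] .
  define I where "I = restrict (inv_into S1 (circle_map H)) S1"
  have "inv_into S1 (circle_map H) (cis (H t)) = cis t"
    using inv_into_f_f[of "circle_map H" S1 "cis t"] B circle_map_cis[OF H, of t]
    by (simp add: Bij_def bij_betw_def)
  then have I: "I (cis (H t)) = cis t" by (simp add: I_def)
  have IB: "I \<in> Bij S1" unfolding I_def using restrict_inv_into_Bij[OF B] by simp
  have mult: "x \<otimes>\<^bsub>BijGroup S1\<^esub> y = compose S1 x y" if "x \<in> Bij S1" "y \<in> Bij S1" for x y
    using that by (simp add: BijGroup_def)
  have "conj_by (circle_map H) f = compose S1 (compose S1 (circle_map H) f) I"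
    unfolding conj_by_def inv_BijGroup[OF B] I_def[symmetric]
    by (simp only: mult B F(2) IB compose_Bij)
  then show ?thesis
    by (simp add: compose_def I F(3) circle_map_cis[OF H])
qed

text \<open>In charts the conjugate is the map \<open>g\<close> with \<open>g (A t) = B t\<close>,
  where \<open>A\<close> and \<open>B\<close> are \<open>H\<close> and
  \<open>\<lambda>t. H (F t)\<close> read in the charts at \<open>p\<close> and \<open>q\<close>.
  The hypothesis says that \<open>A\<close> and \<open>B\<close> have equal Schwarzians at
  \<open>r\<close>, and the composition rule then leaves the Schwarzian of \<open>g\<close> times
  the square of a nonzero derivative.\<close>

lemma schwarzian_vanishes_at_conj:
  assumes H: "circle_lift H" and F: "circle_lift F" "f \<in> Bij S1" "\<And>t. f (cis t) = cis (F t)"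
    and eq: "\<And>r. cis r = cis s \<Longrightarrow> proj_sch H (F r) * (deriv F r)\<^sup>2 + sch F r = proj_sch H r"
  shows "schwarzian_vanishes_at (conj_by (circle_map H) f) (cis (H s))"
  unfolding schwarzian_vanishes_at_def
proof (intro ballI impI)
  fix p q assume "p \<in> S1" "q \<in> S1" and ne: "cis (H s) \<noteq> - p \<and> conj_by (circle_map H) f (cis (H s)) \<noteq> - q"
  then obtain a b where ab: "p = cis a" "q = cis b" using S1_cis by metis
  obtain G where G: "circle_lift G" "\<And>t. G (H t) = t" "\<And>t. H (G t) = t"
    using circle_lift_inverse[OF H] by blast
  have HF: "circle_lift (\<lambda>t. H (F t))" using circle_lift_compose[OF H F(1)] by simp
  have chart: "proj_chart (cis c) (cis t) = tan2 c t" for c t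
  proof -
    have "2 * ((t - c) / 2) = t - c" by simp
    then have "tan ((t - c) / 2) = sin (t - c) / (cos (t - c) + 1)"
      by (subst tan_half) (simp only:)
    then show ?thesis by (simp add: proj_chart_def tan2_def cis_divide add.commute)
  qed
  let ?f = "conj_by (circle_map H) f"
  have f: "?f (cis t) = cis (H (F (G t)))" for t
    using conj_by_cis[OF H F, of "G t"] G(3) by simp
  define g where "g = (\<lambda>X. tan2 b (H (F (G (a + 2 * arctan X)))))"
  have g: "proj_chart q \<circ> ?f \<circ> proj_param p = g"
    by (auto simp: fun_eq_iff proj_param_def ab cis_mult f chart g_def)
  \<comment> \<open>The lift \<open>s\<close> is replaced by the translate \<open>r\<close> for
    which \<open>H r\<close> is within \<pi> of \<open>a\<close>: only on that branch does
    \<open>2 * arctan\<close> undo \<open>tan2 a\<close>.\<close>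
  obtain m :: int where "a - pi \<le> H s - 2 * pi * of_int m" "H s - 2 * pi * of_int m < a - pi + 2 * pi"
    using cis_reduce .
  moreover define r where "r = s - 2 * pi * of_int m"
  moreover have "H s - 2 * pi * of_int m = H r"
    using circle_lift_period_int[OF H, of s "-m"] by (simp add: r_def)
  moreover have "H r \<noteq> a - pi"
  proof
    assume "H r = a - pi"
    then have "cis (H s) = cis (a - pi)"
      using cis_period(2)[of "H s" m] calculation by simp
    then show False using ne ab by (simp add: cis_divide[symmetric])
  qed
  ultimately have r: "a - pi < H r" "H r < a + pi" by auto
  have rs: "cis r = cis s" by (simp add: r_def)
  define U where "U = {t. a - pi < H t \<and> H t < a + pi} \<inter> (\<lambda>t. H (F t)) -` tan2_dom b"
  have contH: "continuous_on UNIV H" and contHF: "continuous_on UNIV (\<lambda>t. H (F t))"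
    using circle_lift_isCont[OF H] circle_lift_isCont[OF HF] by (auto intro: continuous_at_imp_continuous_on)
  have "open ({t. a - pi < H t \<and> H t < a + pi})"
    using contH by (intro open_Collect_conj open_Collect_less) auto
  moreover have "open ((\<lambda>t. H (F t)) -` tan2_dom b)"
    using contHF open_tan2_dom by (simp add: continuous_on_open_vimage)
  ultimately have U: "open U" unfolding U_def by blast
  have cosnz: "t \<in> tan2_dom c \<longleftrightarrow> cis t \<noteq> - cis c" for t c
  proof -
    have "1 + Re (cis (t - c)) = 2 * (cos ((t - c) / 2))\<^sup>2"
    proof -
      have "2 * ((t - c) / 2) = t - c" by simp
      then have "cos (t - c) = 2 * (cos ((t - c) / 2))\<^sup>2 - 1"
        using cos_double_cos[of "(t - c) / 2"] by (simp only:)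
      then show ?thesis by simp
    qed
    then have "cos ((t - c) / 2) = 0 \<longleftrightarrow> Re (cis (t - c)) = -1" by auto
    also have "\<dots> \<longleftrightarrow> cis (t - c) = -1"
    proof
      assume c: "Re (cis (t - c)) = -1"
      then have "(sin (t - c))\<^sup>2 = 0" using sin_cos_squared_add[of "t - c"] by simp
      then show "cis (t - c) = -1" using c by (simp add: complex_eq_iff)
    qed simp
    also have "\<dots> \<longleftrightarrow> cis t = - cis c"
      by (simp add: cis_divide[symmetric] field_simps)
    finally show ?thesis by (simp add: tan2_dom_def)
  qed
  have "cis (H (F r)) \<noteq> - q"
  proof -
    have "cis (H (F r)) = cis (H (F s))" using circle_lift_cis[OF HF] rs by blast
    then show ?thesis using ne f[of "H s"] G(2) by simp
  qed
  then have rU: "r \<in> U" using r cosnz ab by (auto simp: U_def)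
  define A where "A = (\<lambda>t. tan2 a (H t))"
  define B where "B = (\<lambda>t. tan2 b (H (F t)))"
  have Hdom: "H t \<in> tan2_dom a" if "t \<in> U" for t
  proof -
    have "cos ((H t - a) / 2) > 0" using that by (intro cos_gt_zero_pi) (auto simp: U_def)
    then show ?thesis by (simp add: tan2_dom_def)
  qed
  have gA: "g (A t) = B t" if "t \<in> U" for t
  proof -
    have "arctan (tan ((H t - a) / 2)) = (H t - a) / 2"
      using that by (intro arctan_tan) (auto simp: U_def)
    then have "a + 2 * arctan (tan ((H t - a) / 2)) = H t" by simp
    then show ?thesis by (simp only: g_def A_def B_def tan2_def G(2))
  qed
  have nzH: "deriv H t \<noteq> 0" "deriv F t \<noteq> 0" "deriv (\<lambda>t. H (F t)) t \<noteq> 0" for t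
    using circle_lift_pos[OF H] circle_lift_pos[OF F(1)] circle_lift_pos[OF HF] by (metis less_irrefl)+
  have sA: "sch A r = proj_sch H r"
    unfolding A_def by (rule sch_tan2_compose[of UNIV]) (use nzH Hdom[OF rU] circle_lift_smooth[OF H] in auto)
  have "sch B r = proj_sch (\<lambda>t. H (F t)) r"
    unfolding B_def by (rule sch_tan2_compose[of UNIV]) (use nzH rU circle_lift_smooth[OF HF] in \<open>auto simp: U_def\<close>)
  then have sB: "sch B r = sch A r"
    using sA proj_sch_compose[OF H F(1)] eq[OF rs] by simp
  have smA: "smooth_on U A"
    unfolding A_def by (rule smooth_on_compose[OF U open_tan2_dom smooth_on_tan2 smooth_on_subset[OF circle_lift_smooth[OF H]]])
      (use Hdom in auto)
  have smB: "smooth_on U B"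
    unfolding B_def by (rule smooth_on_compose[OF U open_tan2_dom smooth_on_tan2 smooth_on_subset[OF circle_lift_smooth[OF HF]]])
      (auto simp: U_def)
  have dA: "deriv A t > 0" if "t \<in> U" for t
  proof -
    have "deriv A t = deriv (tan2 a) (H t) * deriv H t"
      unfolding A_def by (rule deriv_compose_on[OF U open_tan2_dom smooth_on_tan2 smooth_on_subset[OF circle_lift_smooth[OF H]] Hdom])
        (use that in auto)
    then show ?thesis using deriv_tan2_pos[OF Hdom[OF that]] circle_lift_pos[OF H] by simp
  qed
  have dB: "deriv B t > 0" if "t \<in> U" for t
  proof -
    have "deriv B t = deriv (tan2 b) (H (F t)) * deriv (\<lambda>t. H (F t)) t"
      unfolding B_def by (rule deriv_compose_on[OF U open_tan2_dom smooth_on_tan2 smooth_on_subset[OF circle_lift_smooth[OF HF]]])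
        (use that in \<open>auto simp: U_def\<close>)
    moreover have "H (F t) \<in> tan2_dom b" using that by (auto simp: U_def)
    ultimately show ?thesis using deriv_tan2_pos circle_lift_pos[OF HF] by simp
  qed
  \<comment> \<open>\<open>E\<close> inverts \<open>A\<close> and exhibits \<open>g\<close> as
    \<open>B\<close> after \<open>E\<close>; this gives the smoothness of \<open>g\<close> near
    \<open>A r\<close> that the composition rule requires.\<close>
  define E where "E = (\<lambda>X. G (a + 2 * arctan X))"
  have smE: "smooth_on UNIV E"
  proof -
    have "smooth_on UNIV (arctan :: real \<Rightarrow> real)"
    proof (rule smooth_on_realI[where f' = "\<lambda>x. inverse (1 + x * x)"])
      show "(arctan has_real_derivative inverse (1 + x * x)) (at x)" for x :: real
        using DERIV_arctan[of x] by (simp add: power2_eq_square)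
      show "smooth_on UNIV (\<lambda>x::real. inverse (1 + x * x))"
        by (intro smooth_on_inverse smooth_on_add smooth_on_mult) (auto simp: add_pos_nonneg less_imp_neq[THEN not_sym])
    qed simp
    then have "smooth_on UNIV (\<lambda>X::real. a + 2 * arctan X)"
      by (intro smooth_on_add smooth_on_mult) auto
    then show ?thesis unfolding E_def
      by (intro smooth_on_compose[OF _ _ circle_lift_smooth[OF G(1)]]) auto
  qed
  define V where "V = E -` U"
  have V: "open V" unfolding V_def
    using U smooth_on_imp_continuous_on[OF smE] by (simp add: continuous_on_open_vimage)
  have EA: "E (A t) = t" if "t \<in> U" for t
  proof -
    have "arctan (tan ((H t - a) / 2)) = (H t - a) / 2"
      using that by (intro arctan_tan) (auto simp: U_def)
    then have "a + 2 * arctan (tan ((H t - a) / 2)) = H t" by simp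
    then show ?thesis by (simp only: E_def A_def tan2_def G(2))
  qed
  have gB: "g = (\<lambda>X. B (E X))" by (simp add: g_def B_def E_def)
  have smg: "smooth_on V g" unfolding gB
    by (rule smooth_on_compose[OF V U smB smooth_on_subset[OF smE]]) (auto simp: V_def)
  have dgA: "deriv g (A t) * deriv A t = deriv B t" if "t \<in> U" for t
  proof -
    have "deriv B t = deriv (\<lambda>t. g (A t)) t" by (rule deriv_cong_open[OF U _ that]) (simp add: gA)
    also have "\<dots> = deriv g (A t) * deriv A t"
      by (rule deriv_compose_on[OF U V smg smA _ that]) (simp add: V_def EA)
    finally show ?thesis by simp
  qed
  have AE: "A (E X) = X" for X
    using arctan_bounded[of X] by (simp add: A_def E_def tan2_def G(3) tan_arctan)
  have dg: "deriv g X \<noteq> 0" if "X \<in> V" for X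
    using dgA[of "E X"] dB[of "E X"] that AE[of X] by (auto simp: V_def)
  have AV: "A r \<in> V" using rU EA by (simp add: V_def)
  have "sch B r = sch (\<lambda>t. g (A t)) r" by (rule sch_cong_open[OF U _ rU]) (simp add: gA)
  also have "\<dots> = sch g (A r) * (deriv A r)\<^sup>2 + sch A r"
    by (rule sch_compose[OF U V smg smA _ rU]) (use dg dA in \<open>auto simp: V_def EA less_imp_neq[THEN not_sym]\<close>)
  finally have "sch g (A r) = 0" using sB dA[OF rU] by simp
  then have "schwarzian g (A r) = 0" using schwarzian_eq_sch[OF V smg dg AV] by simp
  moreover have "proj_chart p (cis (H s)) = A r"
  proof -
    have "cis (H s) = cis (H r)" using rs circle_lift_cis[OF H] by metis
    then show ?thesis by (simp add: ab chart A_def)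
  qed
  ultimately show "schwarzian_coeff p q ?f (cis (H s)) = 0"
    by (simp add: schwarzian_coeff_def g)
qed

section \<open>Minimal sets of groups of lifts\<close>

text \<open>The set holds all lifts of all group elements, so it contains the translations by
  multiples of \<open>2 * pi\<close>, and invariant sets are automatically periodic. The absence of
  finite orbits is expressed on the circle, since orbits on the line are always infinite.\<close>

locale lift_group =
  fixes \<F> :: "(real \<Rightarrow> real) set"
  assumes lift: "F \<in> \<F> \<Longrightarrow> circle_lift F"
    and comp: "F \<in> \<F> \<Longrightarrow> G \<in> \<F> \<Longrightarrow> (\<lambda>t. F (G t)) \<in> \<F>"
    and inverse: "F \<in> \<F> \<Longrightarrow> \<exists>G\<in>\<F>. \<forall>t. G (F t) = t \<and> F (G t) = t"
    and shift: "(\<lambda>t. t + 2 * pi * of_int k) \<in> \<F>"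
    and infinite_orbit: "infinite ((\<lambda>F. cis (F s)) ` \<F>)"
begin

definition inv_set :: "real set \<Rightarrow> bool" where
  "inv_set T \<longleftrightarrow> closed T \<and> T \<noteq> {} \<and> (\<forall>F\<in>\<F>. \<forall>t\<in>T. F t \<in> T)"

definition minimal_set :: "real set \<Rightarrow> bool" where
  "minimal_set T \<longleftrightarrow> inv_set T \<and> (\<forall>T'. inv_set T' \<and> T' \<subseteq> T \<longrightarrow> T' = T)"

lemma identity: "(\<lambda>t. t) \<in> \<F>"
  using shift[of 0] by simp

lemma inv_set_shift: "inv_set T \<Longrightarrow> t \<in> T \<Longrightarrow> t + 2 * pi * of_int k \<in> T"
  using shift by (fastforce simp: inv_set_def)

lemma inv_set_shift': "inv_set T \<Longrightarrow> t \<in> T \<Longrightarrow> t - 2 * pi * of_int k \<in> T"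
  using inv_set_shift[of T t "-k"] by simp

lemma inv_set_iff: "inv_set T \<Longrightarrow> F \<in> \<F> \<Longrightarrow> F t \<in> T \<longleftrightarrow> t \<in> T"
  unfolding inv_set_def by (metis inverse)

text \<open>Zorn's lemma is applied to complements, so that minimal sets become maximal elements.
  The line is not compact, so the intersection of a chain is shown to be nonempty after cutting to
  one period, which every invariant set meets.\<close>

lemma exists_minimal_set: "\<exists>T. minimal_set T"
proof -
  let ?A = "{- T |T. inv_set T}"
  have "\<exists>M\<in>?A. \<forall>X\<in>?A. M \<subseteq> X \<longrightarrow> X = M"
  proof (rule subset_Zorn)
    fix C assume C: "subset.chain ?A C"
    show "\<exists>U\<in>?A. \<forall>X\<in>C. X \<subseteq> U"
    proof (cases "C = {}")
      case True
      have "inv_set UNIV" by (simp add: inv_set_def)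
      then show ?thesis using True by blast
    next
      case False
      have T: "inv_set (- X)" if "X \<in> C" for X
        using C that by (force simp: subset.chain_def)
      have "\<Inter> ((\<lambda>X. - X \<inter> {0..2 * pi}) ` C) \<noteq> {}"
      proof (rule compact_chain)
        show "compact S" if "S \<in> (\<lambda>X. - X \<inter> {0..2 * pi}) ` C" for S
          using that T by (auto simp: inv_set_def intro!: closed_Int_compact)
        have "- X \<inter> {0..2 * pi} \<noteq> {}" if "X \<in> C" for X
        proof -
          have TX: "inv_set (- X)" using T[OF that] .
          then obtain t where t: "t \<in> - X" by (auto simp: inv_set_def)
          obtain k :: int where "0 \<le> t - 2 * pi * of_int k" "t - 2 * pi * of_int k < 0 + 2 * pi"
            using cis_reduce .
          then show ?thesis using inv_set_shift'[OF TX t, of k] by (auto simp: disjoint_iff)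
        qed
        then show "{} \<notin> (\<lambda>X. - X \<inter> {0..2 * pi}) ` C" by (auto simp: image_iff)
        show "S \<subseteq> S' \<or> S' \<subseteq> S"
          if "S \<in> (\<lambda>X. - X \<inter> {0..2 * pi}) ` C \<and> S' \<in> (\<lambda>X. - X \<inter> {0..2 * pi}) ` C" for S S'
        proof -
          from that obtain X X' where X: "X \<in> C" "S = - X \<inter> {0..2 * pi}" "X' \<in> C" "S' = - X' \<inter> {0..2 * pi}"
            by blast
          have "X \<subseteq> X' \<or> X' \<subseteq> X" using C X(1,3) unfolding subset_chain_def by blast
          then show ?thesis using X by blast
        qed
      qed
      then have "- \<Union>C \<noteq> {}" using False by auto
      moreover have "closed (- \<Union>C)"
        using T by (auto simp: inv_set_def closed_def intro!: open_Union)
      moreover have "F t \<in> - \<Union>C" if "F \<in> \<F>" "t \<in> - \<Union>C" for F t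
        using T that by (auto simp: inv_set_def)
      ultimately have "inv_set (- \<Union>C)" unfolding inv_set_def by blast
      then have "\<Union>C \<in> ?A" by (intro CollectI exI[of _ "- \<Union>C"]) simp
      then show ?thesis by blast
    qed
  qed
  then obtain M where M: "M \<in> ?A" "\<forall>X\<in>?A. M \<subseteq> X \<longrightarrow> X = M" by (rule bexE)
  then obtain T where T: "inv_set T" "M = - T" by auto
  have "T' = T" if T': "inv_set T'" "T' \<subseteq> T" for T'
  proof -
    have "- T' \<in> ?A" using T'(1) by auto
    then have "- T' = M" using M(2) T(2) T'(2) by (meson Compl_subset_Compl_iff)
    then show ?thesis using T(2) by auto
  qed
  then show ?thesis using T(1) by (auto simp: minimal_set_def)
qed

lemma orbit_accumulates:
  "\<exists>y\<in>{0..2 * pi}. y islimpt {F a |F. F \<in> \<F>}"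
proof -
  let ?S = "{F a |F. F \<in> \<F>} \<inter> {0..2 * pi}"
  have sub: "(\<lambda>F. cis (F a)) ` \<F> \<subseteq> cis ` ?S"
  proof
    fix z assume "z \<in> (\<lambda>F. cis (F a)) ` \<F>"
    then obtain F where F: "F \<in> \<F>" "z = cis (F a)" by blast
    obtain k :: int where k: "0 \<le> F a - 2 * pi * of_int k" "F a - 2 * pi * of_int k < 0 + 2 * pi"
      using cis_reduce .
    have "(\<lambda>t. F t + 2 * pi * of_int (-k)) \<in> \<F>" using comp[OF shift F(1)] .
    then have "F a - 2 * pi * of_int k \<in> {F a |F. F \<in> \<F>}" by force
    then show "z \<in> cis ` ?S" using k F(2) by (intro image_eqI[of _ _ "F a - 2 * pi * of_int k"]) auto
  qed
  have "infinite ?S"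
  proof
    assume "finite ?S"
    then have "finite (cis ` ?S)" by (rule finite_imageI)
    then have "finite ((\<lambda>F. cis (F a)) ` \<F>)" by (rule finite_subset[OF sub])
    then show False using infinite_orbit[of a] by simp
  qed
  then have "\<exists>y\<in>{0..2 * pi}. y islimpt ?S"
    by (intro compact_Icc[of 0 "2 * pi", unfolded compact_eq_Bolzano_Weierstrass, rule_format]) simp
  then show ?thesis using islimpt_subset[of _ ?S "{F a |F. F \<in> \<F>}"] by (meson Int_lower1)
qed

lemma orbit_close_pair:
  assumes e: "e > 0"
  shows "\<exists>F1\<in>\<F>. \<exists>F2\<in>\<F>. F1 a < F2 a \<and> F2 a < F1 a + e"
proof -
  obtain y where y: "y islimpt {F a |F. F \<in> \<F>}" using orbit_accumulates by blast
  have near: "\<exists>F\<in>\<F>. F a \<noteq> y \<and> \<bar>F a - y\<bar> < d" if "d > 0" for d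
    using y[unfolded islimpt_approachable] that by (auto simp: dist_real_def)
  obtain G1 where G1: "G1 \<in> \<F>" "G1 a \<noteq> y" "\<bar>G1 a - y\<bar> < e / 2" using near[of "e / 2"] e by auto
  obtain G2 where G2: "G2 \<in> \<F>" "G2 a \<noteq> y" "\<bar>G2 a - y\<bar> < min (e / 2) \<bar>G1 a - y\<bar>"
    using near[of "min (e / 2) \<bar>G1 a - y\<bar>"] e G1(2) by auto
  show "\<exists>F1\<in>\<F>. \<exists>F2\<in>\<F>. F1 a < F2 a \<and> F2 a < F1 a + e"
  proof (cases "G1 a < G2 a")
    case True
    then show ?thesis using G1 G2 by (intro bexI[of _ G1] bexI[of _ G2]) auto
  next
    case False
    then show ?thesis using G1 G2 by (intro bexI[of _ G2] bexI[of _ G1]) auto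
  qed
qed

text \<open>A gap of \<open>T\<close> has infinitely many disjoint translates modulo \<open>2\<pi>\<close>, so some of them are
  arbitrarily short and carry \<open>x\<close> close to \<open>T\<close>.\<close>

lemma orbit_approaches:
  assumes T: "inv_set T" and e: "e > 0"
  shows "\<exists>F\<in>\<F>. \<exists>t\<in>T. \<bar>F x - t\<bar> < e"
proof (cases "x \<in> T")
  case True
  then show ?thesis using e by (intro bexI[OF _ identity] bexI[of _ x]) auto
next
  case False
  obtain t0 where t0: "t0 \<in> T" using T by (auto simp: inv_set_def)
  have cl: "closed T" using T by (simp add: inv_set_def)
  obtain k :: int where k: "x \<le> t0 - 2 * pi * of_int k" "t0 - 2 * pi * of_int k < x + 2 * pi"
    using cis_reduce .
  have up: "T \<inter> {x..} \<noteq> {}" using inv_set_shift'[OF T t0, of k] k by auto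
  have "t0 - 2 * pi * of_int (k + 1) \<le> x" using k by (simp add: algebra_simps)
  then have down: "T \<inter> {..x} \<noteq> {}" using inv_set_shift'[OF T t0, of "k + 1"] by blast
  define a where "a = Sup (T \<inter> {..x})"
  define b where "b = Inf (T \<inter> {x..})"
  have aT: "a \<in> T \<inter> {..x}" unfolding a_def
    by (rule closed_contains_Sup) (use cl down in \<open>auto intro!: closed_Int bdd_aboveI[of _ x]\<close>)
  have bT: "b \<in> T \<inter> {x..}" unfolding b_def
    by (rule closed_contains_Inf) (use cl up in \<open>auto intro!: closed_Int bdd_belowI[of _ x]\<close>)
  have gap: "t \<notin> T" if "a < t" "t < b" for t
  proof
    assume "t \<in> T"
    show False
    proof (cases "t \<le> x")
      case True
      then have "t \<le> a" unfolding a_def using \<open>t \<in> T\<close> by (intro cSup_upper) (auto intro: bdd_aboveI[of _ x])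
      then show False using that by simp
    next
      case False
      then have "b \<le> t" unfolding b_def using \<open>t \<in> T\<close> by (intro cInf_lower) (auto intro: bdd_belowI[of _ x])
      then show False using that by simp
    qed
  qed
  have ax: "a < x" "x < b" using aT bT False by (auto simp: less_le)
  obtain F1 F2 where F: "F1 \<in> \<F>" "F2 \<in> \<F>" "F1 a < F2 a" "F2 a < F1 a + e"
    using orbit_close_pair[OF e, of a] by blast
  \<comment> \<open>\<open>F2 a\<close> is a point of \<open>T\<close> beyond \<open>F1 a\<close>,
    and the image of the gap under \<open>F1\<close> misses \<open>T\<close>. So the whole image gap
    fits between \<open>F1 a\<close> and \<open>F2 a\<close> and is shorter than
    \<open>e\<close>.\<close>
  have "F1 b \<le> F2 a"
  proof (rule ccontr)
    assume "\<not> F1 b \<le> F2 a"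
    obtain G where G: "G \<in> \<F>" "\<And>t. G (F1 t) = t" "\<And>t. F1 (G t) = t" using inverse[OF F(1)] by blast
    have "F1 a < F1 (G (F2 a))" "F1 (G (F2 a)) < F1 b"
      using G(3) F(3) \<open>\<not> F1 b \<le> F2 a\<close> by auto
    then have "a < G (F2 a)" "G (F2 a) < b"
      by (simp_all only: circle_lift_less[OF lift[OF F(1)]])
    moreover have "G (F2 a) \<in> T" using aT inv_set_iff[OF T] G(1) F(2) by blast
    ultimately show False using gap by blast
  qed
  moreover have "F1 a < F1 x" "F1 x < F1 b" using circle_lift_less[OF lift[OF F(1)]] ax by blast+
  ultimately have "\<bar>F1 x - F1 a\<bar> < e" using F by auto
  moreover have "F1 a \<in> T" using aT inv_set_iff[OF T F(1)] by blast
  ultimately show ?thesis using F(1) by blast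
qed

text \<open>Orbits starting in \<open>T'\<close> come arbitrarily close to \<open>T\<close>, so by
  compactness of a period the two sets meet, and minimality applies to the intersection. In
  particular the minimal set is unique, which is what makes \<open>limit_set\<close> well
  defined.\<close>

lemma minimal_set_least:
  assumes T: "minimal_set T" and T': "inv_set T'"
  shows "T \<subseteq> T'"
proof -
  have iT: "inv_set T" using T by (simp add: minimal_set_def)
  obtain x where x: "x \<in> T'" using T' by (auto simp: inv_set_def)
  have "T \<inter> T' \<noteq> {}"
  proof
    assume "T \<inter> T' = {}"
    then have "(T \<inter> {0..2 * pi}) \<inter> T' = {}" by blast
    moreover have "compact (T \<inter> {0..2 * pi})" "closed T'"
      using iT T' by (auto simp: inv_set_def intro!: closed_Int_compact)
    ultimately have "\<exists>d>0. \<forall>t\<in>T \<inter> {0..2 * pi}. \<forall>t'\<in>T'. d \<le> dist t t'"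
      by (intro separate_compact_closed)
    then obtain d where d: "d > 0" "\<And>t t'. t \<in> T \<inter> {0..2 * pi} \<Longrightarrow> t' \<in> T' \<Longrightarrow> d \<le> dist t t'"
      by auto
    obtain F t where F: "F \<in> \<F>" "t \<in> T" "\<bar>F x - t\<bar> < d" using orbit_approaches[OF iT d(1)] by blast
    obtain k :: int where "0 \<le> t - 2 * pi * of_int k" "t - 2 * pi * of_int k < 0 + 2 * pi"
      using cis_reduce .
    then have "t - 2 * pi * of_int k \<in> T \<inter> {0..2 * pi}" using inv_set_shift'[OF iT F(2)] by auto
    moreover have "F x - 2 * pi * of_int k \<in> T'"
      using inv_set_shift'[OF T'] x inv_set_iff[OF T' F(1)] by blast
    ultimately show False using d(2) F(3) by (fastforce simp: dist_real_def)
  qed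
  then have "inv_set (T \<inter> T')" using iT T' by (auto simp: inv_set_def)
  then show ?thesis using T by (auto simp: minimal_set_def)
qed

text \<open>The closure of any orbit is an invariant set and so contains \<open>T\<close>, wherever
  the orbit starts. This lets the orbit of a fixed point be used without first locating that point
  in \<open>T\<close>.\<close>

lemma minimal_set_orbit_dense:
  assumes T: "minimal_set T" and t: "t \<in> T" and e: "e > 0"
  shows "\<exists>F\<in>\<F>. \<bar>F x - t\<bar> < e"
proof -
  let ?O = "{F x |F. F \<in> \<F>}"
  have "F t \<in> closure ?O" if F: "F \<in> \<F>" and t: "t \<in> closure ?O" for F t
  proof -
    have "F ` closure ?O \<subseteq> closure (F ` ?O)"
      by (rule image_closure_subset)
        (use circle_lift_isCont[OF lift[OF F]] in \<open>auto intro: continuous_at_imp_continuous_on closure_subset[THEN subsetD]\<close>)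
    moreover have "F ` ?O \<subseteq> ?O"
    proof (intro image_subsetI, elim CollectE exE conjE)
      fix y G assume "y = G x" "G \<in> \<F>"
      then show "F y \<in> ?O" using comp[OF F] by (intro CollectI exI[of _ "\<lambda>t. F (G t)"]) simp
    qed
    ultimately show ?thesis using t closure_mono[of "F ` ?O" ?O] by blast
  qed
  moreover have "x \<in> closure ?O" using identity by (intro closure_subset[THEN subsetD]) force
  ultimately have "inv_set (closure ?O)" by (auto simp: inv_set_def)
  then have "t \<in> closure ?O" using minimal_set_least[OF T] t by blast
  then show ?thesis using e by (auto simp: closure_approachable dist_real_def)
qed

text \<open>An orbit in \<open>T\<close> is infinite modulo a period, so some \<open>y\<close> in
  \<open>T\<close> is an accumulation point of \<open>T\<close>, and a group element carries
  \<open>y\<close> near \<open>t\<close>. If it lands exactly on \<open>t\<close>, points of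
  \<open>T\<close> close to \<open>y\<close> are carried along instead.\<close>

lemma minimal_set_perfect:
  assumes T: "minimal_set T" and t: "t \<in> T" and e: "e > 0"
  shows "\<exists>t'\<in>T. t' \<noteq> t \<and> \<bar>t' - t\<bar> < e"
proof -
  have iT: "inv_set T" using T by (simp add: minimal_set_def)
  obtain y where y: "y islimpt {F t |F. F \<in> \<F>}" using orbit_accumulates by blast
  have sub: "{F t |F. F \<in> \<F>} \<subseteq> T" using inv_set_iff[OF iT] t by blast
  have lim: "y islimpt T" using islimpt_subset[OF y sub] .
  then have yT: "y \<in> T" using iT closed_limpt by (auto simp: inv_set_def)
  obtain F where F: "F \<in> \<F>" "\<bar>F y - t\<bar> < e" using minimal_set_orbit_dense[OF T t e] by blast
  show ?thesis
  proof (cases "F y = t")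
    case False
    then show ?thesis using F yT inv_set_iff[OF iT F(1)] by blast
  next
    case True
    obtain d where d: "d > 0" "\<And>x. dist x y < d \<Longrightarrow> dist (F x) (F y) < e"
      using circle_lift_isCont[OF lift[OF F(1)], of y] e unfolding continuous_at_eps_delta by metis
    obtain y' where "y' \<in> T" "y' \<noteq> y" "dist y' y < d" using lim d(1) unfolding islimpt_approachable by blast
    then have "F y' \<in> T" "F y' \<noteq> t" "\<bar>F y' - t\<bar> < e"
      using inv_set_iff[OF iT F(1)] circle_lift_eq[OF lift[OF F(1)]] True d(2)[of y'] by (auto simp: dist_real_def)
    then show ?thesis by blast
  qed
qed

end

section \<open>Dynamics of a volume preserving group\<close>

locale volume_action = lift_group +
  fixes W :: "real \<times> real \<Rightarrow> real"
  assumes smooth_W: "smooth_on {(s, t). cis s \<noteq> cis t} W"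
    and W_pos: "cis s \<noteq> cis t \<Longrightarrow> W (s, t) > 0"
    and W_period: "cis s = cis s' \<Longrightarrow> cis t = cis t' \<Longrightarrow> W (s, t) = W (s', t')"
    and W_inv: "F \<in> \<F> \<Longrightarrow> cis s \<noteq> cis t \<Longrightarrow> W (F s, F t) * deriv F s * deriv F t = W (s, t)"
begin

text \<open>Compactness applies to the pairs \<open>(x, x + r)\<close> with \<open>x\<close> in one
  period; periodicity in both variables transports the bounds to all \<open>x\<close>.\<close>

lemma W_bounds:
  assumes d: "d > 0"
  shows "\<exists>m M. 0 < m \<and> 0 < M \<and> (\<forall>x y. d \<le> y - x \<and> y - x \<le> 2 * pi - d \<longrightarrow> m \<le> W (x, y) \<and> W (x, y) \<le> M)"
proof (cases "2 * d \<le> 2 * pi")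
  case False
  then show ?thesis by (intro exI[of _ 1]) auto
next
  case True
  define D where "D = (\<lambda>(x, r). (x, x + r)) ` ({0..2 * pi} \<times> {d..2 * pi - d})"
  have cD: "compact D" unfolding D_def
    by (intro compact_continuous_image compact_Times compact_Icc)
      (auto simp: case_prod_beta intro!: continuous_intros)
  have off: "cis (fst z) \<noteq> cis (snd z)" if "z \<in> D" for z
  proof -
    from that obtain x r where "z = (x, x + r)" "d \<le> r" "r \<le> 2 * pi - d" by (auto simp: D_def)
    then show ?thesis using d cis_less_2pi[of x "x + r"] by simp
  qed
  then have "D \<subseteq> {(s, t). cis s \<noteq> cis t}" by auto
  then have WD: "continuous_on D W"
    using smooth_on_imp_continuous_on[OF smooth_W] by (rule continuous_on_subset[rotated])
  have nD: "D \<noteq> {}" using True by (auto simp: D_def)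
  obtain p where p: "p \<in> D" "\<And>z. z \<in> D \<Longrightarrow> W p \<le> W z"
    using continuous_attains_inf[OF cD nD WD] by auto
  obtain q where q: "q \<in> D" "\<And>z. z \<in> D \<Longrightarrow> W z \<le> W q"
    using continuous_attains_sup[OF cD nD WD] by auto
  have pos: "W p > 0" "W q > 0"
    using W_pos[OF off[OF p(1)]] W_pos[OF off[OF q(1)]] by simp_all
  have "W p \<le> W (x, y) \<and> W (x, y) \<le> W q" if xy: "d \<le> y - x" "y - x \<le> 2 * pi - d" for x y
  proof -
    obtain k :: int where k: "0 \<le> x - 2 * pi * of_int k" "x - 2 * pi * of_int k < 0 + 2 * pi"
      using cis_reduce .
    have "W (x, y) = W (x - 2 * pi * of_int k, y - 2 * pi * of_int k)" by (rule W_period) simp_all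
    moreover have "(x - 2 * pi * of_int k, y - 2 * pi * of_int k) \<in> D"
      unfolding D_def by (rule image_eqI[of _ _ "(x - 2 * pi * of_int k, y - x)"]) (use k xy in auto)
    ultimately show ?thesis using p(2) q(2) by simp
  qed
  then show ?thesis using pos by blast
qed

text \<open>If an arc becomes short while a disjoint arc stays away from it, then the mean value theorem
  produces points at which the invariance of the volume form fails.\<close>

lemma short_arc:
  assumes d: "d > 0"
  obtains \<eta> where "\<eta> > 0"
    "\<And>F p q r s. F \<in> \<F> \<Longrightarrow> d \<le> q - p \<Longrightarrow> d \<le> r - q \<Longrightarrow> d \<le> s - r \<Longrightarrow> d \<le> p + 2 * pi - s \<Longrightarrow>
       F q - F p < \<eta> \<Longrightarrow> F r - F q < d \<or> F p + 2 * pi - F s < d"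
proof -
  obtain m M where m: "0 < m" "0 < M"
    "\<And>x y. d \<le> y - x \<Longrightarrow> y - x \<le> 2 * pi - d \<Longrightarrow> m \<le> W (x, y) \<and> W (x, y) \<le> M"
    using W_bounds[OF d] by blast
  \<comment> \<open>Chosen so that \<open>M * (\<eta> * (2 * pi)) = m * (d * d)\<close>: the left
    side is above the contribution of the two image arcs, the right side below that of the original
    arcs.\<close>
  define \<eta> where "\<eta> = m * d * d / (2 * pi * M)"
  have "\<eta> > 0" using m d by (simp add: \<eta>_def)
  moreover have "F r - F q < d \<or> F p + 2 * pi - F s < d"
    if F: "F \<in> \<F>" and pq: "d \<le> q - p" "d \<le> r - q" "d \<le> s - r" "d \<le> p + 2 * pi - s" and small: "F q - F p < \<eta>"
    for F p q r s
  proof (rule ccontr)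
    assume "\<not> ?thesis"
    then have far: "F r - F q \<ge> d" "F p + 2 * pi - F s \<ge> d" by auto
    note L = lift[OF F]
    have lt: "p < q" "r < s" using pq d by auto
    have "\<exists>x. p < x \<and> x < q \<and> F q - F p = (q - p) * deriv F x"
      by (rule MVT2[OF lt(1)]) (rule circle_lift_DERIV[OF L])
    then obtain x where x: "p < x" "x < q" "F q - F p = (q - p) * deriv F x" by blast
    have "\<exists>y. r < y \<and> y < s \<and> F s - F r = (s - r) * deriv F y"
      by (rule MVT2[OF lt(2)]) (rule circle_lift_DERIV[OF L])
    then obtain y where y: "r < y" "y < s" "F s - F r = (s - r) * deriv F y" by blast
    have pos: "deriv F x > 0" "deriv F y > 0" using circle_lift_pos[OF L] by auto
    have "F p < F x" "F x < F q" "F r < F y" "F y < F s" using circle_lift_less[OF L] x y by auto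
    then have W1: "W (F x, F y) \<le> M" "W (F x, F y) > 0" using m(1) m(3)[where x = "F x" and y = "F y"] far by auto
    have W2: "m \<le> W (x, y)" using m(3)[where x = x and y = y] x y pq by auto
    have "cis x \<noteq> cis y" by (rule cis_less_2pi) (use x y pq d in auto)
    from W_inv[OF F this] have "m \<le> W (F x, F y) * deriv F x * deriv F y" using W2 by simp
    then have "m * ((q - p) * (s - r)) \<le> W (F x, F y) * deriv F x * deriv F y * ((q - p) * (s - r))"
      using lt by (intro mult_right_mono) auto
    also have "\<dots> = W (F x, F y) * ((F q - F p) * (F s - F r))" by (simp only: x(3) y(3) mult_ac)
    also have "\<dots> \<le> M * ((F q - F p) * (2 * pi))"
    proof (intro mult_mono)
      have "F q < F r" using circle_lift_less[OF L] pq d by auto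
      then show "F s - F r \<le> 2 * pi" using far(2) d \<open>F p < F x\<close> \<open>F x < F q\<close> by linarith
      show "0 \<le> F s - F r" using y pos lt by simp
      show "0 \<le> (F q - F p) * (F s - F r)" using x y pos lt by simp
    qed (use W1 m x pos lt in auto)
    also have "\<dots> < M * (\<eta> * (2 * pi))" using small m by simp
    also have "\<dots> = m * (d * d)" using m by (simp add: \<eta>_def field_simps)
    finally have "m * ((q - p) * (s - r)) < m * (d * d)" .
    then have "(q - p) * (s - r) < d * d" using m(1) by (simp add: mult_less_cancel_left_pos)
    moreover have "d * d \<le> (q - p) * (s - r)" using pq d by (intro mult_mono) auto
    ultimately show False by linarith
  qed
  ultimately show thesis using that by blast
qed

section \<open>From a contracted arc to a hyperbolic element\<close>

definition contracting :: bool where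
  "contracting \<longleftrightarrow> (\<exists>p q. p < q \<and> q < p + 2 * pi \<and> (\<forall>\<eta>>0. \<exists>F\<in>\<F>. F q - F p < \<eta>))"

text \<open>As \<open>r\<close> moves away from \<open>q\<close>, \<open>short_arc\<close> says that
  the arc from \<open>q\<close> to \<open>r\<close> has short image or the arc from
  \<open>r + d\<close> to \<open>p + 2 * pi\<close> has. Near the last \<open>r\<close> of the first
  kind both happen up to steps of size \<open>d\<close>, so everything outside an arc of length at
  most \<open>3 * d\<close> is contracted.\<close>

lemma contracting_complement:
  assumes contracting and e: "e > 0"
  shows "\<exists>F\<in>\<F>. \<exists>b. F (b + 2 * pi) - F (b + e) < e"
proof -
  obtain p q where pq: "p < q" "q < p + 2 * pi" and inf: "\<And>\<eta>. \<eta> > 0 \<Longrightarrow> \<exists>F\<in>\<F>. F q - F p < \<eta>"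
    using assms by (auto simp: contracting_def)
  \<comment> \<open>The division by 3 pays for up to three image arcs shorter than \<open>d\<close>;
    the division by 5 leaves room for \<open>r\<close> and \<open>r + d\<close>, with margins
    \<open>d\<close>, between \<open>q\<close> and \<open>p + 2 * pi\<close>.\<close>
  define d where "d = min (e / 3) (min (q - p) ((p + 2 * pi - q) / 5))"
  have d: "d > 0" "3 * d \<le> e" "d \<le> q - p" "5 * d \<le> p + 2 * pi - q"
    using pq e by (simp_all add: d_def min_def)
  obtain \<eta> where \<eta>: "\<eta> > 0" "\<And>F p q r s. F \<in> \<F> \<Longrightarrow> d \<le> q - p \<Longrightarrow> d \<le> r - q \<Longrightarrow> d \<le> s - r \<Longrightarrow> d \<le> p + 2 * pi - s \<Longrightarrow>
       F q - F p < \<eta> \<Longrightarrow> F r - F q < d \<or> F p + 2 * pi - F s < d"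
    using short_arc[OF d(1)] by blast
  obtain F where F: "F \<in> \<F>" "F q - F p < min \<eta> d" using inf[of "min \<eta> d"] \<eta> d by auto
  note L = lift[OF F(1)]
  have alt: "F r - F q < d \<or> F p + 2 * pi - F (r + d) < d" if "q + d \<le> r" "r \<le> p + 2 * pi - 2 * d" for r
    by (rule \<eta>(2)) (use F d that in auto)
  have mono: "F s \<le> F t" if "s \<le> t" for s t using circle_lift_le[OF L] that by blast
  have per: "F (t + 2 * pi) = F t + 2 * pi" for t using circle_lift_period[OF L] .
  define A where "A = {r. q + d \<le> r \<and> r \<le> p + 2 * pi - 2 * d \<and> F r - F q < d}"
  show ?thesis
  proof (cases "A = {}")
    case True
    then have "q + d \<notin> A" by blast
    then have "\<not> F (q + d) - F q < d" using d by (auto simp: A_def)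
    then have "F p + 2 * pi - F (q + 2 * d) < d" using alt[of "q + d"] d by (auto simp: algebra_simps)
    then have "F (q + 2 * pi) - F (q + e) < e"
      using F(2) mono[of "q + 2 * d" "q + e"] d by (simp add: per)
    then show ?thesis using F(1) by blast
  next
    case False
    have "bdd_above A" by (auto simp: A_def intro: bdd_aboveI)
    \<comment> \<open>The supremum need not be attained; a point of \<open>A\<close> within
      \<open>d\<close> of it is enough, since \<open>r + d\<close> is then outside
      \<open>A\<close>.\<close>
    then obtain r where r: "r \<in> A" "r + d > Sup A"
      using less_cSup_iff[OF False \<open>bdd_above A\<close>, of "Sup A - d"] d(1) by (auto simp: algebra_simps)
    show ?thesis
    proof (cases "r + d \<le> p + 2 * pi - 2 * d")
      case True
      have "r + d \<notin> A" using r(2) cSup_upper[OF _ \<open>bdd_above A\<close>] by force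
      then have "\<not> F (r + d) - F q < d" using True r(1) d by (auto simp: A_def)
      then have "F p + 2 * pi - F (r + 2 * d) < d" using alt[of "r + d"] True r(1) d by (auto simp: A_def algebra_simps)
      then have "F (r + 2 * pi) - F (r + e) < e"
        using F(2) mono[of "r + 2 * d" "r + e"] d r(1) by (simp add: per A_def)
      then show ?thesis using F(1) by blast
    next
      case False
      then have "F p + 2 * pi \<le> F (r + e)" using mono[of "p + 2 * pi" "r + e"] d by (simp add: per)
      then have "F (r + 2 * pi) - F (r + e) < e" using F(2) d r(1) by (simp add: per A_def)
      then show ?thesis using F(1) by blast
    qed
  qed
qed

text \<open>By \<open>contracting_complement\<close> some element maps all but an arc of length
  \<open>e\<close> near \<open>b\<close> into an arc of length \<open>e\<close> near
  \<open>a\<close>. As \<open>e\<close> tends to zero the positions converge along a subsequence.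
  Composing with an element that separates the two limits puts the target arc away from the
  exceptional one, so the large arc is mapped strictly inside itself.\<close>

lemma contracting_trap:
  assumes contracting
  shows "\<exists>F\<in>\<F>. \<exists>b b'. b < b' \<and> b' < b + 2 * pi \<and> F b' > b' \<and> F (b + 2 * pi) < b + 2 * pi"
proof -
  define Q where "Q e F b \<longleftrightarrow> F \<in> \<F> \<and> 0 \<le> b \<and> b \<le> 2 * pi \<and> 0 \<le> F (b + e) \<and> F (b + e) \<le> 2 * pi \<and>
    F (b + 2 * pi) - F (b + e) < e" for e F b
  have "\<exists>F b. Q e F b" if e: "e > 0" for e
  proof -
    obtain F b where F: "F \<in> \<F>" "F (b + 2 * pi) - F (b + e) < e" using contracting_complement[OF assms e] by blast
    obtain k :: int where k: "0 \<le> b - 2 * pi * of_int k" "b - 2 * pi * of_int k < 0 + 2 * pi"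
      using cis_reduce .
    define c where "c = b - 2 * pi * of_int k"
    have c: "0 \<le> c" "c \<le> 2 * pi" using k by (auto simp: c_def)
    obtain l :: int where l: "0 \<le> F (c + e) - 2 * pi * of_int l" "F (c + e) - 2 * pi * of_int l < 0 + 2 * pi"
      using cis_reduce .
    define G where "G = (\<lambda>t. F t + 2 * pi * of_int (-l))"
    have "G \<in> \<F>" unfolding G_def using comp[OF shift F(1)] .
    moreover have "F (b + x) = F (c + x) + 2 * pi * of_int k" for x
      using circle_lift_period_int[OF lift[OF F(1)], of "c + x" k] by (simp add: c_def algebra_simps)
    then have "G (c + 2 * pi) - G (c + e) < e" using F(2) by (simp add: G_def)
    ultimately have "Q e G c" using c l by (simp add: Q_def G_def)
    then show ?thesis by blast
  qed
  then have "\<forall>n::nat. \<exists>F b. Q (1 / real (Suc n)) F b" by simp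
  then obtain F b where Fb: "\<And>n. Q (1 / real (Suc n)) (F n) (b n)" by metis
  define e where "e = (\<lambda>n. 1 / real (Suc n))"
  define a where "a = (\<lambda>n. F n (b n + e n))"
  have "compact ({0..2 * pi} \<times> {0..2 * pi})" by (intro compact_Times compact_Icc)
  moreover have "\<forall>n. (a n, b n) \<in> {0..2 * pi} \<times> {0..2 * pi}" using Fb by (simp add: a_def e_def Q_def)
  ultimately have "\<exists>l\<in>{0..2 * pi} \<times> {0..2 * pi}. \<exists>r. strict_mono r \<and> ((\<lambda>n. (a n, b n)) \<circ> r) \<longlonglongrightarrow> l"
    by (intro compact_def[THEN iffD1, rule_format]) simp_all
  then obtain l \<phi> where l: "strict_mono (\<phi> :: nat \<Rightarrow> nat)" "((\<lambda>n. (a n, b n)) \<circ> \<phi>) \<longlonglongrightarrow> l"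
    by auto
  obtain a0 b0 where "l = (a0, b0)" by (cases l)
  then have lim: "(\<lambda>n. a (\<phi> n)) \<longlonglongrightarrow> a0" "(\<lambda>n. b (\<phi> n)) \<longlonglongrightarrow> b0"
    using tendsto_fst[OF l(2)] tendsto_snd[OF l(2)] by (simp_all add: o_def)
  have "e \<longlonglongrightarrow> 0" unfolding e_def using LIMSEQ_inverse_real_of_nat by (simp add: inverse_eq_divide)
  then have lime: "(\<lambda>n. e (\<phi> n)) \<longlonglongrightarrow> 0" using LIMSEQ_subseq_LIMSEQ[OF _ l(1)] by (auto simp: o_def)
  have lima: "(\<lambda>n. a (\<phi> n) + e (\<phi> n)) \<longlonglongrightarrow> a0" using tendsto_add[OF lim(1) lime] by simp
  \<comment> \<open>The two limit positions may coincide, and then nothing would be trapped; the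
    infinite orbit of \<open>a0\<close> contains a point other than \<open>b0\<close> on the
    circle.\<close>
  have "\<exists>G\<in>\<F>. cis (G a0) \<noteq> cis b0"
  proof (rule ccontr)
    assume "\<not> ?thesis"
    then have "(\<lambda>F. cis (F a0)) ` \<F> \<subseteq> {cis b0}" by auto
    then show False using infinite_orbit[of a0] finite_subset by blast
  qed
  then obtain G' where G': "G' \<in> \<F>" "cis (G' a0) \<noteq> cis b0" by blast
  obtain k :: int where k: "b0 \<le> G' a0 - 2 * pi * of_int k" "G' a0 - 2 * pi * of_int k < b0 + 2 * pi"
    using cis_reduce .
  define G where "G = (\<lambda>t. G' t + 2 * pi * of_int (-k))"
  have G: "G \<in> \<F>" unfolding G_def using comp[OF shift G'(1)] .
  define c where "c = G a0"
  have "cis c = cis (G' a0)" by (simp add: c_def G_def)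
  then have c: "b0 < c" "c < b0 + 2 * pi" using k G'(2) by (auto simp: c_def G_def less_le)
  define h where "h = min (c - b0) (b0 + 2 * pi - c) / 4"
  have h: "h > 0" "4 * h \<le> c - b0" "4 * h \<le> b0 + 2 * pi - c" using c by (auto simp: h_def)
  have Gc: "isCont G a0" using circle_lift_isCont[OF lift[OF G]] .
  have "\<forall>\<^sub>F n in sequentially. dist (b (\<phi> n)) b0 < h \<and> dist (e (\<phi> n)) 0 < h \<and>
      dist (G (a (\<phi> n))) c < h \<and> dist (G (a (\<phi> n) + e (\<phi> n))) c < h"
    unfolding c_def
    by (intro eventually_conj tendstoD lim lime h isCont_tendsto_compose[OF Gc] lima)
  then obtain n where n: "dist (b (\<phi> n)) b0 < h" "dist (e (\<phi> n)) 0 < h"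
      "dist (G (a (\<phi> n))) c < h" "dist (G (a (\<phi> n) + e (\<phi> n))) c < h"
    by (auto simp: eventually_sequentially)
  let ?n = "\<phi> n"
  let ?F = "\<lambda>t. G (F ?n t)"
  have "F ?n \<in> \<F>" using Fb[of ?n] by (simp add: Q_def)
  then have F: "?F \<in> \<F>" by (rule comp[OF G])
  have epos: "e ?n > 0" by (simp add: e_def)
  have "F ?n (b ?n + 2 * pi) < a ?n + e ?n" using Fb[of ?n] by (simp add: a_def e_def Q_def)
  then have "?F (b ?n + 2 * pi) < G (a ?n + e ?n)" using circle_lift_less[OF lift[OF G]] by blast
  also have "\<dots> < b ?n + 2 * pi" using n h by (auto simp: dist_real_def)
  finally have 1: "?F (b ?n + 2 * pi) < b ?n + 2 * pi" .
  have 2: "?F (b ?n + e ?n) > b ?n + e ?n" using n h by (auto simp: dist_real_def a_def)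
  show ?thesis
    by (rule bexI[OF _ F], rule exI[of _ "b ?n"], rule exI[of _ "b ?n + e ?n"])
      (use 1 2 epos n h c in \<open>auto simp: dist_real_def\<close>)
qed

lemma funpow_in: "F \<in> \<F> \<Longrightarrow> F ^^ n \<in> \<F>"
proof (induction n)
  case 0
  then show ?case using identity by (simp add: id_def)
next
  case (Suc n)
  then show ?case using comp[OF Suc.prems] by (simp add: o_def)
qed

text \<open>\<open>\<alpha>\<close> is the last fixed point before \<open>b'\<close> and
  \<open>\<beta>\<close> the first one after it, so points between them move towards
  \<open>\<beta>\<close>. Beyond \<open>\<beta>\<close> the order alone does not exclude further
  fixed points. There volume preservation decides: an arc left of \<open>\<beta>\<close> collapses
  onto \<open>\<beta>\<close>, and by \<open>short_arc\<close> the arc on its right must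
  follow.\<close>

lemma contracting_hyperbolic:
  assumes contracting
  obtains F \<alpha> \<beta> where "F \<in> \<F>" "\<alpha> < \<beta>" "\<beta> < \<alpha> + 2 * pi" "F \<alpha> = \<alpha>" "F \<beta> = \<beta>"
    "\<And>t. \<alpha> < t \<Longrightarrow> t < \<alpha> + 2 * pi \<Longrightarrow> (\<lambda>n. (F ^^ n) t) \<longlonglongrightarrow> \<beta>"
proof -
  obtain F b b' where F: "F \<in> \<F>" and b: "b < b'" "b' < b + 2 * pi" "F b' > b'" "F (b + 2 * pi) < b + 2 * pi"
    using contracting_trap[OF assms] by blast
  note L = lift[OF F]
  have cont: "continuous_on S F" for S
    using circle_lift_isCont[OF L] by (simp add: continuous_at_imp_continuous_on)
  have per: "F (t + 2 * pi) = F t + 2 * pi" for t using circle_lift_period[OF L] .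
  have Fb: "F b < b" using b(4) per by simp
  have closedI: "compact ({x..y} \<inter> {t. F t \<le> t})" for x y
    by (intro compact_Int_closed compact_Icc closed_Collect_le cont continuous_on_id)
  have "\<exists>s\<in>{b..b'} \<inter> {t. F t \<le> t}. \<forall>t\<in>{b..b'} \<inter> {t. F t \<le> t}. t \<le> s"
    by (rule compact_attains_sup[OF closedI]) (use b Fb in force)
  then obtain \<alpha> where \<alpha>: "b \<le> \<alpha>" "\<alpha> \<le> b'" "F \<alpha> \<le> \<alpha>" "\<And>t. b \<le> t \<Longrightarrow> t \<le> b' \<Longrightarrow> F t \<le> t \<Longrightarrow> t \<le> \<alpha>"
    by auto
  have "\<exists>s\<in>{b'..b + 2 * pi} \<inter> {t. F t \<le> t}. \<forall>t\<in>{b'..b + 2 * pi} \<inter> {t. F t \<le> t}. s \<le> t"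
  proof (rule compact_attains_inf[OF closedI])
    have "b + 2 * pi \<in> {b'..b + 2 * pi} \<inter> {t. F t \<le> t}" using b by simp
    then show "{b'..b + 2 * pi} \<inter> {t. F t \<le> t} \<noteq> {}" by blast
  qed
  then obtain \<beta> where \<beta>: "b' \<le> \<beta>" "\<beta> \<le> b + 2 * pi" "F \<beta> \<le> \<beta>" "\<And>t. b' \<le> t \<Longrightarrow> t \<le> b + 2 * pi \<Longrightarrow> F t \<le> t \<Longrightarrow> \<beta> \<le> t"
    by auto
  have "\<exists>t\<ge>\<alpha>. t \<le> b' \<and> F t - t = 0"
    by (rule IVT') (use \<alpha> b in \<open>auto intro!: continuous_intros cont\<close>)
  then obtain z where z: "\<alpha> \<le> z" "z \<le> b'" "F z = z" by auto
  then have fa: "F \<alpha> = \<alpha>" using \<alpha>(1,2) \<alpha>(4)[of z] by force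
  have "\<exists>t\<ge>b'. t \<le> \<beta> \<and> - (F t - t) = 0"
    by (rule IVT') (use \<beta> b in \<open>auto intro!: continuous_intros cont\<close>)
  then obtain z where z: "b' \<le> z" "z \<le> \<beta>" "F z = z" by auto
  then have fb: "F \<beta> = \<beta>" using \<beta>(1,2) \<beta>(4)[of z] by force
  have ne: "\<alpha> \<noteq> b'" "\<beta> \<noteq> b'" "\<alpha> \<noteq> b" "\<beta> \<noteq> b + 2 * pi" using fa fb b(3,4) Fb by auto
  have ab: "\<alpha> < \<beta>" "\<beta> < \<alpha> + 2 * pi" "\<alpha> < b'" "b' < \<beta>" using \<alpha> \<beta> ne by auto
  have inc: "F t > t" if "\<alpha> < t" "t < \<beta>" for t
  proof (rule ccontr)
    assume "\<not> F t > t"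
    then show False using \<alpha>(1) \<alpha>(4)[of t] \<beta>(2) \<beta>(4)[of t] that by (cases "t \<le> b'") auto
  qed
  have mono: "F s < F t \<longleftrightarrow> s < t" for s t using circle_lift_less[OF L] .
  have left: "(\<lambda>n. (F ^^ n) t) \<longlonglongrightarrow> \<beta>" if t: "\<alpha> < t" "t < \<beta>" for t
  proof -
    have bd: "\<alpha> < (F ^^ n) t \<and> (F ^^ n) t < \<beta>" for n
    proof (induction n)
      case (Suc n)
      then show ?case using mono[of \<alpha> "(F ^^ n) t"] mono[of "(F ^^ n) t" \<beta>] fa fb by simp
    qed (use t in simp)
    have incs: "incseq (\<lambda>n. (F ^^ n) t)"
      by (rule incseq_SucI) (use inc bd in \<open>auto intro: less_imp_le\<close>)
    obtain l where l: "(\<lambda>n. (F ^^ n) t) \<longlonglongrightarrow> l" "\<forall>n. (F ^^ n) t \<le> l"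
      by (rule incseq_convergent[OF incs, of \<beta>]) (use bd in \<open>auto intro: less_imp_le\<close>)
    have "l \<le> \<beta>" by (rule LIMSEQ_le_const2[OF l(1)]) (use bd in \<open>auto intro: less_imp_le\<close>)
    have "(\<lambda>n. F ((F ^^ n) t)) \<longlonglongrightarrow> F l"
      using isCont_tendsto_compose[OF circle_lift_isCont[OF L] l(1)] .
    moreover have "(\<lambda>n. F ((F ^^ n) t)) \<longlonglongrightarrow> l" using LIMSEQ_Suc[OF l(1)] by simp
    ultimately have "F l = l" using LIMSEQ_unique by blast
    moreover have "l > \<alpha>" using spec[OF l(2), of 0] t by simp
    ultimately have "l = \<beta>" using inc[of l] \<open>l \<le> \<beta>\<close> by force
    then show ?thesis using l(1) by simp
  qed
  have right: "(\<lambda>n. (F ^^ n) r) \<longlonglongrightarrow> \<beta>" if r: "\<beta> < r" "r < \<alpha> + 2 * pi" for r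
  proof (rule LIMSEQ_I)
    fix e :: real assume e: "e > 0"
    define p where "p = (2 * \<alpha> + \<beta>) / 3"
    define q where "q = (\<alpha> + 2 * \<beta>) / 3"
    define s where "s = (r + \<alpha> + 2 * pi) / 2"
    have pq: "\<alpha> < p" "p < q" "q < \<beta>" "r < s" "s < \<alpha> + 2 * pi" using ab r by (auto simp: p_def q_def s_def)
    \<comment> \<open>Besides keeping the four points apart, the bound
      \<open>d \<le> p - \<alpha>\<close> rules out the second alternative of
      \<open>short_arc\<close>: iterates of \<open>p\<close> stay at or beyond \<open>p\<close>, and
      those of \<open>s\<close> stay below \<open>\<alpha> + 2 * pi\<close>.\<close>
    define d where "d = Min {e, q - p, r - q, s - r, \<alpha> + 2 * pi - s, p - \<alpha>}"
    have "d > 0" using e pq r unfolding d_def by (subst Min_gr_iff) auto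
    moreover have "\<forall>x\<in>{e, q - p, r - q, s - r, \<alpha> + 2 * pi - s, p - \<alpha>}. d \<le> x"
      unfolding d_def by (intro ballI Min.coboundedI) auto
    ultimately have d: "d > 0" "d \<le> e" "d \<le> q - p" "d \<le> r - q" "d \<le> s - r" "d \<le> \<alpha> + 2 * pi - s" "d \<le> p - \<alpha>"
      by simp_all
    obtain \<eta> where \<eta>: "\<eta> > 0" "\<And>F p q r s. F \<in> \<F> \<Longrightarrow> d \<le> q - p \<Longrightarrow> d \<le> r - q \<Longrightarrow> d \<le> s - r \<Longrightarrow> d \<le> p + 2 * pi - s \<Longrightarrow>
         F q - F p < \<eta> \<Longrightarrow> F r - F q < d \<or> F p + 2 * pi - F s < d"
      using short_arc[OF d(1)] by blast
    have "(\<lambda>n. (F ^^ n) q - (F ^^ n) p) \<longlonglongrightarrow> \<beta> - \<beta>"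
      by (intro tendsto_diff left) (use pq in auto)
    then obtain N where N: "\<And>n. n \<ge> N \<Longrightarrow> \<bar>(F ^^ n) q - (F ^^ n) p\<bar> < \<eta>"
      using \<eta>(1) LIMSEQ_D[of "\<lambda>n. (F ^^ n) q - (F ^^ n) p" 0 \<eta>] by auto
    have "norm ((F ^^ n) r - \<beta>) < e" if n: "n \<ge> N" for n
    proof -
      note Ln = lift[OF funpow_in[OF F, of n]]
      have fixd: "(F ^^ n) \<alpha> = \<alpha>" "(F ^^ n) \<beta> = \<beta>" by (induction n) (simp_all add: fa fb)
      have mn: "(F ^^ n) x < (F ^^ n) y" if "x < y" for x y using circle_lift_less[OF Ln] that by blast
      have "p \<le> (F ^^ m) p \<and> (F ^^ m) p < \<beta>" for m
      proof (induction m)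
        case (Suc m)
        then show ?case using inc[of "(F ^^ m) p"] mono[of "(F ^^ m) p" \<beta>] fb pq by auto
      qed (use pq in auto)
      then have "p \<le> (F ^^ n) p" by blast
      moreover have "(F ^^ n) s < \<alpha> + 2 * pi"
        using mn[OF pq(5)] circle_lift_period[OF Ln, of \<alpha>] fixd by simp
      ultimately have "\<not> (F ^^ n) p + 2 * pi - (F ^^ n) s < d" using d by linarith
      moreover have "(F ^^ n) r - (F ^^ n) q < d \<or> (F ^^ n) p + 2 * pi - (F ^^ n) s < d"
        by (rule \<eta>(2)[OF funpow_in[OF F]]) (use d pq N[OF n] in auto)
      ultimately have "(F ^^ n) r < (F ^^ n) q + d" by simp
      moreover have "(F ^^ n) q < \<beta>" "\<beta> < (F ^^ n) r" using mn[OF pq(3)] mn[OF r(1)] fixd by auto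
      ultimately show ?thesis using d(2) by auto
    qed
    then show "\<exists>N. \<forall>n\<ge>N. norm ((F ^^ n) r - \<beta>) < e" by blast
  qed
  have "(\<lambda>n. (F ^^ n) \<beta>) \<longlonglongrightarrow> \<beta>"
  proof -
    have "(F ^^ n) \<beta> = \<beta>" for n using fb by (induction n) auto
    then show ?thesis by simp
  qed
  then have "(\<lambda>n. (F ^^ n) t) \<longlonglongrightarrow> \<beta>" if "\<alpha> < t" "t < \<alpha> + 2 * pi" for t
    using left[of t] right[of t] that by (cases t \<beta> rule: linorder_cases) auto
  then show thesis using that[OF F ab(1,2) fa fb] by blast
qed

end

section \<open>Partial derivatives\<close>

definition pd1 :: "(real \<times> real \<Rightarrow> real) \<Rightarrow> real \<times> real \<Rightarrow> real" where
  "pd1 g p = frechet_derivative g (at p) (1, 0)"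

definition pd2 :: "(real \<times> real \<Rightarrow> real) \<Rightarrow> real \<times> real \<Rightarrow> real" where
  "pd2 g p = frechet_derivative g (at p) (0, 1)"

lemma smooth_on_pd: "smooth_on U g \<Longrightarrow> smooth_on U (pd1 g)" "smooth_on U g \<Longrightarrow> smooth_on U (pd2 g)"
  unfolding pd1_def[abs_def] pd2_def[abs_def] by (rule smooth_on_frechet_derivative, assumption)+

lemma pd_DERIV:
  assumes "smooth_on U g" "(s, t) \<in> U"
  shows "((\<lambda>s. g (s, t)) has_real_derivative pd1 g (s, t)) (at s)"
    and "((\<lambda>t. g (s, t)) has_real_derivative pd2 g (s, t)) (at t)"
proof -
  let ?D = "frechet_derivative g (at (s, t))"
  have D: "(g has_derivative ?D) (at (s, t))" using smooth_on_has_derivative[OF assms] .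
  have lin: "linear ?D" using D has_derivative_linear by blast
  have "((\<lambda>s. (s, t)) has_derivative (\<lambda>h. (h, 0))) (at s)"
    by (auto intro!: derivative_eq_intros)
  from has_derivative_compose[OF this D]
  have "((\<lambda>s. g (s, t)) has_derivative (\<lambda>h. ?D (h, 0))) (at s)" .
  moreover have "?D (h, 0) = pd1 g (s, t) * h" for h
    using linear_cmul[OF lin, of h "(1, 0)"] by (simp add: pd1_def mult.commute)
  ultimately show "((\<lambda>s. g (s, t)) has_real_derivative pd1 g (s, t)) (at s)"
    by (simp add: has_field_derivative_def)
  have "((\<lambda>t. (s, t)) has_derivative (\<lambda>h. (0, h))) (at t)"
    by (auto intro!: derivative_eq_intros)
  from has_derivative_compose[OF this D]
  have "((\<lambda>t. g (s, t)) has_derivative (\<lambda>h. ?D (0, h))) (at t)" .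
  moreover have "?D (0, h) = pd2 g (s, t) * h" for h
    using linear_cmul[OF lin, of h "(0, 1)"] by (simp add: pd2_def mult.commute)
  ultimately show "((\<lambda>t. g (s, t)) has_real_derivative pd2 g (s, t)) (at t)"
    by (simp add: has_field_derivative_def)
qed

lemma pd_commute:
  assumes "open U" "smooth_on U g" "(s, t) \<in> U"
  shows "pd2 (pd1 g) (s, t) = pd1 (pd2 g) (s, t)"
proof (rule mixed_partials_commute[OF assms(1,3)])
  note d = pd_DERIV[OF assms(2)] and d1 = pd_DERIV(2)[OF smooth_on_pd(1)[OF assms(2)]]
    and d2 = pd_DERIV(1)[OF smooth_on_pd(2)[OF assms(2)]]
  show "((\<lambda>s. g (s, y)) has_real_derivative pd1 g (x, y)) (at x)" if "(x, y) \<in> U" for x y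
    using d(1)[OF that] .
  show "((\<lambda>t. g (x, t)) has_real_derivative pd2 g (x, y)) (at y)" if "(x, y) \<in> U" for x y
    using d(2)[OF that] .
  show "((\<lambda>t. pd1 g (x, t)) has_real_derivative pd2 (pd1 g) (x, y)) (at y)" if "(x, y) \<in> U" for x y
    using d1[OF that] .
  show "((\<lambda>s. pd2 g (s, y)) has_real_derivative pd1 (pd2 g) (x, y)) (at x)" if "(x, y) \<in> U" for x y
    using d2[OF that] .
  show "continuous_on U (pd2 (pd1 g))" "continuous_on U (pd1 (pd2 g))"
    by (intro smooth_on_imp_continuous_on smooth_on_pd assms)+
qed

section \<open>The curvature of the volume form and the induced projective structures\<close>

lemma DERIV_eq_on_open:
  fixes f g :: "real \<Rightarrow> real"
  assumes "(f has_real_derivative D) (at x)" "(g has_real_derivative E) (at x)"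
    "open U" "x \<in> U" "\<And>y. y \<in> U \<Longrightarrow> f y = g y"
  shows "D = E"
  using DERIV_unique[OF has_field_derivative_transform_within_open[OF assms(1,3,4,5)] assms(2)] .

definition Off :: "(real \<times> real) set" where
  "Off = {(s, t). cis s \<noteq> cis t}"

lemma Off_iff: "(s, t) \<in> Off \<longleftrightarrow> cis s \<noteq> cis t"
  by (simp add: Off_def)

lemma open_Off: "open Off"
proof -
  have "Off = {p. cis (fst p) \<noteq> cis (snd p)}" by (auto simp: Off_def)
  moreover have "open {p :: real \<times> real. cis (fst p) \<noteq> cis (snd p)}"
    by (intro open_Collect_neq continuous_on_cis continuous_on_fst continuous_on_snd continuous_on_id)
  ultimately show ?thesis by (simp only:)
qed

lemma open_cis_neq: "open {s. cis s \<noteq> cis t}" "open {s. cis t \<noteq> cis s}"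
  by (intro open_Collect_neq smooth_on_imp_continuous_on[OF smooth_on_cis_fun] continuous_on_const)+

context volume_action
begin

definition u :: "real \<times> real \<Rightarrow> real" where
  "u p = pd1 W p / W p"

definition K :: "real \<times> real \<Rightarrow> real" where
  "K p = pd2 u p / W p"

text \<open>The Schwarzian derivative of the affine parameter with density \<open>W (\<cdot>, t)\<close>.\<close>

definition P :: "real \<times> real \<Rightarrow> real" where
  "P p = pd1 u p - (u p)\<^sup>2 / 2"

lemma smooth_on_W: "smooth_on Off W"
  using smooth_W by (simp add: Off_def)

lemma W_nz: "p \<in> Off \<Longrightarrow> W p > 0" "p \<in> Off \<Longrightarrow> W p \<noteq> 0"
  using W_pos[of "fst p" "snd p"] by (auto simp: Off_def split_beta)

lemma smooth_on_u: "smooth_on Off u"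
  unfolding u_def[abs_def]
  by (intro smooth_on_divide open_Off smooth_on_pd smooth_on_W) (rule W_nz(2))

lemma smooth_on_K: "smooth_on Off K"
  unfolding K_def[abs_def]
  by (intro smooth_on_divide open_Off smooth_on_pd smooth_on_W smooth_on_u) (rule W_nz(2))

lemma smooth_on_P: "smooth_on Off P"
proof -
  have "smooth_on Off (\<lambda>p. pd1 u p - u p * u p * (1/2))"
    by (intro smooth_on_diff smooth_on_mult smooth_on_const open_Off smooth_on_pd smooth_on_u)
  then show ?thesis by (simp add: P_def[abs_def] power2_eq_square)
qed

lemma W_DERIV: "(s, t) \<in> Off \<Longrightarrow> ((\<lambda>s. W (s, t)) has_real_derivative u (s, t) * W (s, t)) (at s)"
  using pd_DERIV(1)[OF smooth_on_W, of s t] W_nz[of "(s, t)"] by (simp add: u_def)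

lemma u_DERIV1: "(s, t) \<in> Off \<Longrightarrow> ((\<lambda>s. u (s, t)) has_real_derivative P (s, t) + (u (s, t))\<^sup>2 / 2) (at s)"
  using pd_DERIV(1)[OF smooth_on_u, of s t] by (simp add: P_def)

lemma u_DERIV2: "(s, t) \<in> Off \<Longrightarrow> ((\<lambda>t. u (s, t)) has_real_derivative K (s, t) * W (s, t)) (at t)"
  using pd_DERIV(2)[OF smooth_on_u, of s t] W_nz[of "(s, t)"] by (simp add: K_def)

text \<open>The \<open>t\<close>-derivative of \<open>u\<close> is \<open>K * W\<close> and the
  \<open>s\<close>-derivative of \<open>W\<close> is \<open>u * W\<close>. So the
  \<open>s\<close>-derivative of \<open>K * W\<close> contains \<open>u * K * W\<close>, which is
  exactly the \<open>t\<close>-derivative of \<open>u\<^sup>2 / 2\<close>; the remaining term is the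
  claim.\<close>

lemma P_DERIV2:
  assumes st: "(s, t) \<in> Off"
  shows "((\<lambda>t. P (s, t)) has_real_derivative W (s, t) * pd1 K (s, t)) (at t)"
proof -
  have a: "((\<lambda>t. P (s, t)) has_real_derivative pd2 (pd1 u) (s, t) - u (s, t) * pd2 u (s, t)) (at t)"
  proof -
    have "((\<lambda>t. pd1 u (s, t) - u (s, t) * u (s, t) / 2) has_real_derivative
        pd2 (pd1 u) (s, t) - (pd2 u (s, t) * u (s, t) + pd2 u (s, t) * u (s, t)) / 2) (at t)"
      by (intro DERIV_diff DERIV_mult DERIV_cdivide pd_DERIV(2)[OF smooth_on_pd(1)[OF smooth_on_u] st]
        pd_DERIV(2)[OF smooth_on_u st])
    then show ?thesis by (simp add: P_def power2_eq_square mult.commute)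
  qed
  have "((\<lambda>s. K (s, t)) has_real_derivative
     (pd1 (pd2 u) (s, t) * W (s, t) - pd2 u (s, t) * (u (s, t) * W (s, t))) / (W (s, t) * W (s, t))) (at s)"
    unfolding K_def
    by (intro DERIV_divide pd_DERIV(1)[OF smooth_on_pd(2)[OF smooth_on_u] st] W_DERIV[OF st] W_nz(2)[OF st])
  from DERIV_unique[OF pd_DERIV(1)[OF smooth_on_K st] this]
  moreover have "(a * w - b * (v * w)) / (w * w) = (a - b * v) / w" if "w \<noteq> 0" for a b v w :: real
    using that by (simp add: field_simps)
  ultimately have "pd1 K (s, t) = (pd1 (pd2 u) (s, t) - pd2 u (s, t) * u (s, t)) / W (s, t)"
    using W_nz(2)[OF st] by simp
  then have "W (s, t) * pd1 K (s, t) = pd1 (pd2 u) (s, t) - u (s, t) * pd2 u (s, t)"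
    using W_nz(2)[OF st] by (simp add: mult.commute)
  then show ?thesis using a pd_commute[OF open_Off smooth_on_u st] by simp
qed

section \<open>Transformation rules of the connection, the curvature and the projective
  structures\<close>

lemma Off_image: "F \<in> \<F> \<Longrightarrow> (F s, F t) \<in> Off \<longleftrightarrow> (s, t) \<in> Off"
  by (simp add: Off_iff circle_lift_cis lift)

lemma W_inv': "F \<in> \<F> \<Longrightarrow> (s, t) \<in> Off \<Longrightarrow> W (F s, F t) * deriv F s * deriv F t = W (s, t)"
  by (simp add: W_inv Off_iff)

lemma deriv_DERIV: "F \<in> \<F> \<Longrightarrow> (deriv F has_real_derivative nonlin F s * deriv F s) (at s)"
proof -
  assume "F \<in> \<F>"
  note L = lift[OF this]
  have "deriv F s \<noteq> 0" using circle_lift_pos[OF L, of s] by simp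
  then show ?thesis
    using smooth_on_deriv(2)[OF open_UNIV smooth_on_deriv(1)[OF open_UNIV circle_lift_smooth[OF L]], of s]
    by (simp add: nonlin_def)
qed

text \<open>Logarithmic differentiation of the invariance in \<open>s\<close>: the factor
  \<open>deriv F t\<close> drops out and \<open>deriv F s\<close> contributes the nonlinearity. This
  is the rule of a connection form.\<close>

lemma u_inv:
  assumes F: "F \<in> \<F>" and st: "(s, t) \<in> Off"
  shows "u (s, t) = u (F s, F t) * deriv F s + nonlin F s"
proof -
  note L = lift[OF F]
  have FO: "(F s, F t) \<in> Off" using Off_image[OF F] st by simp
  have "((\<lambda>s. W (F s, F t)) has_real_derivative u (F s, F t) * W (F s, F t) * deriv F s) (at s)"
    by (rule DERIV_chain2[OF W_DERIV[OF FO] circle_lift_DERIV[OF L]])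
  from DERIV_cmult_right[OF DERIV_mult[OF this deriv_DERIV[OF F]], of "deriv F t"]
  have R: "((\<lambda>s. W (F s, F t) * deriv F s * deriv F t) has_real_derivative
      (u (F s, F t) * W (F s, F t) * deriv F s * deriv F s + nonlin F s * deriv F s * W (F s, F t)) * deriv F t) (at s)" .
  have "u (s, t) * W (s, t) =
      (u (F s, F t) * W (F s, F t) * deriv F s * deriv F s + nonlin F s * deriv F s * W (F s, F t)) * deriv F t"
    by (rule DERIV_eq_on_open[OF W_DERIV[OF st] R open_cis_neq(1)[of t]])
      (use st W_inv[OF F] in \<open>auto simp: Off_iff\<close>)
  also have "\<dots> = (u (F s, F t) * deriv F s + nonlin F s) * W (s, t)"
    using W_inv'[OF F st] by (simp add: algebra_simps flip: W_inv'[OF F st])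
  finally show ?thesis using W_nz(2)[OF st] by simp
qed

text \<open>The inhomogeneous term of \<open>u_inv\<close> does not involve \<open>t\<close>, so
  differentiating in \<open>t\<close> removes it, and division by \<open>W\<close> absorbs the
  remaining derivatives of \<open>F\<close>.\<close>

lemma K_inv:
  assumes F: "F \<in> \<F>" and st: "(s, t) \<in> Off"
  shows "K (F s, F t) = K (s, t)"
proof -
  note L = lift[OF F]
  have FO: "(F s, F t) \<in> Off" using Off_image[OF F] st by simp
  have "((\<lambda>t. u (F s, F t)) has_real_derivative K (F s, F t) * W (F s, F t) * deriv F t) (at t)"
    by (rule DERIV_chain2[OF u_DERIV2[OF FO] circle_lift_DERIV[OF L]])
  from DERIV_add[OF DERIV_cmult_right[OF this, of "deriv F s"] DERIV_const]
  have R: "((\<lambda>t. u (F s, F t) * deriv F s + nonlin F s) has_real_derivative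
      K (F s, F t) * W (F s, F t) * deriv F t * deriv F s + 0) (at t)" .
  have "K (s, t) * W (s, t) = K (F s, F t) * W (F s, F t) * deriv F t * deriv F s + 0"
    by (rule DERIV_eq_on_open[OF u_DERIV2[OF st] R open_cis_neq(2)[of s]])
      (use st u_inv[OF F] in \<open>auto simp: Off_iff\<close>)
  also have "\<dots> = K (F s, F t) * W (s, t)"
    by (simp add: algebra_simps flip: W_inv'[OF F st])
  finally show ?thesis using W_nz(2)[OF st] by simp
qed

text \<open>Differentiating \<open>u_inv\<close> in \<open>s\<close> gives
  \<open>deriv (nonlin F) s\<close> and mixed terms in \<open>u\<close> and \<open>nonlin F\<close>.
  Subtracting half the square of \<open>u_inv\<close> cancels the mixed terms and completes the
  Schwarzian.\<close>

lemma P_inv: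
  assumes F: "F \<in> \<F>" and st: "(s, t) \<in> Off"
  shows "P (s, t) = P (F s, F t) * (deriv F s)\<^sup>2 + sch F s"
proof -
  note L = lift[OF F]
  have nz: "deriv F x \<noteq> 0" for x using circle_lift_pos[OF L, of x] by simp
  have FO: "(F s, F t) \<in> Off" using Off_image[OF F] st by simp
  have "((\<lambda>s. u (F s, F t)) has_real_derivative (P (F s, F t) + (u (F s, F t))\<^sup>2 / 2) * deriv F s) (at s)"
    by (rule DERIV_chain2[OF u_DERIV1[OF FO] circle_lift_DERIV[OF L]])
  from DERIV_add[OF DERIV_mult[OF this deriv_DERIV[OF F]]
      smooth_on_deriv(2)[OF open_UNIV smooth_on_nonlin[OF open_UNIV circle_lift_smooth[OF L] nz] UNIV_I]]
  have R: "((\<lambda>s. u (F s, F t) * deriv F s + nonlin F s) has_real_derivative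
      (P (F s, F t) + (u (F s, F t))\<^sup>2 / 2) * deriv F s * deriv F s +
      nonlin F s * deriv F s * u (F s, F t) + deriv (nonlin F) s) (at s)" .
  have "P (s, t) + (u (s, t))\<^sup>2 / 2 = (P (F s, F t) + (u (F s, F t))\<^sup>2 / 2) * deriv F s * deriv F s +
      nonlin F s * deriv F s * u (F s, F t) + deriv (nonlin F) s"
    by (rule DERIV_eq_on_open[OF u_DERIV1[OF st] R open_cis_neq(1)[of t]])
      (use st u_inv[OF F] in \<open>auto simp: Off_iff\<close>)
  then show ?thesis
    unfolding u_inv[OF F st] sch_def by (simp add: power2_eq_square field_simps)
qed

lemma u_period_right:
  assumes "cis t = cis t'" "(s, t) \<in> Off"
  shows "u (s, t) = u (s, t')"
proof -
  have st': "(s, t') \<in> Off" using assms by (simp add: Off_iff)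
  have "u (s, t) * W (s, t) = u (s, t') * W (s, t')"
    by (rule DERIV_eq_on_open[OF W_DERIV[OF assms(2)] W_DERIV[OF st'] open_UNIV UNIV_I])
      (rule W_period[OF refl assms(1)])
  moreover have "W (s, t) = W (s, t')" using W_period[OF refl assms(1)] .
  ultimately show ?thesis using W_nz(2)[OF st'] by simp
qed

lemma P_period_right:
  assumes "cis t = cis t'" "(s, t) \<in> Off"
  shows "P (s, t) = P (s, t')"
proof -
  have st': "(s, t') \<in> Off" using assms by (simp add: Off_iff)
  have "P (s, t) + (u (s, t))\<^sup>2 / 2 = P (s, t') + (u (s, t'))\<^sup>2 / 2"
    by (rule DERIV_eq_on_open[OF u_DERIV1[OF assms(2)] u_DERIV1[OF st'] open_cis_neq(1)[of t]],
      use assms(2) in \<open>simp add: Off_iff\<close>, rule u_period_right[OF assms(1)], simp add: Off_iff)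
  then show ?thesis using u_period_right[OF assms] by simp
qed

lemma K_period_right:
  assumes "cis t = cis t'" "(s, t) \<in> Off"
  shows "K (s, t) = K (s, t')"
proof -
  have st': "(s, t') \<in> Off" using assms by (simp add: Off_iff)
  obtain k :: int where k: "t = t' + 2 * pi * of_int k" using assms(1) cis_eq_iff by blast
  have d: "((\<lambda>t. t - 2 * pi * of_int k) has_real_derivative 1) (at t)"
    by (auto intro!: derivative_eq_intros)
  have t': "t - 2 * pi * of_int k = t'" using k by simp
  have "((\<lambda>t. u (s, t - 2 * pi * of_int k)) has_real_derivative K (s, t') * W (s, t') * 1) (at t)"
    by (rule DERIV_chain2[OF _ d]) (simp only: t' u_DERIV2[OF st'])
  note D = this
  have "K (s, t) * W (s, t) = K (s, t') * W (s, t') * 1"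
  proof (rule DERIV_eq_on_open[OF u_DERIV2[OF assms(2)] D open_cis_neq(2)[of s]])
    show "t \<in> {t. cis s \<noteq> cis t}" using assms(2) by (simp add: Off_iff)
    show "u (s, y) = u (s, y - 2 * pi * of_int k)" if "y \<in> {t. cis s \<noteq> cis t}" for y
      by (rule u_period_right) (use that in \<open>simp_all add: Off_iff\<close>)
  qed
  moreover have "W (s, t) = W (s, t')" using W_period[OF refl assms(1)] .
  ultimately show ?thesis using W_nz(2)[OF st'] by simp
qed

text \<open>A translation by a period moves both arguments, so \<open>P_inv\<close> for
  \<open>shift\<close> comes first and \<open>P_period_right\<close> then corrects the second
  argument.\<close>

lemma P_period:
  assumes "cis s = cis s'" "cis t = cis t'" "(s, t) \<in> Off"
  shows "P (s, t) = P (s', t')"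
proof -
  obtain k :: int where k: "s' = s + 2 * pi * of_int k" using assms(1) cis_eq_iff by metis
  have "P (s, t) = P (s', t + 2 * pi * of_int k)"
    using P_inv[OF shift assms(3), of k] circle_lift_shift(2) by (simp add: sch_shift k)
  also have "\<dots> = P (s', t')" by (rule P_period_right) (use assms in \<open>simp_all add: Off_iff\<close>)
  finally show ?thesis .
qed

text \<open>Iterates of the hyperbolic element fix \<open>\<alpha>\<close> and carry every other
  point to \<open>\<beta>\<close>, so invariance and continuity force
  \<open>K (\<alpha>, t) = K (\<alpha>, \<beta>)\<close>. Invariance passes this value to all pairs
  whose first point lies in the orbit of \<open>\<alpha>\<close>, and that orbit comes close to
  every point of \<open>T\<close>.\<close>

lemma contracting_K_const:
  assumes contracting and T: "minimal_set T"
  obtains c where "\<And>x y. x \<in> T \<Longrightarrow> (x, y) \<in> Off \<Longrightarrow> K (x, y) = c"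
proof -
  obtain F \<alpha> \<beta> where F: "F \<in> \<F>" "\<alpha> < \<beta>" "\<beta> < \<alpha> + 2 * pi" "F \<alpha> = \<alpha>" "F \<beta> = \<beta>"
    and lim: "\<And>t. \<alpha> < t \<Longrightarrow> t < \<alpha> + 2 * pi \<Longrightarrow> (\<lambda>n. (F ^^ n) t) \<longlonglongrightarrow> \<beta>"
    using contracting_hyperbolic[OF assms(1)] by blast
  have cont: "isCont K p" if "p \<in> Off" for p
    by (rule continuous_on_eq_continuous_at[OF open_Off, THEN iffD1, rule_format,
      OF smooth_on_imp_continuous_on[OF smooth_on_K] that])
  have ab: "(\<alpha>, \<beta>) \<in> Off" using cis_less_2pi[OF F(2,3)] by (simp add: Off_iff)
  define c where "c = K (\<alpha>, \<beta>)"
  have K1: "K (\<alpha>, t) = c" if t: "\<alpha> < t" "t < \<alpha> + 2 * pi" for t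
  proof -
    have st: "(\<alpha>, t) \<in> Off" using cis_less_2pi[OF t] by (simp add: Off_iff)
    have "K (\<alpha>, (F ^^ n) t) = K (\<alpha>, t)" for n
    proof -
      have "(F ^^ n) \<alpha> = \<alpha>" by (induction n) (simp_all add: F(4))
      then show ?thesis using K_inv[OF funpow_in[OF F(1), of n] st] by simp
    qed
    moreover have "(\<lambda>n. K (\<alpha>, (F ^^ n) t)) \<longlonglongrightarrow> K (\<alpha>, \<beta>)"
      by (rule isCont_tendsto_compose[OF cont[OF ab]]) (intro tendsto_Pair tendsto_const lim t)
    ultimately have "(\<lambda>n::nat. K (\<alpha>, t)) \<longlonglongrightarrow> c" by (simp add: c_def)
    then show ?thesis using LIMSEQ_const_iff by blast
  qed
  have K2: "K (\<alpha>, t) = c" if t: "(\<alpha>, t) \<in> Off" for t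
  proof -
    obtain k :: int where k: "\<alpha> \<le> t - 2 * pi * of_int k" "t - 2 * pi * of_int k < \<alpha> + 2 * pi"
      using cis_reduce .
    have "\<alpha> \<noteq> t - 2 * pi * of_int k" using t cis_period(2)[of t k] by (auto simp: Off_iff)
    then have "K (\<alpha>, t - 2 * pi * of_int k) = c" using K1 k by simp
    then show ?thesis using K_period_right[OF _ t, of "t - 2 * pi * of_int k"] by simp
  qed
  have "K (x, y) = c" if x: "x \<in> T" and xy: "(x, y) \<in> Off" for x y
  proof (rule ccontr)
    assume ne: "K (x, y) \<noteq> c"
    have "\<bar>K (x, y) - c\<bar> > 0" using ne by simp
    then have "\<exists>d>0. \<forall>p. dist p (x, y) < d \<longrightarrow> dist (K p) (K (x, y)) < \<bar>K (x, y) - c\<bar>"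
      by (rule cont[OF xy, unfolded continuous_at_eps_delta, rule_format])
    then obtain d1 where d1: "d1 > 0" "\<And>p. dist p (x, y) < d1 \<Longrightarrow> dist (K p) (K (x, y)) < \<bar>K (x, y) - c\<bar>"
      by auto
    obtain d2 where d2: "d2 > 0" "ball (x, y) d2 \<subseteq> Off" using open_Off xy by (meson openE)
    have "min d1 d2 > 0" using d1 d2 by simp
    then obtain G where G: "G \<in> \<F>" "\<bar>G \<alpha> - x\<bar> < min d1 d2"
      using minimal_set_orbit_dense[OF T x] by blast
    have dd: "dist (G \<alpha>, y) (x, y) < min d1 d2" using G(2) by (simp add: dist_prod_def dist_real_def)
    then have "(G \<alpha>, y) \<in> ball (x, y) d2" by (simp add: dist_commute)
    then have O: "(G \<alpha>, y) \<in> Off" using d2(2) by blast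
    obtain z where z: "G z = y" using circle_lift_surj[OF lift[OF G(1)]] by blast
    have "(\<alpha>, z) \<in> Off" using O z Off_image[OF G(1)] by blast
    then have "K (G \<alpha>, y) = c" using K_inv[OF G(1), of \<alpha> z] K2[of z] z by simp
    then show False using d1(2)[of "(G \<alpha>, y)"] dd by (simp add: dist_real_def abs_minus_commute)
  qed
  then show thesis using that by blast
qed

lemma contracting_P_const:
  assumes contracting and T: "minimal_set T" and x: "x \<in> T" and y: "(x, y) \<in> Off" and z: "(x, z) \<in> Off"
  shows "P (x, y) = P (x, z)"
proof -
  obtain c where c: "\<And>x y. x \<in> T \<Longrightarrow> (x, y) \<in> Off \<Longrightarrow> K (x, y) = c"
    using contracting_K_const[OF assms(1) T] by blast
  \<comment> \<open>The derivative at \<open>x\<close> exists, so it can be computed from difference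
    quotients with points of \<open>T\<close> only, and these vanish.\<close>
  have K0: "pd1 K (x, t) = 0" if t: "(x, t) \<in> Off" for t
  proof -
    have "((\<lambda>s. (K (s, t) - K (x, t)) / (s - x)) \<longlongrightarrow> pd1 K (x, t)) (at x)"
      using pd_DERIV(1)[OF smooth_on_K t] by (simp add: has_field_derivative_iff)
    then have l1: "((\<lambda>s. (K (s, t) - K (x, t)) / (s - x)) \<longlongrightarrow> pd1 K (x, t)) (at x within T)"
      by (rule tendsto_mono[rotated]) (simp add: at_le)
    have "\<forall>\<^sub>F s in at x within T. s \<in> {s. cis s \<noteq> cis t}"
      by (rule topological_tendstoD[OF tendsto_ident_at open_cis_neq(1)]) (use t in \<open>simp add: Off_iff\<close>)
    moreover have "\<forall>\<^sub>F s in at x within T. s \<in> T" by (simp add: eventually_at_filter)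
    ultimately have "\<forall>\<^sub>F s in at x within T. (K (s, t) - K (x, t)) / (s - x) = 0"
      by eventually_elim (use c[of _ t] c[OF x t] in \<open>simp add: Off_iff\<close>)
    then have l2: "((\<lambda>s. (K (s, t) - K (x, t)) / (s - x)) \<longlongrightarrow> 0) (at x within T)"
      by (rule tendsto_eventually)
    have "x islimpt T"
      unfolding islimpt_approachable using minimal_set_perfect[OF T x] by (simp add: dist_real_def)
    then have "at x within T \<noteq> bot" by (simp add: trivial_limit_within)
    then show ?thesis using tendsto_unique l1 l2 by blast
  qed
  \<comment> \<open>Both second points are moved by periods into the interval between
    \<open>x\<close> and \<open>x + 2 * pi\<close>, on which \<open>P\<close> has derivative zero in
    its second argument.\<close>
  obtain k :: int where k: "x \<le> y - 2 * pi * of_int k" "y - 2 * pi * of_int k < x + 2 * pi"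
    using cis_reduce .
  obtain l :: int where l: "x \<le> z - 2 * pi * of_int l" "z - 2 * pi * of_int l < x + 2 * pi"
    using cis_reduce .
  define y' where "y' = y - 2 * pi * of_int k"
  define z' where "z' = z - 2 * pi * of_int l"
  have c': "cis y = cis y'" "cis z = cis z'" by (simp_all add: y'_def z'_def)
  then have "x \<noteq> y'" "x \<noteq> z'" using y z by (auto simp: Off_iff)
  then have yz: "y' \<in> {x<..<x + 2 * pi}" "z' \<in> {x<..<x + 2 * pi}" using k l by (auto simp: y'_def z'_def)
  have "P (x, y') = P (x, z')"
  proof (rule DERIV_isconst3[where f = "\<lambda>t. P (x, t)" and a = x and b = "x + 2 * pi"])
    fix t assume "t \<in> {x<..<x + 2 * pi}"
    then have "(x, t) \<in> Off" using cis_less_2pi[of x t] by (simp add: Off_iff)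
    then show "((\<lambda>t. P (x, t)) has_real_derivative 0) (at t)" using P_DERIV2[of x t] K0 by simp
  qed (use yz in auto)
  then show ?thesis using P_period_right[OF c'(1) y] P_period_right[OF c'(2) z] by simp
qed

text \<open>The equation is the hypothesis \<open>eq\<close> of
  \<open>schwarzian_vanishes_at_conj\<close>: at the points of \<open>T\<close> the group preserves
  the projective structure pulled back by \<open>H\<close>.\<close>

definition compatible :: "real set \<Rightarrow> (real \<Rightarrow> real) \<Rightarrow> bool" where
  "compatible T H \<longleftrightarrow> circle_lift H \<and>
     (\<forall>F\<in>\<F>. \<forall>x\<in>T. proj_sch H (F x) * (deriv F x)\<^sup>2 + sch F x = proj_sch H x)"

text \<open>At points of \<open>T\<close> the value of \<open>P\<close> does not depend on the
  second argument, so \<open>P_inv\<close> becomes a rule for \<open>proj_sch H\<close> alone. The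
  witness \<open>y\<close> may therefore change with \<open>x\<close>.\<close>

lemma compatibleI:
  assumes contracting and T: "minimal_set T" and H: "circle_lift H"
    and eq: "\<And>x. x \<in> T \<Longrightarrow> \<exists>y. (x, y) \<in> Off \<and> proj_sch H x = P (x, y)"
  shows "compatible T H"
  unfolding compatible_def
proof (intro conjI H ballI)
  fix F x assume F: "F \<in> \<F>" and x: "x \<in> T"
  have "inv_set T" using T by (simp add: minimal_set_def)
  then have Fx: "F x \<in> T" using inv_set_iff F x by blast
  obtain y where y: "(x, y) \<in> Off" "proj_sch H x = P (x, y)" using eq[OF x] by blast
  obtain z where z: "(F x, z) \<in> Off" "proj_sch H (F x) = P (F x, z)" using eq[OF Fx] by blast
  have FO: "(F x, F y) \<in> Off" using Off_image[OF F] y by blast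
  have "P (F x, z) = P (F x, F y)" using contracting_P_const[OF assms(1) T Fx z(1) FO] .
  then show "proj_sch H (F x) * (deriv F x)\<^sup>2 + sch F x = proj_sch H x"
    using P_inv[OF F y(1)] y z by simp
qed

end

section \<open>Construction of lifts\<close>

lemma interval_antiderivative:
  fixes f :: "real \<Rightarrow> real"
  assumes "a < c" "c < b" "smooth_on {a<..<b} f"
  obtains F where "smooth_on {a<..<b} F" "\<And>t. a < t \<Longrightarrow> t < b \<Longrightarrow> (F has_real_derivative f t) (at t)" "F c = v"
proof -
  have cont: "isCont f x" if "a < x" "x < b" for x
    by (rule continuous_on_eq_continuous_at[OF open_greaterThanLessThan, THEN iffD1, rule_format,
      OF smooth_on_imp_continuous_on[OF assms(3)]]) (use that in simp)
  have "\<exists>g. \<forall>x. ereal a < ereal x \<longrightarrow> ereal x < ereal b \<longrightarrow> (g has_vector_derivative f x) (at x)"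
    by (rule einterval_antiderivative) (use assms cont in auto)
  then obtain g where g: "\<And>x. a < x \<Longrightarrow> x < b \<Longrightarrow> (g has_real_derivative f x) (at x)"
    by (auto simp: has_real_derivative_iff_has_vector_derivative)
  have d: "((\<lambda>t. g t - g c + v) has_real_derivative f t) (at t)" if "a < t" "t < b" for t
    using g[OF that] by (auto intro!: derivative_eq_intros)
  have "smooth_on {a<..<b} (\<lambda>t. g t - g c + v)"
    by (rule smooth_on_realI[OF _ d assms(3)]) auto
  then show thesis using that[of "\<lambda>t. g t - g c + v"] d by simp
qed

section \<open>Periodic densities and lifts with a prescribed density\<close>

definition wrap :: "real \<Rightarrow> real \<Rightarrow> real" where
  "wrap a s = s - 2 * pi * of_int \<lfloor>(s - a) / (2 * pi)\<rfloor>"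

lemma wrap_eq:
  assumes "a \<le> s - 2 * pi * of_int k" "s - 2 * pi * of_int k < a + 2 * pi"
  shows "wrap a s = s - 2 * pi * of_int k"
proof -
  have "\<lfloor>(s - a) / (2 * pi)\<rfloor> = k"
    by (rule floor_unique)
      (use assms in \<open>simp_all add: pos_le_divide_eq pos_divide_less_eq algebra_simps\<close>)
  then show ?thesis by (simp add: wrap_def)
qed

text \<open>\<open>h\<close> describes the extension across the seam \<open>a\<close>: it agrees
  with \<open>f\<close> on the right, and on the left with \<open>f\<close> one period later. Away
  from the seam the extension is locally a translate of \<open>f\<close>.\<close>

lemma smooth_periodic_extension:
  fixes f h :: "real \<Rightarrow> real"
  assumes f: "smooth_on {a<..<a + 2 * pi} f" and d: "0 < d" "d \<le> 2 * pi" and h: "smooth_on {a - d<..<a + d} h"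
    and fh: "\<And>s. a \<le> s \<Longrightarrow> s < a + d \<Longrightarrow> f s = h s" "\<And>s. a - d < s \<Longrightarrow> s < a \<Longrightarrow> f (s + 2 * pi) = h s"
  shows "\<exists>p. smooth_on UNIV p \<and> (\<forall>s. p (s + 2 * pi) = p s) \<and> (\<forall>s. a \<le> s \<and> s < a + 2 * pi \<longrightarrow> p s = f s)"
proof (intro exI conjI allI impI)
  define p where "p = (\<lambda>s. f (wrap a s))"
  show "p (s + 2 * pi) = p s" for s
  proof -
    obtain k :: int where k: "a \<le> s - 2 * pi * of_int k" "s - 2 * pi * of_int k < a + 2 * pi"
      using cis_reduce .
    have "wrap a (s + 2 * pi) = s + 2 * pi - 2 * pi * of_int (k + 1)"
      by (rule wrap_eq) (use k in \<open>simp_all add: algebra_simps\<close>)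
    then have "wrap a (s + 2 * pi) = wrap a s" by (simp add: wrap_eq[OF k] algebra_simps)
    then show ?thesis by (simp add: p_def)
  qed
  show "p s = f s" if "a \<le> s \<and> s < a + 2 * pi" for s
    using wrap_eq[of a s 0] that by (simp add: p_def)
  show "smooth_on UNIV p"
  proof (rule smooth_on_local)
    fix x :: real
    obtain k :: int where k: "a \<le> x - 2 * pi * of_int k" "x - 2 * pi * of_int k < a + 2 * pi"
      using cis_reduce .
    define c where "c = 2 * pi * of_int k"
    show "\<exists>V. open V \<and> x \<in> V \<and> smooth_on V p"
    proof (cases "x - c = a")
      case False
      let ?V = "{a + c<..<a + 2 * pi + c}"
      have "smooth_on ?V (\<lambda>s. f (s - c))"
        by (rule smooth_on_compose[OF _ _ f]) (auto intro!: smooth_on_diff)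
      then have "smooth_on ?V p"
      proof (rule smooth_on_cong[rotated])
        fix s assume "s \<in> ?V"
        then have "wrap a s = s - c" unfolding c_def by (intro wrap_eq) (auto simp: c_def)
        then show "f (s - c) = p s" by (simp add: p_def)
      qed simp
      then show ?thesis using k False by (intro exI[of _ ?V]) (auto simp: c_def)
    next
      case True
      let ?V = "{a - d + c<..<a + d + c}"
      have "smooth_on ?V (\<lambda>s. h (s - c))"
        by (rule smooth_on_compose[OF _ _ h]) (auto intro!: smooth_on_diff)
      then have "smooth_on ?V p"
      proof (rule smooth_on_cong[rotated])
        fix s assume s: "s \<in> ?V"
        show "h (s - c) = p s"
        proof (cases "a + c \<le> s")
          case True
          then have "wrap a s = s - c" unfolding c_def using s d by (intro wrap_eq) (auto simp: c_def)
          then show ?thesis using fh(1)[of "s - c"] True s by (simp add: p_def)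
        next
          case False
          have "wrap a s = s - 2 * pi * of_int (k - 1)"
            using s d False by (intro wrap_eq) (auto simp: c_def algebra_simps)
          then have "wrap a s = (s - c) + 2 * pi" by (simp add: c_def algebra_simps)
          then show ?thesis using fh(2)[of "s - c"] False s by (simp add: p_def)
        qed
      qed simp
      then show ?thesis using True d by (intro exI[of _ ?V]) auto
    qed
  qed
qed

text \<open>\<open>H (t + 2 * pi) - H t\<close> has derivative zero by periodicity of
  \<open>p\<close>, so one turn measured at the single point \<open>a\<close> gives degree
  one.\<close>

lemma circle_liftI:
  assumes "smooth_on UNIV p" "\<And>s. p s > 0" "\<And>s. p (s + 2 * pi) = p s"
    and H: "\<And>s. (H has_real_derivative p s) (at s)" and a: "H (a + 2 * pi) = H a + 2 * pi"
  shows "circle_lift H" "deriv H s = p s"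
proof -
  show d: "deriv H s = p s" for s using DERIV_imp_deriv[OF H] .
  have "smooth_on UNIV H" by (rule smooth_on_realI[OF open_UNIV H assms(1)])
  moreover have "H (t + 2 * pi) = H t + 2 * pi" for t
  proof -
    have "((\<lambda>t. H (t + 2 * pi) - H t) has_real_derivative 0) (at t)" for t
    proof -
      have "((\<lambda>t. H (t + 2 * pi)) has_real_derivative p (t + 2 * pi)) (at t)"
        using DERIV_shift[of H "p (t + 2 * pi)" t "2 * pi"] H by simp
      from DERIV_diff[OF this H[of t]] show ?thesis by (simp add: assms(3))
    qed
    then have "H (t + 2 * pi) - H t = H (a + 2 * pi) - H a"
      using DERIV_isconst_all[of "\<lambda>t. H (t + 2 * pi) - H t" t a] by simp
    then show ?thesis using a by simp
  qed
  ultimately show "circle_lift H" using assms(2) d by (simp add: circle_lift_def)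
qed

lemma proj_sch_add_const:
  assumes "circle_lift H"
  shows "proj_sch (\<lambda>s. H s + c) s = proj_sch H s"
  using proj_sch_compose[OF circle_lift_shift(1) assms, of c s] circle_lift_shift(2) sch_shift
  by (simp add: proj_sch_def)

lemma proj_sch_period:
  assumes H: "circle_lift H" and "cis s = cis t"
  shows "proj_sch H s = proj_sch H t"
proof -
  obtain k :: int where k: "s = t + 2 * pi * of_int k" using assms(2) cis_eq_iff by blast
  let ?c = "2 * pi * of_int k"
  have "proj_sch H s = proj_sch (\<lambda>t. H (t + ?c)) t"
    using proj_sch_compose[OF H circle_lift_shift(1), of ?c t] circle_lift_shift(2) sch_shift k by simp
  also have "(\<lambda>t. H (t + ?c)) = (\<lambda>t. H t + ?c)" using circle_lift_period_int[OF H] by blast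
  finally show ?thesis using proj_sch_add_const[OF H] by simp
qed

section \<open>The contracting case: limit sets with a gap\<close>

context volume_action
begin

lemma smooth_on_W_left:
  assumes "open U" "\<And>s. s \<in> U \<Longrightarrow> (s, w) \<in> Off"
  shows "smooth_on U (\<lambda>s. W (s, w))"
  by (rule smooth_on_compose[OF assms(1) open_Off smooth_on_W _ assms(2)])
    (intro smooth_on_Pair smooth_on_ident smooth_on_const assms(1))

lemma Off_interval: "w < s \<Longrightarrow> s < w + 2 * pi \<Longrightarrow> (s, w) \<in> Off"
  using cis_less_2pi[of w s] by (simp add: Off_iff)

lemma Off_interval': "w - 2 * pi < s \<Longrightarrow> s < w \<Longrightarrow> (s, w) \<in> Off"
  using cis_less_2pi[of s w] by (simp add: Off_iff)

text \<open>On the interval \<open>H\<close> is \<open>c + 2 * arctan X\<close>, so in the chart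
  centred at \<open>c\<close> it is \<open>X\<close> itself, whose nonlinearity is
  \<open>u (\<cdot>, w)\<close> because its density is \<open>W (\<cdot>, w)\<close>.\<close>

lemma proj_sch_arctan:
  assumes ab: "\<And>s. a < s \<Longrightarrow> s < b \<Longrightarrow> (s, w) \<in> Off"
    and X: "\<And>s. a < s \<Longrightarrow> s < b \<Longrightarrow> (X has_real_derivative W (s, w)) (at s)"
    and H: "circle_lift H" "\<And>s. a < s \<Longrightarrow> s < b \<Longrightarrow> deriv H s = 2 * W (s, w) / (1 + (X s)\<^sup>2)"
    and s: "a < s" "s < b"
  shows "proj_sch H s = P (s, w)"
proof -
  define c where "c = H s - 2 * arctan (X s)"
  have Hc: "H t = c + 2 * arctan (X t)" if t: "a < t" "t < b" for t
  proof -
    have "(\<lambda>t. H t - 2 * arctan (X t)) t = (\<lambda>t. H t - 2 * arctan (X t)) s"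
    proof (rule DERIV_isconst3[where f = "\<lambda>t. H t - 2 * arctan (X t)" and a = a and b = b])
      fix r assume "r \<in> {a<..<b}"
      then have r: "a < r" "r < b" by auto
      have "1 + (X r)\<^sup>2 \<noteq> 0" using zero_le_power2[of "X r"] by linarith
      then show "((\<lambda>t. H t - 2 * arctan (X t)) has_real_derivative 0) (at r)"
        using circle_lift_DERIV[OF H(1), of r] X[OF r] H(2)[OF r]
        by (auto intro!: derivative_eq_intros simp: field_simps)
    qed (use s t in auto)
    then show ?thesis by (simp add: c_def)
  qed
  have o: "open {a<..<b}" by simp
  have sI: "s \<in> {a<..<b}" using s by simp
  have tX: "tan2 c (H t) = X t" if "t \<in> {a<..<b}" for t
    using Hc[of t] that by (simp add: tan2_def tan_arctan)
  have "H s \<in> tan2_dom c" using Hc[OF s] by (simp add: tan2_dom_def)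
  then have "proj_sch H s = sch (\<lambda>s. tan2 c (H s)) s"
    using sch_tan2_compose[OF open_UNIV circle_lift_smooth[OF H(1)] _ UNIV_I, of s c] circle_lift_pos[OF H(1)]
    by (simp add: less_imp_neq[THEN not_sym])
  also have "\<dots> = sch X s" by (rule sch_cong_open[OF o tX sI])
  also have "\<dots> = P (s, w)"
  proof -
    have d1: "deriv X t = W (t, w)" if "t \<in> {a<..<b}" for t
      using DERIV_imp_deriv[OF X] that by simp
    have d2: "deriv (deriv X) t = u (t, w) * W (t, w)" if t: "t \<in> {a<..<b}" for t
      using deriv_cong_open[OF o d1 t] DERIV_imp_deriv[OF W_DERIV[OF ab]] t by simp
    have d3: "nonlin X t = u (t, w)" if t: "t \<in> {a<..<b}" for t
      using d1[OF t] d2[OF t] W_nz(2)[OF ab, of t] t by (simp add: nonlin_def)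
    have "deriv (nonlin X) s = P (s, w) + (u (s, w))\<^sup>2 / 2"
      using deriv_cong_open[OF o d3 sI] DERIV_imp_deriv[OF u_DERIV1[OF ab[OF s]]] by simp
    then show ?thesis using d3[OF sI] by (simp add: sch_def)
  qed
  finally show ?thesis .
qed

text \<open>Near \<open>T\<close> the density of \<open>H\<close> is to be \<open>g\<close>, the
  derivative of \<open>2 * arctan X\<close>, but its total angle is at most one turn and may be
  less. Cutting \<open>g\<close> off inside the gap makes the angle strictly smaller than
  \<open>2 * pi\<close>, and a positive multiple of \<open>1 - \<theta>\<close> supplies the missing
  angle without touching \<open>T\<close>.\<close>

lemma compatible_gap:
  assumes c: contracting and T: "minimal_set T" and "T \<noteq> UNIV"
  shows "\<exists>H. compatible T H"
proof -
  have iT: "inv_set T" using T by (simp add: minimal_set_def)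
  obtain w where w: "w \<notin> T" using assms(3) by blast
  have "open (- T)" using iT unfolding inv_set_def closed_def by blast
  then obtain e0 where e0: "e0 > 0" "ball w e0 \<subseteq> - T" using w by (meson ComplI openE)
  define e where "e = min e0 1"
  have e: "0 < e" "e \<le> 1" using e0 by (auto simp: e_def)
  have gap: "t \<notin> T" if "\<bar>t - w\<bar> < e" for t
  proof -
    have "t \<in> ball w e0" using that by (simp add: dist_real_def e_def abs_minus_commute)
    then show ?thesis using e0(2) by blast
  qed
  have pi3: "pi > 3" using pi_gt3 .
  let ?I = "{w<..<w + 2 * pi}"
  have off: "(s, w) \<in> Off" if "s \<in> ?I" for s using Off_interval that by simp
  have sW: "smooth_on ?I (\<lambda>s. W (s, w))" by (rule smooth_on_W_left[OF _ off]) simp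
  obtain X where X: "smooth_on ?I X" "\<And>t. w < t \<Longrightarrow> t < w + 2 * pi \<Longrightarrow> (X has_real_derivative W (t, w)) (at t)"
    using interval_antiderivative[OF _ _ sW, where c = "w + pi" and v = 0] pi3 by auto
  have lt: "w + e / 3 < w + 2 * e / 3" using e by simp
  obtain \<theta>1 :: "real \<Rightarrow> real" where \<theta>1: "smooth_on UNIV \<theta>1" "\<And>x. 0 \<le> \<theta>1 x" "\<And>x. \<theta>1 x \<le> 1"
    "\<And>x. x \<le> w + e / 3 \<Longrightarrow> \<theta>1 x = 0" "\<And>x. x \<ge> w + 2 * e / 3 \<Longrightarrow> \<theta>1 x = 1"
    using smooth_cutoff[OF lt] by auto
  \<comment> \<open>The reflected factor repeats the cutoff at the other end of the period:
    \<open>\<theta>\<close> vanishes near \<open>w\<close> and near \<open>w + 2 * pi\<close> and is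
    one at the points outside the gap in between.\<close>
  define \<theta> where "\<theta> = (\<lambda>s. \<theta>1 s * \<theta>1 (2 * w + 2 * pi - s))"
  have s\<theta>: "smooth_on UNIV \<theta>"
    unfolding \<theta>_def
    by (intro smooth_on_mult open_UNIV \<theta>1(1) smooth_on_compose[OF open_UNIV open_UNIV \<theta>1(1)] smooth_on_diff
      smooth_on_const smooth_on_ident UNIV_I)
  have \<theta>01: "0 \<le> \<theta> s" "\<theta> s \<le> 1" for s
    using \<theta>1(2,3) by (auto simp: \<theta>_def mult_le_one)
  have \<theta>0: "\<theta> s = 0" if "s \<le> w + e / 3 \<or> s \<ge> w + 2 * pi - e / 3" for s
    using that \<theta>1(4)[of s] \<theta>1(4)[of "2 * w + 2 * pi - s"] by (auto simp: \<theta>_def)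
  have \<theta>1': "\<theta> s = 1" if "s \<ge> w + 2 * e / 3" "s \<le> w + 2 * pi - 2 * e / 3" for s
    using that \<theta>1(5)[of s] \<theta>1(5)[of "2 * w + 2 * pi - s"] by (auto simp: \<theta>_def)
  define g where "g = (\<lambda>s. 2 * W (s, w) / (1 + X s * X s))"
  have nz: "1 + X s * X s > 0" for s using zero_le_square[of "X s"] by linarith
  have sg: "smooth_on ?I g"
    unfolding g_def by (intro smooth_on_divide smooth_on_mult smooth_on_add smooth_on_const sW X(1))
      (use nz in \<open>auto simp: less_imp_neq[THEN not_sym]\<close>)
  have gpos: "g s > 0" if "s \<in> ?I" for s
    unfolding g_def using W_nz(1)[OF off[OF that]] nz[of s] by simp
  have sI: "smooth_on ?I \<theta>" using smooth_on_subset[OF s\<theta>] by simp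
  have e3: "0 < e / 3" "e / 3 \<le> 2 * pi" using e pi3 by auto
  have sc: "smooth_on {w - e / 3<..<w + e / 3} (\<lambda>s. c)" for c :: real by simp
  have s1: "smooth_on ?I (\<lambda>s. \<theta> s * g s)" "smooth_on ?I (\<lambda>s. 1 - \<theta> s)"
    by (intro smooth_on_mult smooth_on_diff smooth_on_const sI sg open_greaterThanLessThan)+
  have e1: "\<theta> s * g s = 0" "1 - \<theta> s = 1" if "w \<le> s" "s < w + e / 3" for s using \<theta>0[of s] that by simp_all
  have e2: "\<theta> (s + 2 * pi) * g (s + 2 * pi) = 0" "1 - \<theta> (s + 2 * pi) = 1" if "w - e / 3 < s" "s < w" for s
    using \<theta>0[of "s + 2 * pi"] that by simp_all
  from smooth_periodic_extension[OF s1(1) e3 sc e1(1) e2(1)]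
  obtain p1 where "smooth_on UNIV p1 \<and> (\<forall>s. p1 (s + 2 * pi) = p1 s) \<and>
    (\<forall>s. w \<le> s \<and> s < w + 2 * pi \<longrightarrow> p1 s = \<theta> s * g s)" by (rule exE)
  then have p1: "smooth_on UNIV p1" "p1 (s + 2 * pi) = p1 s" "w \<le> s \<Longrightarrow> s < w + 2 * pi \<Longrightarrow> p1 s = \<theta> s * g s" for s
    by simp_all
  from smooth_periodic_extension[OF s1(2) e3 sc e1(2) e2(2)]
  obtain p2 where "smooth_on UNIV p2 \<and> (\<forall>s. p2 (s + 2 * pi) = p2 s) \<and>
    (\<forall>s. w \<le> s \<and> s < w + 2 * pi \<longrightarrow> p2 s = 1 - \<theta> s)" by (rule exE)
  then have p2: "smooth_on UNIV p2" "p2 (s + 2 * pi) = p2 s" "w \<le> s \<Longrightarrow> s < w + 2 * pi \<Longrightarrow> p2 s = 1 - \<theta> s" for s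
    by simp_all
  obtain A1 where A1: "\<And>t. (A1 has_real_derivative p1 t) (at t)"
    using smooth_antiderivative[OF p1(1)] by blast
  obtain A2 where A2: "\<And>t. (A2 has_real_derivative p2 t) (at t)"
    using smooth_antiderivative[OF p2(1)] by blast
  define a where "a = w + e / 3"
  define b where "b = w + 2 * pi - e / 3"
  have ab: "w < a" "a < b" "b < w + 2 * pi" using e pi3 by (auto simp: a_def b_def)
  have I2: "A2 (w + 2 * pi) > A2 w"
  proof -
    have "A2 w < A2 a"
      by (rule DERIV_pos_imp_increasing[OF ab(1)])
        (use A2 p2(3) \<theta>0 ab in \<open>force simp: a_def\<close>)
    also have "A2 a \<le> A2 (w + 2 * pi)"
    proof (rule DERIV_nonneg_imp_nondecreasing[where f = A2])
      fix x assume x: "a \<le> x" "x \<le> w + 2 * pi"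
      have "p2 x \<ge> 0"
      proof (cases "x = w + 2 * pi")
        case True
        then show ?thesis using p2(2)[of w] p2(3)[of w] \<theta>01(2)[of w] pi3 by simp
      next
        case False
        then show ?thesis using p2(3)[of x] \<theta>01(2)[of x] x ab by simp
      qed
      then show "\<exists>y. (A2 has_real_derivative y) (at x) \<and> 0 \<le> y" using A2 by blast
    qed (use ab in simp)
    finally show ?thesis .
  qed
  have const: "A1 y = A1 x" if "x \<le> y" "w \<le> x" "y < w + 2 * pi" "y \<le> a \<or> b \<le> x" for x y
  proof (cases "x = y")
    case False
    then have "x < y" using that by simp
    then show ?thesis
    proof (rule DERIV_isconst_end)
      show "continuous_on {x..y} A1" using A1 DERIV_isCont by (blast intro: continuous_at_imp_continuous_on)
      fix t assume t: "x < t" "t < y"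
      then have "\<theta> t = 0" using that by (intro \<theta>0) (auto simp: a_def b_def)
      then show "(A1 has_real_derivative 0) (at t)" using A1[of t] p1(3)[of t] t that by simp
    qed
  qed simp
  \<comment> \<open>Between \<open>a\<close> and \<open>b\<close> the integral of
    \<open>\<theta> * g\<close> is at most that of \<open>g\<close>, which is
    \<open>2 * arctan (X b) - 2 * arctan (X a)\<close>; outside it is zero. Strictness comes from
    the bounds of \<open>arctan\<close>.\<close>
  have I1: "A1 (w + 2 * pi) - A1 w < 2 * pi"
  proof -
    have "A1 a = A1 w" using const[of w a] ab by simp
    moreover have "A1 (w + 2 * pi) = A1 b"
    proof (rule DERIV_isconst_end[OF ab(3)])
      show "continuous_on {b..w + 2 * pi} A1" using A1 DERIV_isCont by (blast intro: continuous_at_imp_continuous_on)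
      fix t assume t: "b < t" "t < w + 2 * pi"
      then have "\<theta> t = 0" by (intro \<theta>0) (auto simp: b_def)
      then show "(A1 has_real_derivative 0) (at t)" using A1[of t] p1(3)[of t] t ab by simp
    qed
    moreover have "2 * arctan (X a) - A1 a \<le> 2 * arctan (X b) - A1 b"
    proof (rule DERIV_nonneg_imp_nondecreasing[where f = "\<lambda>x. 2 * arctan (X x) - A1 x"])
      fix x assume x: "a \<le> x" "x \<le> b"
      have xI: "x \<in> ?I" using x ab by simp
      have D: "((\<lambda>x. 2 * arctan (X x) - A1 x) has_real_derivative g x - p1 x) (at x)"
        using X(2)[of x] A1[of x] xI nz[of x]
        by (auto intro!: derivative_eq_intros simp: g_def power2_eq_square field_simps)
      have "g x - p1 x = (1 - \<theta> x) * g x" using p1(3)[of x] xI by (simp add: algebra_simps)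
      also have "\<dots> \<ge> 0" using \<theta>01(2)[of x] gpos[OF xI] by simp
      finally have "g x - p1 x \<ge> 0" .
      then show "\<exists>y. ((\<lambda>x. 2 * arctan (X x) - A1 x) has_real_derivative y) (at x) \<and> 0 \<le> y" using D by blast
    qed (use ab in simp)
    ultimately show ?thesis using arctan_lbound[of "X a"] arctan_ubound[of "X b"] by simp
  qed
  \<comment> \<open>The missing angle divided by the integral of \<open>1 - \<theta>\<close>;
    positive by \<open>I1\<close> and \<open>I2\<close>.\<close>
  define c where "c = (2 * pi - (A1 (w + 2 * pi) - A1 w)) / (A2 (w + 2 * pi) - A2 w)"
  have cpos: "c > 0" unfolding c_def using I1 I2 by simp
  have ceq: "c * (A2 (w + 2 * pi) - A2 w) = 2 * pi - (A1 (w + 2 * pi) - A1 w)"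
    unfolding c_def using I2 by simp
  define p where "p = (\<lambda>s. p1 s + c * p2 s)"
  define H where "H = (\<lambda>s. A1 s + c * A2 s)"
  have sp: "smooth_on UNIV p" unfolding p_def by (intro smooth_on_add smooth_on_mult smooth_on_const p1(1) p2(1) open_UNIV)
  have pper: "p (s + 2 * pi) = p s" for s by (simp add: p_def p1(2) p2(2))
  have dH: "(H has_real_derivative p s) (at s)" for s
    unfolding H_def p_def using A1 A2 by (auto intro!: derivative_eq_intros)
  have ppos: "p s > 0" for s
  proof -
    have pos: "p s > 0" if s: "w \<le> s" "s < w + 2 * pi" for s
    proof (cases "\<theta> s = 0")
      case True
      then show ?thesis using p1(3)[OF s] p2(3)[OF s] cpos by (simp add: p_def)
    next
      case False
      then have "s \<noteq> w" using \<theta>0[of w] e by auto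
      then have "\<theta> s * g s > 0" using False \<theta>01(1)[of s] gpos[of s] s by simp
      moreover have "c * (1 - \<theta> s) \<ge> 0" using cpos \<theta>01(2)[of s] by simp
      ultimately show ?thesis using p1(3)[OF s] p2(3)[OF s] by (simp add: p_def)
    qed
    obtain k :: int where k: "w \<le> s - 2 * pi * of_int k" "s - 2 * pi * of_int k < w + 2 * pi"
      using cis_reduce .
    have "p ((s - 2 * pi * of_int k) + 2 * pi * of_int k) = p (s - 2 * pi * of_int k) + 0 * of_int k"
      by (rule periodic_int) (simp add: pper)
    then show ?thesis using pos[OF k] by simp
  qed
  have "H (w + 2 * pi) = H w + 2 * pi" using ceq by (simp add: H_def algebra_simps)
  note H = circle_liftI[OF sp ppos pper dH this]
  have "compatible T H"
  proof (rule compatibleI[OF c T H(1)])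
    fix x assume x: "x \<in> T"
    obtain k :: int where k: "w \<le> x - 2 * pi * of_int k" "x - 2 * pi * of_int k < w + 2 * pi"
      using cis_reduce .
    define y where "y = x - 2 * pi * of_int k"
    have "y \<in> T" unfolding y_def by (rule inv_set_shift'[OF iT x])
    moreover have "y - 2 * pi * of_int 1 \<in> T" by (rule inv_set_shift'[OF iT \<open>y \<in> T\<close>])
    ultimately have "\<not> \<bar>y - w\<bar> < e" "\<not> \<bar>y - 2 * pi - w\<bar> < e" using gap by auto
    then have y: "w + 2 * e / 3 < y" "y < w + 2 * pi - 2 * e / 3" using k e by (auto simp: y_def abs_less_iff)
    have "proj_sch H y = P (y, w)"
    proof (rule proj_sch_arctan[OF _ _ H(1) _ y])
      fix s assume s: "w + 2 * e / 3 < s" "s < w + 2 * pi - 2 * e / 3"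
      then have sI: "s \<in> ?I" "w < s" "s < w + 2 * pi" "w \<le> s" using e by auto
      show "(s, w) \<in> Off" by (rule off[OF sI(1)])
      show "(X has_real_derivative W (s, w)) (at s)" by (rule X(2)[OF sI(2,3)])
      show "deriv H s = 2 * W (s, w) / (1 + (X s)\<^sup>2)"
        using H(2)[of s] p1(3)[OF sI(4,3)] p2(3)[OF sI(4,3)] \<theta>1'[of s] s
        by (simp add: p_def g_def power2_eq_square)
    qed
    moreover have yw: "(y, w) \<in> Off" by (rule off) (use y e in auto)
    have cis: "cis x = cis y" by (simp add: y_def)
    moreover have "proj_sch H x = proj_sch H y" by (rule proj_sch_period[OF H(1) cis])
    moreover have "(x, w) \<in> Off" using yw cis by (simp add: Off_iff)
    moreover have "P (y, w) = P (x, w)" by (rule P_period[OF cis[symmetric] refl yw])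
    ultimately show "\<exists>y. (x, y) \<in> Off \<and> proj_sch H x = P (x, y)" by auto
  qed
  then show ?thesis by blast
qed

end

section \<open>The minimal case\<close>

context volume_action
begin

text \<open>The affine parameter \<open>X\<close> with density \<open>W (\<cdot>, \<alpha>)\<close> is multiplied by a factor greater than
  one by \<open>F\<^sup>-\<^sup>1\<close>, hence is onto the line. So the density is unbounded on both sides of \<open>\<alpha>\<close>,
  and then on both sides of each point of its orbit.\<close>

lemma hyperbolic_parameter_unbounded:
  assumes F: "F \<in> \<F>" and ab: "\<alpha> < \<beta>" "\<beta> < \<alpha> + 2 * pi" "F \<alpha> = \<alpha>" "F \<beta> = \<beta>"
    and lim: "\<And>t. \<alpha> < t \<Longrightarrow> t < \<alpha> + 2 * pi \<Longrightarrow> (\<lambda>n. (F ^^ n) t) \<longlonglongrightarrow> \<beta>"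
    and X: "\<And>s. \<alpha> < s \<Longrightarrow> s < \<alpha> + 2 * pi \<Longrightarrow> (X has_real_derivative W (s, \<alpha>)) (at s)" "X \<beta> = 0"
  shows "\<exists>s. \<alpha> < s \<and> s < \<alpha> + 2 * pi \<and> X s > M" "\<exists>s. \<alpha> < s \<and> s < \<alpha> + 2 * pi \<and> X s < M"
proof -
  let ?I = "{\<alpha><..<\<alpha> + 2 * pi}"
  define \<mu> where "\<mu> = deriv F \<alpha>"
  have \<mu>: "\<mu> > 0" unfolding \<mu>_def using circle_lift_pos[OF lift[OF F]] .
  have per: "F (\<alpha> + 2 * pi) = \<alpha> + 2 * pi" using circle_lift_period[OF lift[OF F], of \<alpha>] ab by simp
  have inI: "G s \<in> ?I" if G: "G \<in> \<F>" "G \<alpha> = \<alpha>" and s: "s \<in> ?I" for G s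
    using circle_lift_less[OF lift[OF G(1)], of \<alpha> s] circle_lift_less[OF lift[OF G(1)], of s "\<alpha> + 2 * pi"]
      circle_lift_period[OF lift[OF G(1)], of \<alpha>] G(2) s by simp
  have bI: "\<beta> \<in> ?I" using ab by simp
  \<comment> \<open>As \<open>F\<close> fixes \<open>\<alpha>\<close>, pulling the density
    \<open>W (\<cdot>, \<alpha>)\<close> back by \<open>F\<close> divides it by the constant
    \<open>\<mu>\<close>. Both sides thus have the same derivative, and they agree at
    \<open>\<beta>\<close>.\<close>
  have XF: "X (F s) = X s / \<mu>" if s: "s \<in> ?I" for s
  proof -
    have "X (F s) - X s / \<mu> = X (F \<beta>) - X \<beta> / \<mu>"
    proof (rule DERIV_isconst3[where f = "\<lambda>s. X (F s) - X s / \<mu>" and a = \<alpha> and b = "\<alpha> + 2 * pi"])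
      fix t assume t: "t \<in> ?I"
      have O: "(t, \<alpha>) \<in> Off" using Off_interval t by simp
      have "((\<lambda>s. X (F s)) has_real_derivative W (F t, \<alpha>) * deriv F t) (at t)"
        by (rule DERIV_chain2[OF X(1) circle_lift_DERIV[OF lift[OF F]]]) (use inI[OF F ab(3) t] in auto)
      from DERIV_diff[OF this DERIV_cdivide[OF X(1), of t \<mu>]]
      have "((\<lambda>s. X (F s) - X s / \<mu>) has_real_derivative W (F t, \<alpha>) * deriv F t - W (t, \<alpha>) / \<mu>) (at t)"
        using t by simp
      moreover have "W (F t, \<alpha>) * deriv F t * \<mu> = W (t, \<alpha>)"
        using W_inv'[OF F O] ab(3) by (simp add: \<mu>_def)
      then have "W (F t, \<alpha>) * deriv F t - W (t, \<alpha>) / \<mu> = 0" using \<mu> by (simp add: field_simps)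
      ultimately show "((\<lambda>s. X (F s) - X s / \<mu>) has_real_derivative 0) (at t)" by simp
    qed (use s ab in auto)
    then show ?thesis using ab X(2) by simp
  qed
  have Fn: "(F ^^ n) s \<in> ?I" if "s \<in> ?I" for n s
    by (induction n) (use inI[OF F ab(3)] that in \<open>simp_all del: greaterThanLessThan_iff\<close>)
  have XFn: "X ((F ^^ n) s) = X s / \<mu> ^ n" if "s \<in> ?I" for n s
    by (induction n) (use XF[OF Fn[OF that]] in simp_all)
  have mono: "X s < X t" if "s < t" "s \<in> ?I" "t \<in> ?I" for s t
  proof (rule DERIV_pos_imp_increasing[OF that(1)])
    fix x assume "s \<le> x" "x \<le> t"
    then have x: "\<alpha> < x" "x < \<alpha> + 2 * pi" using that by auto
    show "\<exists>y. (X has_real_derivative y) (at x) \<and> 0 < y"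
      using X(1)[OF x] W_nz(1)[OF Off_interval[OF x]] by blast
  qed
  \<comment> \<open>Otherwise \<open>X\<close> would stay at least \<open>X s\<close> along the
    orbit of a point \<open>s\<close> beyond \<open>\<beta>\<close>, although that orbit converges
    to \<open>\<beta>\<close>, where \<open>X\<close> is zero.\<close>
  have \<mu>1: "\<mu> > 1"
  proof (rule ccontr)
    assume "\<not> \<mu> > 1"
    define s where "s = (\<beta> + \<alpha> + 2 * pi) / 2"
    have s: "\<beta> < s" "s \<in> ?I" using ab by (auto simp: s_def)
    then have Xs: "X s > 0" using mono[of \<beta> s] bI X(2) by simp
    have "isCont X \<beta>" using X(1)[of \<beta>] ab DERIV_isCont by blast
    from isCont_tendsto_compose[OF this lim[of s]] have "(\<lambda>n. X ((F ^^ n) s)) \<longlonglongrightarrow> 0"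
      using s X(2) by simp
    moreover have "X s \<le> X ((F ^^ n) s)" for n
    proof -
      have "\<mu> ^ n \<le> 1" using \<open>\<not> \<mu> > 1\<close> \<mu> by (intro power_le_one) auto
      then show ?thesis using XFn[OF s(2), of n] Xs \<mu> by (simp add: pos_le_divide_eq mult_left_le)
    qed
    ultimately have "X s \<le> 0" by (intro LIMSEQ_le_const) auto
    then show False using Xs by simp
  qed
  obtain G where G: "G \<in> \<F>" "\<And>t. G (F t) = t" "\<And>t. F (G t) = t" using inverse[OF F] by blast
  have Ga: "G \<alpha> = \<alpha>" using G(2)[of \<alpha>] ab by simp
  have XG: "X (G s) = X s * \<mu>" if "s \<in> ?I" for s
    using XF[OF inI[OF G(1) Ga that]] G(3)[of s] \<mu> by (simp add: field_simps)
  have Gn: "(G ^^ n) s \<in> ?I" if "s \<in> ?I" for n s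
    by (induction n) (use inI[OF G(1) Ga] that in \<open>simp_all del: greaterThanLessThan_iff\<close>)
  have XGn: "X ((G ^^ n) s) = X s * \<mu> ^ n" if "s \<in> ?I" for n s
    by (induction n) (use XG[OF Gn[OF that]] in simp_all)
  show "\<exists>s. \<alpha> < s \<and> s < \<alpha> + 2 * pi \<and> X s > M"
  proof -
    define s where "s = (\<beta> + \<alpha> + 2 * pi) / 2"
    have s: "\<beta> < s" "s \<in> ?I" using ab by (auto simp: s_def)
    then have Xs: "X s > 0" using mono[of \<beta> s] bI X(2) by simp
    obtain n where "M / X s < \<mu> ^ n" using real_arch_pow[OF \<mu>1] by blast
    then have "M < X ((G ^^ n) s)" using XGn[OF s(2)] Xs by (simp add: pos_divide_less_eq mult.commute)
    then show ?thesis using Gn[OF s(2), of n] by auto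
  qed
  show "\<exists>s. \<alpha> < s \<and> s < \<alpha> + 2 * pi \<and> X s < M"
  proof -
    define s where "s = (\<beta> + \<alpha>) / 2"
    have s: "s < \<beta>" "s \<in> ?I" using ab by (auto simp: s_def)
    then have Xs: "X s < 0" using mono[of s \<beta>] bI X(2) by simp
    obtain n where "M / X s < \<mu> ^ n" using real_arch_pow[OF \<mu>1] by blast
    then have "X ((G ^^ n) s) < M" using XGn[OF s(2)] Xs by (simp add: neg_divide_less_eq mult.commute)
    then show ?thesis using Gn[OF s(2), of n] by auto
  qed
qed

lemma DERIV_le_bound:
  fixes X :: "real \<Rightarrow> real"
  assumes "\<And>t. a \<le> t \<Longrightarrow> t \<le> b \<Longrightarrow> (X has_real_derivative X' t) (at t)" "\<And>t. a \<le> t \<Longrightarrow> t \<le> b \<Longrightarrow> X' t \<le> M" "a \<le> b"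
  shows "X b - X a \<le> M * (b - a)"
proof (cases "a = b")
  case False
  then have "a < b" using assms(3) by simp
  then obtain z where "a < z" "z < b" "X b - X a = (b - a) * X' z" using MVT2[of a b X X'] assms(1) by blast
  then show ?thesis using assms(2)[of z] \<open>a < b\<close> by (simp add: mult.commute mult_right_mono)
qed simp

text \<open>The two sides are recorded separately, because \<open>connection_pole\<close> works on
  an interval with end point \<open>w\<close> and needs large values on its own side.\<close>

definition unbounded_at :: "real \<Rightarrow> bool" where
  "unbounded_at w \<longleftrightarrow> (\<forall>M \<delta>. \<delta> > 0 \<longrightarrow> (\<exists>s. w < s \<and> s < w + \<delta> \<and> W (s, w) > M) \<and>
     (\<exists>s. w - \<delta> < s \<and> s < w \<and> W (s, w) > M))"

text \<open>A density bounded on one side of \<open>\<alpha>\<close> would have a primitive bounded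
  there by \<open>DERIV_le_bound\<close>; by monotonicity the extreme values required by
  \<open>un\<close> can occur only on that side.\<close>

lemma unbounded_at_hyperbolic:
  assumes ab: "\<alpha> < \<beta>" "\<beta> < \<alpha> + 2 * pi"
    and X: "\<And>s. \<alpha> < s \<Longrightarrow> s < \<alpha> + 2 * pi \<Longrightarrow> (X has_real_derivative W (s, \<alpha>)) (at s)"
    and un: "\<And>M. \<exists>s. \<alpha> < s \<and> s < \<alpha> + 2 * pi \<and> X s > M" "\<And>M. \<exists>s. \<alpha> < s \<and> s < \<alpha> + 2 * pi \<and> X s < M"
  shows "unbounded_at \<alpha>"
  unfolding unbounded_at_def
proof (intro allI impI conjI)
  have mono: "X s \<le> X t" if "s \<le> t" "\<alpha> < s" "t < \<alpha> + 2 * pi" for s t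
  proof (rule DERIV_nonneg_imp_nondecreasing[OF that(1)])
    fix x assume "s \<le> x" "x \<le> t"
    then have x: "\<alpha> < x" "x < \<alpha> + 2 * pi" using that by auto
    show "\<exists>y. (X has_real_derivative y) (at x) \<and> 0 \<le> y"
      using X(1)[OF x] less_imp_le[OF W_nz(1)[OF Off_interval[OF x]]] by blast
  qed
  fix M \<delta> :: real assume \<delta>: "\<delta> > 0"
  define e where "e = min (\<delta> / 2) pi"
  have e: "0 < e" "e < \<delta>" "e \<le> pi" using \<delta> by (auto simp: e_def min_def)
  show "\<exists>s. \<alpha> < s \<and> s < \<alpha> + \<delta> \<and> W (s, \<alpha>) > M"
  proof (rule ccontr)
    assume neg: "\<not> ?thesis"
    have bd: "W (s, \<alpha>) \<le> M" if "\<alpha> < s" "s < \<alpha> + \<delta>" for s by (rule leI) (use neg that in blast)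
    obtain s where s: "\<alpha> < s" "s < \<alpha> + 2 * pi" "X s < X (\<alpha> + e) - \<bar>M\<bar> * e" using un(2) by blast
    have Me: "0 \<le> \<bar>M\<bar> * e" using e by simp
    have se: "s < \<alpha> + e"
    proof (rule ccontr)
      assume "\<not> s < \<alpha> + e"
      then have "X (\<alpha> + e) \<le> X s" using mono[of "\<alpha> + e" s] s e by simp
      then show False using s(3) Me by linarith
    qed
    have "X (\<alpha> + e) - X s \<le> \<bar>M\<bar> * (\<alpha> + e - s)"
    proof (rule DERIV_le_bound)
      fix t assume t: "s \<le> t" "t \<le> \<alpha> + e"
      show "(X has_real_derivative W (t, \<alpha>)) (at t)" by (rule X) (use s t e in auto)
      show "W (t, \<alpha>) \<le> \<bar>M\<bar>" using bd[of t] s t e by auto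
    qed (use se in simp)
    also have "\<dots> \<le> \<bar>M\<bar> * e" using s by (intro mult_left_mono) auto
    finally show False using s by simp
  qed
  show "\<exists>s. \<alpha> - \<delta> < s \<and> s < \<alpha> \<and> W (s, \<alpha>) > M"
  proof (rule ccontr)
    assume neg: "\<not> ?thesis"
    have bd': "W (s, \<alpha>) \<le> M" if "\<alpha> - \<delta> < s" "s < \<alpha>" for s by (rule leI) (use neg that in blast)
    \<comment> \<open>\<open>X\<close> sees the left side of \<open>\<alpha>\<close> at the other
      end of its interval, one period later.\<close>
    define b where "b = \<alpha> + 2 * pi"
    have bd: "W (s, \<alpha>) \<le> M" if "b - \<delta> < s" "s < b" for s
    proof -
      have "W (s, \<alpha>) = W (s - 2 * pi, \<alpha>)" by (rule W_period) (use cis_period(2)[of s 1] in simp_all)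
      then show ?thesis using bd'[of "s - 2 * pi"] that by (simp add: b_def)
    qed
    obtain s where s: "\<alpha> < s" "s < b" "X s > X (b - e) + \<bar>M\<bar> * e" using un(1) by (auto simp: b_def)
    have Me: "0 \<le> \<bar>M\<bar> * e" using e by simp
    have se: "s > b - e"
    proof (rule ccontr)
      assume "\<not> s > b - e"
      then have "X s \<le> X (b - e)" using mono[of s "b - e"] s e by (simp add: b_def)
      then show False using s(3) Me by linarith
    qed
    have "X s - X (b - e) \<le> \<bar>M\<bar> * (s - (b - e))"
    proof (rule DERIV_le_bound)
      fix t assume t: "b - e \<le> t" "t \<le> s"
      show "(X has_real_derivative W (t, \<alpha>)) (at t)" by (rule X) (use s t e in \<open>auto simp: b_def\<close>)
      show "W (t, \<alpha>) \<le> \<bar>M\<bar>" using bd[of t] s t e by auto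
    qed (use se in simp)
    also have "\<dots> \<le> \<bar>M\<bar> * e" using s by (intro mult_left_mono) auto
    finally show False using s by simp
  qed
qed

text \<open>Invariance divides the values of \<open>W\<close> by
  \<open>deriv F s * deriv F w\<close>, whose first factor is bounded for \<open>s\<close> near
  \<open>w\<close>; an increasing \<open>F\<close> also preserves the two sides.\<close>

lemma unbounded_at_image:
  assumes w: "unbounded_at w" and F: "F \<in> \<F>"
  shows "unbounded_at (F w)"
proof -
  note L = lift[OF F]
  obtain G where G: "G \<in> \<F>" "\<And>t. G (F t) = t" "\<And>t. F (G t) = t" using inverse[OF F] by blast
  have "continuous_on {w - 1..w + 1} (deriv F)"
    using smooth_on_imp_continuous_on[OF smooth_on_deriv(1)[OF open_UNIV circle_lift_smooth[OF L]]]
      continuous_on_subset by blast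
  then have "\<exists>x\<in>{w - 1..w + 1}. \<forall>y\<in>{w - 1..w + 1}. deriv F y \<le> deriv F x"
    by (intro continuous_attains_sup) auto
  then obtain B where B: "\<And>s. s \<in> {w - 1..w + 1} \<Longrightarrow> deriv F s \<le> B" by blast
  have Bpos: "B > 0" using B[of w] circle_lift_pos[OF L, of w] by simp
  have pos: "deriv F s > 0" for s using circle_lift_pos[OF L] .
  have key: "W (F s, F w) > M" if s: "s \<in> {w - 1..w + 1}" "cis s \<noteq> cis w" "W (s, w) > \<bar>M\<bar> * (B * deriv F w)" for s M
  proof (rule ccontr)
    assume "\<not> W (F s, F w) > M"
    then have "W (F s, F w) \<le> \<bar>M\<bar>" by simp
    then have "W (F s, F w) * (deriv F s * deriv F w) \<le> \<bar>M\<bar> * (B * deriv F w)"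
      using B[OF s(1)] pos[of s] pos[of w] by (intro mult_mono) auto
    then show False using W_inv[OF F s(2)] s(3) by (simp add: mult.assoc)
  qed
  show ?thesis
    unfolding unbounded_at_def
  proof (intro allI impI conjI)
    fix M \<delta> :: real assume \<delta>: "\<delta> > 0"
    have "isCont F w" using circle_lift_isCont[OF L] .
    then have "\<exists>\<epsilon>>0. \<forall>s. dist s w < \<epsilon> \<longrightarrow> dist (F s) (F w) < \<delta>"
      by (rule continuous_at_eps_delta[THEN iffD1, rule_format]) (rule \<delta>)
    then obtain \<epsilon> where \<epsilon>: "\<epsilon> > 0" "\<And>s. dist s w < \<epsilon> \<Longrightarrow> dist (F s) (F w) < \<delta>" by auto
    define \<epsilon>' where "\<epsilon>' = min \<epsilon> 1"
    have \<epsilon>': "\<epsilon>' > 0" "\<epsilon>' \<le> \<epsilon>" "\<epsilon>' \<le> 1" using \<epsilon>(1) by (auto simp: \<epsilon>'_def)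
    have pi3: "pi > 3" by (rule pi_gt3)
    obtain s where s: "w < s" "s < w + \<epsilon>'" "W (s, w) > \<bar>M\<bar> * (B * deriv F w)"
      using w \<epsilon>'(1) unfolding unbounded_at_def by blast
    have "cis s \<noteq> cis w" using Off_interval[of w s] s \<epsilon>' pi3 by (simp add: Off_iff)
    then have "W (F s, F w) > M" using key s \<epsilon>' by simp
    moreover have "F w < F s" using circle_lift_less[OF L] s by blast
    moreover have "F s < F w + \<delta>" using \<epsilon>(2)[of s] s \<epsilon>' by (simp add: dist_real_def abs_less_iff)
    ultimately show "\<exists>s. F w < s \<and> s < F w + \<delta> \<and> M < W (s, F w)" by blast
    obtain s where s: "w - \<epsilon>' < s" "s < w" "W (s, w) > \<bar>M\<bar> * (B * deriv F w)"
      using w \<epsilon>'(1) unfolding unbounded_at_def by blast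
    have "cis s \<noteq> cis w" using Off_interval'[of w s] s \<epsilon>' pi3 by (simp add: Off_iff)
    then have "W (F s, F w) > M" using key s \<epsilon>' by simp
    moreover have "F s < F w" using circle_lift_less[OF L] s by blast
    moreover have "F w - \<delta> < F s" using \<epsilon>(2)[of s] s \<epsilon>' by (simp add: dist_real_def abs_less_iff)
    ultimately show "\<exists>s. F w - \<delta> < s \<and> s < F w \<and> M < W (s, F w)" by blast
  qed
qed

text \<open>Since \<open>W (\<cdot>, \<alpha>)\<close> and \<open>W (\<cdot>, w)\<close> are densities of the same projective structure, the function
  \<open>\<theta> = (W (\<cdot>, \<alpha>) / W (\<cdot>, w))\<^sup>1\<^sup>/\<^sup>2\<close> is affine in \<open>X\<close> on each side of \<open>w\<close>;
  it vanishes at \<open>w\<close>.\<close>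

lemma connection_pole:
  assumes un: "unbounded_at w" and J: "a < b" "w = a \<or> w = b" and w: "\<alpha> < w" "w < \<alpha> + 2 * pi"
    and sub: "\<alpha> \<le> a" "b \<le> \<alpha> + 2 * pi"
    and PP: "\<And>s. a < s \<Longrightarrow> s < b \<Longrightarrow> P (s, \<alpha>) = P (s, w)"
    and X: "\<And>s. \<alpha> < s \<Longrightarrow> s < \<alpha> + 2 * pi \<Longrightarrow> (X has_real_derivative W (s, \<alpha>)) (at s)"
    and s: "a < s" "s < b"
  shows "u (s, w) = u (s, \<alpha>) - 2 * W (s, \<alpha>) / (X s - X w)"
proof -
  have O: "(t, \<alpha>) \<in> Off" if "a < t" "t < b" for t using Off_interval[of \<alpha> t] that sub by simp
  have Ow: "(t, w) \<in> Off" if "a < t" "t < b" for t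
  proof (cases "w = a")
    case True
    then show ?thesis using Off_interval[of w t] that sub w by auto
  next
    case False
    then have "w = b" using J by simp
    then show ?thesis using Off_interval'[of w t] that sub w by auto
  qed
  define \<theta> where "\<theta> = (\<lambda>t. sqrt (W (t, \<alpha>) / W (t, w)))"
  have q: "W (t, \<alpha>) / W (t, w) > 0" if "a < t" "t < b" for t
    using W_nz(1)[OF O[OF that]] W_nz(1)[OF Ow[OF that]] by simp
  have \<theta>pos: "\<theta> t > 0" if "a < t" "t < b" for t using q[OF that] by (simp add: \<theta>_def)
  \<comment> \<open>The difference of the two connection forms. Equality of the two values of
    \<open>P\<close> turns the Riccati equations for \<open>u\<close> into \<open>dv\<close>, and
    \<open>v\<close> is also -2 times the logarithmic derivative of \<open>\<theta>\<close>.\<close>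
  define v where "v = (\<lambda>t. u (t, w) - u (t, \<alpha>))"
  have dv: "(v has_real_derivative (v t)\<^sup>2 / 2 + u (t, \<alpha>) * v t) (at t)" if t: "a < t" "t < b" for t
  proof -
    have "(v has_real_derivative (P (t, w) + (u (t, w))\<^sup>2 / 2) - (P (t, \<alpha>) + (u (t, \<alpha>))\<^sup>2 / 2)) (at t)"
      unfolding v_def by (rule DERIV_diff[OF u_DERIV1[OF Ow[OF t]] u_DERIV1[OF O[OF t]]])
    moreover have "(P (t, w) + (u (t, w))\<^sup>2 / 2) - (P (t, \<alpha>) + (u (t, \<alpha>))\<^sup>2 / 2) = (v t)\<^sup>2 / 2 + u (t, \<alpha>) * v t"
      using PP[OF t] by (simp add: v_def power2_eq_square field_simps)
    ultimately show ?thesis by simp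
  qed
  have d\<theta>: "(\<theta> has_real_derivative - v t * \<theta> t / 2) (at t)" if t: "a < t" "t < b" for t
  proof -
    let ?A = "W (t, \<alpha>)" and ?B = "W (t, w)"
    have nz: "?A > 0" "?B > 0" using W_nz(1)[OF O[OF t]] W_nz(1)[OF Ow[OF t]] by auto
    have "((\<lambda>t. W (t, \<alpha>) / W (t, w)) has_real_derivative (u (t, \<alpha>) * ?A * ?B - ?A * (u (t, w) * ?B)) / (?B * ?B)) (at t)"
      by (rule DERIV_divide[OF W_DERIV[OF O[OF t]] W_DERIV[OF Ow[OF t]]]) (use nz in simp)
    also have "(u (t, \<alpha>) * ?A * ?B - ?A * (u (t, w) * ?B)) / (?B * ?B) = - v t * (?A / ?B)"
      using nz by (simp add: v_def field_simps)
    finally have D: "((\<lambda>t. W (t, \<alpha>) / W (t, w)) has_real_derivative - v t * (?A / ?B)) (at t)" .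
    have "(\<theta> has_real_derivative inverse (sqrt (?A / ?B)) / 2 * (- v t * (?A / ?B))) (at t)"
      unfolding \<theta>_def by (rule DERIV_chain2[OF DERIV_real_sqrt[OF q[OF t]] D])
    note D' = this
    have sq: "inverse (sqrt y) / 2 * (- c * y) = - c * sqrt y / 2" if "y > 0" for c y :: real
    proof -
      have "inverse (sqrt y) * y = sqrt y" using that by (simp add: real_div_sqrt divide_inverse[symmetric] mult.commute)
      moreover have "inverse (sqrt y) / 2 * (- c * y) = - c * (inverse (sqrt y) * y) / 2"
        by (simp add: algebra_simps)
      ultimately show ?thesis by (simp only:)
    qed
    show ?thesis using D' unfolding sq[OF q[OF t]] by (simp only: \<theta>_def)
  qed
  define A where "A = (- v s * \<theta> s / 2) / W (s, \<alpha>)"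
  \<comment> \<open>The quotient is the derivative of \<open>\<theta>\<close> with respect to the
    parameter \<open>X\<close>; by \<open>dv\<close> and \<open>d\<theta>\<close> it is
    constant.\<close>
  have A: "- v t * \<theta> t / 2 = A * W (t, \<alpha>)" if t: "a < t" "t < b" for t
  proof -
    have "(- v t * \<theta> t / 2) / W (t, \<alpha>) = (- v s * \<theta> s / 2) / W (s, \<alpha>)"
    proof (rule DERIV_isconst3[where f = "\<lambda>t. (- v t * \<theta> t / 2) / W (t, \<alpha>)" and a = a and b = b])
      fix r assume "r \<in> {a<..<b}"
      then have r: "a < r" "r < b" by auto
      have nz: "W (r, \<alpha>) \<noteq> 0" using W_nz(2)[OF O[OF r]] .
      have "((\<lambda>t. (- v t * \<theta> t / 2)) has_real_derivative
         (- ((v r)\<^sup>2 / 2 + u (r, \<alpha>) * v r) * \<theta> r + (- v r * \<theta> r / 2) * - v r) / 2) (at r)"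
        by (intro DERIV_cdivide DERIV_mult DERIV_minus dv d\<theta> r)
      from DERIV_divide[OF this W_DERIV[OF O[OF r]] nz]
      show "((\<lambda>t. (- v t * \<theta> t / 2) / W (t, \<alpha>)) has_real_derivative 0) (at r)"
        by (rule DERIV_cong) (simp add: power2_eq_square field_simps)
    qed (use s t in auto)
    then show ?thesis using W_nz(2)[OF O[OF t]] by (simp add: A_def field_simps)
  qed
  define B where "B = \<theta> s - A * X s"
  have \<theta>: "\<theta> t = A * X t + B" if t: "a < t" "t < b" for t
  proof -
    have "\<theta> t - A * X t = \<theta> s - A * X s"
    proof (rule DERIV_isconst3[where f = "\<lambda>t. \<theta> t - A * X t" and a = a and b = b])
      fix r assume "r \<in> {a<..<b}"
      then have r: "a < r" "r < b" by auto
      have "((\<lambda>t. \<theta> t - A * X t) has_real_derivative - v r * \<theta> r / 2 - A * W (r, \<alpha>)) (at r)"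
        by (intro DERIV_diff d\<theta> r DERIV_cmult X) (use r sub in auto)
      then show "((\<lambda>t. \<theta> t - A * X t) has_real_derivative 0) (at r)" using A[OF r] by simp
    qed (use s t in auto)
    then show ?thesis by (simp add: B_def)
  qed
  have Ww: "W (t, w) = W (t, \<alpha>) / (A * X t + B)\<^sup>2" if t: "a < t" "t < b" for t
  proof -
    have "(\<theta> t)\<^sup>2 = W (t, \<alpha>) / W (t, w)" using q[OF t] by (simp add: \<theta>_def)
    then have sq: "(A * X t + B)\<^sup>2 = W (t, \<alpha>) / W (t, w)" using \<theta>[OF t] by simp
    show ?thesis unfolding sq using W_nz(1)[OF O[OF t]] W_nz(1)[OF Ow[OF t]] by simp
  qed
  \<comment> \<open>If the affine function were nonzero at \<open>w\<close>, then by
    \<open>Ww\<close> the density \<open>W (\<cdot>, w)\<close> would stay bounded near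
    \<open>w\<close> on this side.\<close>
  have zero: "A * X w + B = 0"
  proof (rule ccontr)
    assume nz: "A * X w + B \<noteq> 0"
    define g where "g = (\<lambda>t. W (t, \<alpha>) / (A * X t + B)\<^sup>2)"
    have "isCont (\<lambda>t. W (t, \<alpha>)) w" using DERIV_isCont[OF W_DERIV[OF Off_interval[OF w]]] .
    moreover have "isCont X w" using DERIV_isCont[OF X[OF w]] .
    ultimately have "isCont g w" unfolding g_def using nz by (intro continuous_intros) auto
    then have "\<exists>\<epsilon>>0. \<forall>t. dist t w < \<epsilon> \<longrightarrow> dist (g t) (g w) < 1"
      by (rule continuous_at_eps_delta[THEN iffD1, rule_format]) simp
    then obtain \<epsilon> where \<epsilon>: "\<epsilon> > 0" "\<And>t. dist t w < \<epsilon> \<Longrightarrow> dist (g t) (g w) < 1" by auto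
    define \<delta> where "\<delta> = min \<epsilon> (b - a)"
    have \<delta>: "\<delta> > 0" "\<delta> \<le> \<epsilon>" "\<delta> \<le> b - a" using \<epsilon> J by (auto simp: \<delta>_def)
    have "\<exists>t. a < t \<and> t < b \<and> \<bar>t - w\<bar> < \<delta> \<and> W (t, w) > g w + 1"
    proof (cases "w = a")
      case True
      obtain t where "w < t" "t < w + \<delta>" "W (t, w) > g w + 1" using un \<delta>(1) unfolding unbounded_at_def by blast
      then show ?thesis using True \<delta> by (intro exI[of _ t]) auto
    next
      case False
      then have wb: "w = b" using J by simp
      obtain t where "w - \<delta> < t" "t < w" "W (t, w) > g w + 1" using un \<delta>(1) unfolding unbounded_at_def by blast
      then show ?thesis using wb \<delta> by (intro exI[of _ t]) auto
    qed
    then obtain t where t: "a < t" "t < b" "\<bar>t - w\<bar> < \<delta>" "W (t, w) > g w + 1" by blast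
    have "g t = W (t, w)" using Ww[OF t(1,2)] by (simp add: g_def)
    moreover have "dist (g t) (g w) < 1" by (rule \<epsilon>(2)) (use t \<delta> in \<open>simp add: dist_real_def\<close>)
    ultimately show False using t(4) by (simp add: dist_real_def abs_less_iff)
  qed
  then have "B = - (A * X w)" by simp
  then have th: "\<theta> s = A * (X s - X w)" using \<theta>[OF s] by (simp add: right_diff_distrib)
  have nzs: "A \<noteq> 0" "X s - X w \<noteq> 0" using \<theta>pos[OF s] th by auto
  have "v s * (A * (X s - X w)) = - 2 * (A * W (s, \<alpha>))" using A[OF s] th by simp
  then have "A * (v s * (X s - X w)) = A * (- 2 * W (s, \<alpha>))" by (simp add: mult_ac)
  then have "v s * (X s - X w) = - 2 * W (s, \<alpha>)" by (rule mult_left_cancel[OF nzs(1), THEN iffD1])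
  then have "v s = - 2 * W (s, \<alpha>) / (X s - X w)" using nzs(2) by (simp add: field_simps)
  then show ?thesis by (simp add: v_def)
qed

text \<open>The pole formula of \<open>connection_pole\<close> holds when the second point is in the
  orbit of \<open>\<alpha>\<close>, and extends to all second points by density. Its derivative in
  the second point is \<open>K * W\<close> with \<open>K\<close> constant, which determines
  \<open>W\<close>. Hence the affine parameters at \<open>\<alpha>\<close> and
  \<open>\<beta>\<close> are related by an inversion, so \<open>2 * arctan X\<close> continues
  smoothly through the pole of \<open>X\<close>.\<close>

lemma compatible_minimal:
  assumes c: contracting and T: "minimal_set UNIV"
  shows "\<exists>H. compatible UNIV H"
proof -
  obtain F \<alpha> \<beta> where F: "F \<in> \<F>" and ab: "\<alpha> < \<beta>" "\<beta> < \<alpha> + 2 * pi" "F \<alpha> = \<alpha>" "F \<beta> = \<beta>"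
    and lim: "\<And>t. \<alpha> < t \<Longrightarrow> t < \<alpha> + 2 * pi \<Longrightarrow> (\<lambda>n. (F ^^ n) t) \<longlonglongrightarrow> \<beta>"
    using contracting_hyperbolic[OF c] by blast
  obtain k0 where K: "\<And>x y. x \<in> UNIV \<Longrightarrow> (x, y) \<in> Off \<Longrightarrow> K (x, y) = k0"
    using contracting_K_const[OF c T] by blast
  have PP: "P (x, y) = P (x, z)" if "(x, y) \<in> Off" "(x, z) \<in> Off" for x y z
    using contracting_P_const[OF c T UNIV_I that] .
  let ?I = "{\<alpha><..<\<alpha> + 2 * pi}"
  have off: "(s, \<alpha>) \<in> Off" if "s \<in> ?I" for s using Off_interval that by simp
  have sW: "smooth_on ?I (\<lambda>s. W (s, \<alpha>))" by (rule smooth_on_W_left[OF _ off]) simp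
  obtain X where X: "smooth_on ?I X" "\<And>t. \<alpha> < t \<Longrightarrow> t < \<alpha> + 2 * pi \<Longrightarrow> (X has_real_derivative W (t, \<alpha>)) (at t)"
    "X \<beta> = 0"
    using interval_antiderivative[OF ab(1,2) sW] by metis
  have un: "\<exists>s. \<alpha> < s \<and> s < \<alpha> + 2 * pi \<and> X s > M" "\<exists>s. \<alpha> < s \<and> s < \<alpha> + 2 * pi \<and> X s < M" for M
    using hyperbolic_parameter_unbounded[OF F ab lim X(2,3)] by blast+
  have ua: "unbounded_at \<alpha>" by (rule unbounded_at_hyperbolic[OF ab(1,2) X(2) un])
  have mono: "X s < X t" if "s < t" "s \<in> ?I" "t \<in> ?I" for s t
  proof (rule DERIV_pos_imp_increasing[OF that(1)])
    fix x assume "s \<le> x" "x \<le> t"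
    then have x: "\<alpha> < x" "x < \<alpha> + 2 * pi" using that by auto
    show "\<exists>y. (X has_real_derivative y) (at x) \<and> 0 < y"
      using X(2)[OF x] W_nz(1)[OF Off_interval[OF x]] by blast
  qed
  have inj: "X s \<noteq> X t" if "s \<noteq> t" "s \<in> ?I" "t \<in> ?I" for s t
    using mono[of s t] mono[of t s] that by (cases s t rule: linorder_cases) auto
  have Xc: "isCont X s" if "s \<in> ?I" for s using DERIV_isCont[OF X(2)] that by simp
  have Ost: "(s, t) \<in> Off" if "s \<noteq> t" "s \<in> ?I" "t \<in> ?I" for s t
    using Off_interval[of t s] Off_interval'[of t s] that by (cases s t rule: linorder_cases) auto
  have pole_orbit: "u (s, w) = u (s, \<alpha>) - 2 * W (s, \<alpha>) / (X s - X w)"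
    if w: "unbounded_at w" "w \<in> ?I" and s: "s \<in> ?I" "s \<noteq> w" for s w
  proof -
    have PPw: "P (t, \<alpha>) = P (t, w)" if "\<alpha> < t" "t < \<alpha> + 2 * pi" "t \<noteq> w" for t
      using PP[OF off[of t] Ost[of t w]] that w(2) by simp
    show ?thesis
    proof (cases "s < w")
      case True
      show ?thesis
        by (rule connection_pole[where a = \<alpha> and b = w and \<alpha> = \<alpha> and X = X and w = w])
          (use w s True X(2) PPw in auto)
    next
      case False
      show ?thesis
        by (rule connection_pole[where a = w and b = "\<alpha> + 2 * pi" and \<alpha> = \<alpha> and X = X and w = w])
          (use w s False X(2) PPw in auto)
    qed
  qed
  have pole: "u (s, y) = u (s, \<alpha>) - 2 * W (s, \<alpha>) / (X s - X y)" if s: "s \<in> ?I" and y: "y \<in> ?I" "s \<noteq> y" for s y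
  proof (rule ccontr)
    define f where "f = (\<lambda>y. u (s, y) - (u (s, \<alpha>) - 2 * W (s, \<alpha>) / (X s - X y)))"
    assume "\<not> ?thesis"
    then have ne: "\<bar>f y\<bar> > 0" by (simp add: f_def)
    have sy: "(s, y) \<in> Off" by (rule Ost[OF y(2) s y(1)])
    have "isCont (\<lambda>y. u (s, y)) y" using DERIV_isCont[OF u_DERIV2[OF sy]] .
    then have "isCont f y" unfolding f_def using Xc[OF y(1)] inj[OF y(2) s y(1)]
      by (intro continuous_intros) auto
    then have "\<exists>\<epsilon>>0. \<forall>t. dist t y < \<epsilon> \<longrightarrow> dist (f t) (f y) < \<bar>f y\<bar>"
      by (rule continuous_at_eps_delta[THEN iffD1, rule_format]) (rule ne)
    then obtain \<epsilon> where \<epsilon>: "\<epsilon> > 0" "\<And>t. dist t y < \<epsilon> \<Longrightarrow> dist (f t) (f y) < \<bar>f y\<bar>" by auto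
    define \<delta> where "\<delta> = min \<epsilon> (min \<bar>s - y\<bar> (min (y - \<alpha>) (\<alpha> + 2 * pi - y)))"
    have \<delta>: "\<delta> > 0" "\<delta> \<le> \<epsilon>" "\<delta> \<le> \<bar>s - y\<bar>" "\<delta> \<le> y - \<alpha>" "\<delta> \<le> \<alpha> + 2 * pi - y"
      using \<epsilon>(1) y by (auto simp: \<delta>_def)
    obtain G where G: "G \<in> \<F>" "\<bar>G \<alpha> - y\<bar> < \<delta>" using minimal_set_orbit_dense[OF T UNIV_I \<delta>(1)] by blast
    have Gi: "G \<alpha> \<in> ?I" "s \<noteq> G \<alpha>" using G(2) \<delta> by (auto simp: abs_if split: if_splits)
    have "f (G \<alpha>) = 0" unfolding f_def
      using pole_orbit[OF unbounded_at_image[OF ua G(1)] Gi(1) s Gi(2)] by simp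
    then show False using \<epsilon>(2)[of "G \<alpha>"] G(2) \<delta>(2) by (simp add: dist_real_def)
  qed
  have Weq: "k0 * W (s, y) = - 2 * W (s, \<alpha>) * W (y, \<alpha>) / (X s - X y)\<^sup>2" if s: "s \<in> ?I" and y: "y \<in> ?I" "s \<noteq> y" for s y
  proof -
    have sy: "(s, y) \<in> Off" by (rule Ost[OF y(2) s y(1)])
    have nz: "X s - X y \<noteq> 0" using inj[OF y(2) s y(1)] by simp
    have dX: "(X has_real_derivative W (y, \<alpha>)) (at y)" using X(2) y(1) by simp
    have "((\<lambda>y. u (s, \<alpha>) - 2 * W (s, \<alpha>) / (X s - X y)) has_real_derivative
        - 2 * W (s, \<alpha>) * W (y, \<alpha>) / (X s - X y)\<^sup>2) (at y)"
      using dX nz by (auto intro!: derivative_eq_intros simp: power2_eq_square field_simps)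
    note R = this
    have o: "open (?I - {s})" by (intro open_delete) simp
    have "K (s, y) * W (s, y) = - 2 * W (s, \<alpha>) * W (y, \<alpha>) / (X s - X y)\<^sup>2"
      by (rule DERIV_eq_on_open[OF u_DERIV2[OF sy] R o]) (use y pole[OF s] in auto)
    then show ?thesis using K[OF UNIV_I sy] by simp
  qed
  have bI: "\<beta> \<in> ?I" using ab by simp
  \<comment> \<open>The coefficient in \<open>Weq\<close> at \<open>y = \<beta>\<close>, where
    \<open>X\<close> vanishes. Positivity of \<open>W\<close> forces \<open>k0 < 0\<close>, hence
    \<open>\<kappa> > 0\<close>.\<close>
  define \<kappa> where "\<kappa> = - 2 * W (\<beta>, \<alpha>) / k0"
  have Wb: "W (s, \<beta>) = \<kappa> * W (s, \<alpha>) / (X s)\<^sup>2 \<and> \<kappa> > 0" if s: "s \<in> ?I" "s \<noteq> \<beta>" for s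
  proof -
    have e: "k0 * W (s, \<beta>) = - (2 * W (s, \<alpha>) * W (\<beta>, \<alpha>) / (X s)\<^sup>2)"
      using Weq[OF s(1) bI s(2)] X(3) by simp
    have nz: "X s \<noteq> 0" using inj[OF s(2) s(1) bI] X(3) by simp
    have p: "W (s, \<alpha>) > 0" "W (\<beta>, \<alpha>) > 0" "W (s, \<beta>) > 0"
      by (rule W_nz(1), rule off, rule s, rule W_nz(1), rule off, rule bI, rule W_nz(1), rule Ost[OF s(2) s(1) bI])
    have "k0 * W (s, \<beta>) < 0" unfolding e using p nz by simp
    then have "k0 < 0" using p(3) by (simp add: mult_less_0_iff)
    then have "\<kappa> > 0" using p by (simp add: \<kappa>_def divide_pos_neg)
    moreover have "W (s, \<beta>) = (k0 * W (s, \<beta>)) / k0" using \<open>k0 < 0\<close> by simp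
    then have "W (s, \<beta>) = \<kappa> * W (s, \<alpha>) / (X s)\<^sup>2" unfolding e \<kappa>_def using \<open>k0 < 0\<close> by (simp add: field_simps)
    ultimately show ?thesis by blast
  qed
  define s0 where "s0 = (\<alpha> + \<beta>) / 2"
  have "s0 \<in> ?I" "s0 \<noteq> \<beta>" using ab by (auto simp: s0_def)
  then have \<kappa>: "\<kappa> > 0" using Wb by blast
  let ?J = "{\<beta> - 2 * pi<..<\<beta>}"
  have offJ: "(s, \<beta>) \<in> Off" if "s \<in> ?J" for s using Off_interval'[of \<beta> s] that by simp
  have sWJ: "smooth_on ?J (\<lambda>s. W (s, \<beta>))" by (rule smooth_on_W_left[OF _ offJ]) simp
  have aJ: "\<beta> - 2 * pi < \<alpha>" using ab by simp
  obtain Z where Z: "smooth_on ?J Z" "\<And>t. \<beta> - 2 * pi < t \<Longrightarrow> t < \<beta> \<Longrightarrow> (Z has_real_derivative W (t, \<beta>)) (at t)"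
    "Z \<alpha> = 0"
    using interval_antiderivative[OF aJ ab(1) sWJ] by metis
  have Zc: "isCont Z \<alpha>" using DERIV_isCont[OF Z(2)[OF aJ ab(1)]] .
  have Xneg: "X s < 0" if "\<alpha> < s" "s < \<beta>" for s using mono[of s \<beta>] that ab X(3) by simp
  have Xpos: "X s > 0" if "\<beta> < s" "s < \<alpha> + 2 * pi" for s using mono[of \<beta> s] that ab X(3) by simp
  text \<open>The affine parameters at \<open>\<alpha>\<close> and \<open>\<beta>\<close> differ by an inversion on both sides of \<open>\<alpha>\<close>.\<close>
  have ZX1: "Z s = - \<kappa> / X s" if s: "\<alpha> < s" "s < \<beta>" for s
  proof -
    define d where "d = Z s + \<kappa> / X s"
    have const: "Z t + \<kappa> / X t = d" if t: "\<alpha> < t" "t < \<beta>" for t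
      unfolding d_def
    proof (rule DERIV_isconst3[where f = "\<lambda>t. Z t + \<kappa> / X t" and a = \<alpha> and b = \<beta>])
      fix r assume "r \<in> {\<alpha><..<\<beta>}"
      then have r: "\<alpha> < r" "r < \<beta>" by auto
      have nz: "X r \<noteq> 0" using Xneg[OF r] by simp
      have "W (r, \<beta>) = \<kappa> * W (r, \<alpha>) / (X r)\<^sup>2" using Wb[of r] r ab by simp
      then show "((\<lambda>t. Z t + \<kappa> / X t) has_real_derivative 0) (at r)"
        using Z(2)[of r] X(2)[of r] r ab nz by (auto intro!: derivative_eq_intros simp: power2_eq_square)
    qed (use s t in auto)
    \<comment> \<open>To the right of \<open>\<alpha>\<close> the parameter \<open>X\<close> tends
      to minus infinity while \<open>Z\<close> tends to \<open>Z \<alpha> = 0\<close>, so the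
      constant of integration vanishes.\<close>
    have "d = 0"
    proof (rule ccontr)
      assume "d \<noteq> 0"
      then have dp: "\<bar>d\<bar> / 2 > 0" by simp
      have "\<exists>\<epsilon>>0. \<forall>t. dist t \<alpha> < \<epsilon> \<longrightarrow> dist (Z t) (Z \<alpha>) < \<bar>d\<bar> / 2"
        by (rule continuous_at_eps_delta[THEN iffD1, OF Zc, rule_format, OF dp])
      then obtain \<epsilon> where \<epsilon>: "\<epsilon> > 0" "\<And>t. dist t \<alpha> < \<epsilon> \<Longrightarrow> \<bar>Z t\<bar> < \<bar>d\<bar> / 2"
        using Z(3) by (auto simp: dist_real_def)
      define e where "e = min (\<epsilon> / 2) ((\<beta> - \<alpha>) / 2)"
      have "0 < e" using \<epsilon>(1) ab by (simp add: e_def)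
      moreover have "e \<le> \<epsilon> / 2" "e \<le> (\<beta> - \<alpha>) / 2"
        unfolding e_def by (rule min.cobounded1, rule min.cobounded2)
      then have "2 * e \<le> \<epsilon>" "2 * e \<le> \<beta> - \<alpha>" by simp_all
      ultimately have e: "0 < e" "e < \<epsilon>" "\<alpha> + e < \<beta>" by linarith+
      obtain r where r: "\<alpha> < r" "r < \<alpha> + 2 * pi" "X r < min (X (\<alpha> + e)) (- (2 * \<kappa> / \<bar>d\<bar>))" using un(2) by blast
      have re: "r < \<alpha> + e"
      proof (rule ccontr)
        assume "\<not> r < \<alpha> + e"
        then have "X (\<alpha> + e) \<le> X r" using mono[of "\<alpha> + e" r] r e ab by (cases "r = \<alpha> + e") auto
        then show False using r(3) by simp
      qed
      have rb: "\<alpha> < r" "r < \<beta>" using r re e by auto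
      have "2 * \<kappa> / \<bar>d\<bar> < - X r" using r(3) by simp
      then have "2 * \<kappa> < - X r * \<bar>d\<bar>" using \<open>d \<noteq> 0\<close> by (simp add: pos_divide_less_eq)
      then have "\<bar>\<kappa> / X r\<bar> < \<bar>d\<bar> / 2" using Xneg[OF rb] \<kappa> by (simp add: abs_if field_simps)
      moreover have "\<bar>Z r\<bar> < \<bar>d\<bar> / 2" by (rule \<epsilon>(2)) (use rb re e in \<open>simp add: dist_real_def\<close>)
      ultimately show False using const[OF rb] by linarith
    qed
    then show ?thesis by (simp add: d_def)
  qed
  have ZX2: "Z s = - \<kappa> / X (s + 2 * pi)" if s: "\<beta> - 2 * pi < s" "s < \<alpha>" for s
  proof -
    define d where "d = Z s + \<kappa> / X (s + 2 * pi)"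
    have dX: "((\<lambda>t. X (t + 2 * pi)) has_real_derivative W (r + 2 * pi, \<alpha>)) (at r)" if "\<beta> - 2 * pi < r" "r < \<alpha>" for r
      using DERIV_shift[of X "W (r + 2 * pi, \<alpha>)" r "2 * pi"] X(2)[of "r + 2 * pi"] that ab by simp
    have const: "Z t + \<kappa> / X (t + 2 * pi) = d" if t: "\<beta> - 2 * pi < t" "t < \<alpha>" for t
      unfolding d_def
    proof (rule DERIV_isconst3[where f = "\<lambda>t. Z t + \<kappa> / X (t + 2 * pi)" and a = "\<beta> - 2 * pi" and b = \<alpha>])
      fix r assume "r \<in> {\<beta> - 2 * pi<..<\<alpha>}"
      then have r: "\<beta> - 2 * pi < r" "r < \<alpha>" by auto
      have nz: "X (r + 2 * pi) \<noteq> 0" using Xpos[of "r + 2 * pi"] r by simp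
      have "W (r, \<beta>) = W (r + 2 * pi, \<beta>)" by (rule W_period) (use cis_period(1)[of r 1] in simp_all)
      also have "\<dots> = \<kappa> * W (r + 2 * pi, \<alpha>) / (X (r + 2 * pi))\<^sup>2" using Wb[of "r + 2 * pi"] r ab by simp
      finally show "((\<lambda>t. Z t + \<kappa> / X (t + 2 * pi)) has_real_derivative 0) (at r)"
        using Z(2)[of r] dX[OF r] r ab nz by (auto intro!: derivative_eq_intros simp: power2_eq_square)
    qed (use s t in auto)
    have "d = 0"
    proof (rule ccontr)
      assume "d \<noteq> 0"
      then have dp: "\<bar>d\<bar> / 2 > 0" by simp
      have "\<exists>\<epsilon>>0. \<forall>t. dist t \<alpha> < \<epsilon> \<longrightarrow> dist (Z t) (Z \<alpha>) < \<bar>d\<bar> / 2"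
        by (rule continuous_at_eps_delta[THEN iffD1, OF Zc, rule_format, OF dp])
      then obtain \<epsilon> where \<epsilon>: "\<epsilon> > 0" "\<And>t. dist t \<alpha> < \<epsilon> \<Longrightarrow> \<bar>Z t\<bar> < \<bar>d\<bar> / 2"
        using Z(3) by (auto simp: dist_real_def)
      define e where "e = min (\<epsilon> / 2) ((\<alpha> + 2 * pi - \<beta>) / 2)"
      have "0 < e" using \<epsilon>(1) ab by (simp add: e_def)
      moreover have "e \<le> \<epsilon> / 2" "e \<le> (\<alpha> + 2 * pi - \<beta>) / 2"
        unfolding e_def by (rule min.cobounded1, rule min.cobounded2)
      then have "2 * e \<le> \<epsilon>" "2 * e \<le> \<alpha> + 2 * pi - \<beta>" by simp_all
      ultimately have e: "0 < e" "e < \<epsilon>" "\<alpha> + 2 * pi - e > \<beta>" by linarith+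
      obtain r where r: "\<alpha> < r" "r < \<alpha> + 2 * pi" "X r > max (X (\<alpha> + 2 * pi - e)) (2 * \<kappa> / \<bar>d\<bar>)" using un(1) by blast
      have re: "r > \<alpha> + 2 * pi - e"
      proof (rule ccontr)
        assume "\<not> r > \<alpha> + 2 * pi - e"
        then have "X r \<le> X (\<alpha> + 2 * pi - e)" using mono[of r "\<alpha> + 2 * pi - e"] r e ab by (cases "r = \<alpha> + 2 * pi - e") auto
        then show False using r(3) by simp
      qed
      define q where "q = r - 2 * pi"
      have rb: "\<beta> - 2 * pi < q" "q < \<alpha>" using r re e by (auto simp: q_def)
      have Xr: "X r > 0" using Xpos[of r] r re e by simp
      have "2 * \<kappa> / \<bar>d\<bar> < X r" using r(3) by simp
      then have "2 * \<kappa> < X r * \<bar>d\<bar>" using \<open>d \<noteq> 0\<close> by (simp add: pos_divide_less_eq)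
      then have "\<bar>\<kappa> / X r\<bar> < \<bar>d\<bar> / 2" using Xr \<kappa> by (simp add: abs_if field_simps)
      moreover have "\<bar>Z q\<bar> < \<bar>d\<bar> / 2" by (rule \<epsilon>(2)) (use rb re e in \<open>simp add: dist_real_def q_def\<close>)
      moreover have "Z q + \<kappa> / X r = d" using const[OF rb] by (simp add: q_def)
      ultimately show False by linarith
    qed
    then show ?thesis by (simp add: d_def)
  qed
  define g where "g = (\<lambda>s. 2 * W (s, \<alpha>) / (1 + X s * X s))"
  define h where "h = (\<lambda>s. 2 * (W (s, \<beta>) / \<kappa>) / (1 + (Z s / \<kappa>) * (Z s / \<kappa>)))"
  have nz: "1 + x * x > 0" for x :: real using zero_le_square[of x] by linarith
  \<comment> \<open>The angular density of \<open>2 * arctan x\<close> is invariant under the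
    inversion \<open>x \<mapsto> - 1 / x\<close>, which is the change from \<open>X\<close> to
    \<open>Z / \<kappa>\<close>. So \<open>h\<close> continues \<open>g\<close> smoothly through
    \<open>\<alpha>\<close>.\<close>
  have gh: "2 * A / (1 + x * x) = 2 * (\<kappa> * A / x\<^sup>2 / \<kappa>) / (1 + (- \<kappa> / x / \<kappa>) * (- \<kappa> / x / \<kappa>))" if "x \<noteq> 0" for A x
  proof -
    have "- \<kappa> / x / \<kappa> = - (1 / x)" "\<kappa> * A / x\<^sup>2 / \<kappa> = A / x\<^sup>2" using \<kappa> by (simp_all add: field_simps)
    then have "2 * (\<kappa> * A / x\<^sup>2 / \<kappa>) / (1 + (- \<kappa> / x / \<kappa>) * (- \<kappa> / x / \<kappa>)) = 2 * (A / x\<^sup>2) / (1 + 1 / x\<^sup>2)"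
      by (simp add: power2_eq_square)
    also have "1 + 1 / x\<^sup>2 = (1 + x * x) / x\<^sup>2" using that by (simp add: field_simps power2_eq_square)
    finally show ?thesis using that by simp
  qed
  have gh1: "g s = h s" if s: "\<alpha> < s" "s < \<beta>" for s
    using gh[of "X s" "W (s, \<alpha>)"] Xneg[OF s] Wb[of s] ZX1[OF s] s ab by (simp add: g_def h_def)
  have gh2: "g (s + 2 * pi) = h s" if s: "\<beta> - 2 * pi < s" "s < \<alpha>" for s
  proof -
    have "W (s, \<beta>) = W (s + 2 * pi, \<beta>)" by (rule W_period) (use cis_period(1)[of s 1] in simp_all)
    then show ?thesis
      using gh[of "X (s + 2 * pi)" "W (s + 2 * pi, \<alpha>)"] Xpos[of "s + 2 * pi"] Wb[of "s + 2 * pi"] ZX2[OF s] s ab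
      by (simp add: g_def h_def)
  qed
  define f where "f = (\<lambda>s. if s = \<alpha> then h \<alpha> else g s)"
  have sg: "smooth_on ?I g"
    unfolding g_def by (intro smooth_on_divide smooth_on_mult smooth_on_add smooth_on_const sW X(1) open_greaterThanLessThan)
      (use nz in \<open>simp add: less_imp_neq[THEN not_sym]\<close>)
  have sf: "smooth_on ?I f" by (rule smooth_on_cong[OF _ sg]) (auto simp: f_def)
  have sh: "smooth_on ?J h"
    unfolding h_def by (intro smooth_on_divide smooth_on_mult smooth_on_add smooth_on_const sWJ Z(1) open_greaterThanLessThan)
      (rule \<kappa>[THEN less_imp_neq, THEN not_sym] nz[THEN less_imp_neq, THEN not_sym])+
  define \<delta> where "\<delta> = min (\<beta> - \<alpha>) (\<alpha> + 2 * pi - \<beta>)"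
  have \<delta>: "0 < \<delta>" "\<delta> \<le> 2 * pi" "\<delta> \<le> \<beta> - \<alpha>" "\<delta> \<le> \<alpha> + 2 * pi - \<beta>" using ab by (auto simp: \<delta>_def)
  have sh': "smooth_on {\<alpha> - \<delta><..<\<alpha> + \<delta>} h" by (rule smooth_on_subset[OF sh]) (use \<delta> in auto)
  have fh: "f s = h s" if "\<alpha> \<le> s" "s < \<alpha> + \<delta>" for s using gh1[of s] that \<delta> by (auto simp: f_def)
  have fh': "f (s + 2 * pi) = h s" if "\<alpha> - \<delta> < s" "s < \<alpha>" for s using gh2[of s] that \<delta> pi_gt_zero by (auto simp: f_def)
  obtain p where p: "smooth_on UNIV p" "\<And>s. p (s + 2 * pi) = p s" "\<And>s. \<alpha> \<le> s \<Longrightarrow> s < \<alpha> + 2 * pi \<Longrightarrow> p s = f s"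
    using smooth_periodic_extension[OF sf \<delta>(1,2) sh' fh fh'] by auto
  have hpos: "h \<alpha> > 0"
    unfolding h_def by (rule divide_pos_pos[OF _ nz]) (use \<kappa> W_nz(1)[OF offJ[of \<alpha>]] ab in simp)
  have gpos: "g s > 0" if "s \<in> ?I" for s unfolding g_def using nz W_nz(1)[OF off[OF that]] by simp
  have ppos: "p s > 0" for s
  proof -
    obtain k :: int where k: "\<alpha> \<le> s - 2 * pi * of_int k" "s - 2 * pi * of_int k < \<alpha> + 2 * pi"
      using cis_reduce .
    have "p ((s - 2 * pi * of_int k) + 2 * pi * of_int k) = p (s - 2 * pi * of_int k) + 0 * of_int k"
      by (rule periodic_int) (simp add: p(2))
    moreover have "f (s - 2 * pi * of_int k) > 0" using hpos gpos k by (auto simp: f_def)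
    ultimately show ?thesis using p(3)[OF k] by simp
  qed
  obtain H where dH: "\<And>t. (H has_real_derivative p t) (at t)"
    using smooth_antiderivative[OF p(1)] by blast
  have Hc: "isCont H s" for s using DERIV_isCont[OF dH] .
  define c0 where "c0 = H \<beta> - 2 * arctan (X \<beta>)"
  have Harc: "H s = c0 + 2 * arctan (X s)" if s: "s \<in> ?I" for s
  proof -
    have "H s - 2 * arctan (X s) = H \<beta> - 2 * arctan (X \<beta>)"
    proof (rule DERIV_isconst3[where f = "\<lambda>t. H t - 2 * arctan (X t)" and a = \<alpha> and b = "\<alpha> + 2 * pi"])
      fix r assume "r \<in> ?I"
      then have r: "\<alpha> < r" "r < \<alpha> + 2 * pi" by auto
      have "p r = 2 * W (r, \<alpha>) / (1 + X r * X r)" using p(3)[of r] r by (simp add: f_def g_def)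
      then show "((\<lambda>t. H t - 2 * arctan (X t)) has_real_derivative 0) (at r)"
        using dH[of r] X(2)[OF r] nz[of "X r"]
        by (auto intro!: derivative_eq_intros simp: power2_eq_square field_simps)
    qed (use s ab in auto)
    then show ?thesis by (simp add: c0_def)
  qed
  \<comment> \<open>\<open>X\<close> is unbounded at both ends of its interval, so
    \<open>2 * arctan X\<close> sweeps half a turn on each side of \<open>c0\<close>, exactly one
    turn in all.\<close>
  have Hend: "H (\<alpha> + 2 * pi) = c0 + pi"
  proof (rule tendsto_unique)
    show "at_left (\<alpha> + 2 * pi) \<noteq> bot" by simp
    show "(H \<longlongrightarrow> H (\<alpha> + 2 * pi)) (at_left (\<alpha> + 2 * pi))"
      using Hc[of "\<alpha> + 2 * pi"] unfolding isCont_def by (rule tendsto_mono[rotated]) (simp add: at_le)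
    have "filterlim X at_top (at_left (\<alpha> + 2 * pi))"
      unfolding filterlim_at_top
    proof
      fix M
      obtain r where r: "\<alpha> < r" "r < \<alpha> + 2 * pi" "X r > M" using un(1) by blast
      have "M \<le> X s" if "r < s" "s < \<alpha> + 2 * pi" for s using mono[of r s] r that by simp
      then show "\<forall>\<^sub>F s in at_left (\<alpha> + 2 * pi). M \<le> X s"
        unfolding eventually_at_left_field using r(2) by blast
    qed
    then have "((\<lambda>s. c0 + 2 * arctan (X s)) \<longlongrightarrow> c0 + 2 * (pi / 2)) (at_left (\<alpha> + 2 * pi))"
      by (intro tendsto_intros filterlim_compose[OF tendsto_arctan_at_top])
    moreover have "\<forall>\<^sub>F s in at_left (\<alpha> + 2 * pi). H s = c0 + 2 * arctan (X s)"
      unfolding eventually_at_left_field using Harc ab by (intro exI[of _ \<beta>]) auto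
    ultimately show "(H \<longlongrightarrow> c0 + pi) (at_left (\<alpha> + 2 * pi))"
      by (simp add: tendsto_cong)
  qed
  have Hstart: "H \<alpha> = c0 - pi"
  proof (rule tendsto_unique)
    show "at_right \<alpha> \<noteq> bot" by simp
    show "(H \<longlongrightarrow> H \<alpha>) (at_right \<alpha>)"
      using Hc[of \<alpha>] unfolding isCont_def by (rule tendsto_mono[rotated]) (simp add: at_le)
    have "filterlim X at_bot (at_right \<alpha>)"
      unfolding filterlim_at_bot
    proof
      fix M
      obtain r where r: "\<alpha> < r" "r < \<alpha> + 2 * pi" "X r < M" using un(2) by blast
      have "X s \<le> M" if "\<alpha> < s" "s < r" for s using mono[of s r] r that by simp
      then show "\<forall>\<^sub>F s in at_right \<alpha>. X s \<le> M"
        unfolding eventually_at_right_field using r(1) by blast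
    qed
    then have "((\<lambda>s. c0 + 2 * arctan (X s)) \<longlongrightarrow> c0 + 2 * (- (pi / 2))) (at_right \<alpha>)"
      by (intro tendsto_intros filterlim_compose[OF tendsto_arctan_at_bot])
    moreover have "\<forall>\<^sub>F s in at_right \<alpha>. H s = c0 + 2 * arctan (X s)"
      unfolding eventually_at_right_field using Harc ab by (intro exI[of _ \<beta>]) auto
    ultimately show "(H \<longlongrightarrow> c0 - pi) (at_right \<alpha>)"
      by (simp add: tendsto_cong)
  qed
  have "H (\<alpha> + 2 * pi) = H \<alpha> + 2 * pi" using Hend Hstart by simp
  note H = circle_liftI[OF p(1) ppos p(2) dH this]
  have inner: "proj_sch H s = P (s, \<alpha>)" if s: "s \<in> ?I" for s
  proof (rule proj_sch_arctan[where a = \<alpha> and b = "\<alpha> + 2 * pi" and X = X])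
    fix t assume t: "\<alpha> < t" "t < \<alpha> + 2 * pi"
    show "(t, \<alpha>) \<in> Off" using Off_interval[OF t] .
    show "(X has_real_derivative W (t, \<alpha>)) (at t)" using X(2)[OF t] .
    show "deriv H t = 2 * W (t, \<alpha>) / (1 + (X t)\<^sup>2)"
      using H(2)[of t] p(3)[of t] t by (simp add: f_def g_def power2_eq_square)
  qed (use s H(1) in auto)
  have inner': "proj_sch H s = P (s, \<beta>)" if s: "s \<in> ?I" "s \<noteq> \<beta>" for s
    using inner[OF s(1)] PP[OF off[OF s(1)] Ost[OF s(2) s(1) bI]] by simp
  have ab': "(\<alpha>, \<beta>) \<in> Off" using offJ[of \<alpha>] ab by simp
  \<comment> \<open>The interval of \<open>X\<close> excludes \<open>\<alpha>\<close>, so the second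
    point is changed to \<open>\<beta>\<close> and the identity is extended to
    \<open>\<alpha>\<close> by continuity.\<close>
  have at_a: "proj_sch H \<alpha> = P (\<alpha>, \<beta>)"
  proof (rule tendsto_unique)
    show "at_right \<alpha> \<noteq> bot" by simp
    have nzH: "deriv H s \<noteq> 0" for s using circle_lift_pos[OF H(1), of s] by simp
    have "continuous_on UNIV (\<lambda>s. sch H s + (deriv H s)\<^sup>2 / 2)"
      by (intro continuous_intros smooth_on_imp_continuous_on[OF smooth_on_sch[OF open_UNIV circle_lift_smooth[OF H(1)] nzH]]
        smooth_on_imp_continuous_on[OF smooth_on_deriv(1)[OF open_UNIV circle_lift_smooth[OF H(1)]]]) auto
    then have "isCont (proj_sch H) \<alpha>"
      by (simp add: continuous_on_eq_continuous_at proj_sch_def[abs_def])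
    then show "(proj_sch H \<longlongrightarrow> proj_sch H \<alpha>) (at_right \<alpha>)"
      unfolding isCont_def by (rule tendsto_mono[rotated]) (simp add: at_le)
    have "isCont (\<lambda>s. P (s, \<beta>)) \<alpha>"
      using DERIV_isCont[OF pd_DERIV(1)[OF smooth_on_P ab']] .
    then have "((\<lambda>s. P (s, \<beta>)) \<longlongrightarrow> P (\<alpha>, \<beta>)) (at_right \<alpha>)"
      unfolding isCont_def by (rule tendsto_mono[rotated]) (simp add: at_le)
    moreover have "\<forall>\<^sub>F s in at_right \<alpha>. proj_sch H s = P (s, \<beta>)"
      unfolding eventually_at_right_field using inner' ab by (intro exI[of _ \<beta>]) auto
    ultimately show "(proj_sch H \<longlongrightarrow> P (\<alpha>, \<beta>)) (at_right \<alpha>)"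
      by (simp add: tendsto_cong)
  qed
  have "compatible UNIV H"
  proof (rule compatibleI[OF c T H(1)])
    fix x :: real
    obtain k :: int where k: "\<alpha> \<le> x - 2 * pi * of_int k" "x - 2 * pi * of_int k < \<alpha> + 2 * pi"
      using cis_reduce .
    define y where "y = x - 2 * pi * of_int k"
    have cis: "cis x = cis y" by (simp add: y_def)
    have "\<exists>z. (y, z) \<in> Off \<and> proj_sch H y = P (y, z)"
    proof (cases "y = \<alpha>")
      case True
      then show ?thesis using at_a ab' by auto
    next
      case False
      then have "y \<in> ?I" using k by (auto simp: y_def)
      then show ?thesis using inner off by blast
    qed
    then obtain z where z: "(y, z) \<in> Off" "proj_sch H y = P (y, z)" by blast
    then have "(x, z) \<in> Off" using cis by (simp add: Off_iff)
    moreover have "proj_sch H x = P (x, z)"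
      using proj_sch_period[OF H(1) cis] z P_period[OF cis[symmetric] refl z(1)] by simp
    ultimately show "\<exists>y. (x, y) \<in> Off \<and> proj_sch H x = P (x, y)" by blast
  qed
  then show ?thesis by blast
qed

end

section \<open>The equicontinuous case\<close>

context volume_action
begin

text \<open>Without a uniform bound there are arcs of length \<open>e'\<close> with ever shorter
  images. Their starting points accumulate at some \<open>l\<close>, and the middle third of the arc
  starting at \<open>l\<close> lies in infinitely many of them, so this one arc would be
  contracted.\<close>

lemma noncontracting_uniform:
  assumes nc: "\<not> contracting" and e: "e > 0"
  obtains d where "d > 0" "\<And>F p q. F \<in> \<F> \<Longrightarrow> e \<le> q - p \<Longrightarrow> d \<le> F q - F p"
proof -
  define e' where "e' = min e pi"
  have e': "0 < e'" "e' \<le> e" "e' \<le> pi" using e by (auto simp: e'_def)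
  have "\<exists>d>0. \<forall>F\<in>\<F>. \<forall>p. 0 \<le> p \<and> p \<le> 2 * pi \<longrightarrow> d \<le> F (p + e') - F p"
  proof (rule ccontr)
    assume neg: "\<not> ?thesis"
    define Q where "Q d F p \<longleftrightarrow> F \<in> \<F> \<and> 0 \<le> p \<and> p \<le> 2 * pi \<and> F (p + e') - F p < d" for d F p
    have "\<exists>F p. Q d F p" if "d > 0" for d
    proof (rule ccontr)
      assume "\<nexists>F p. Q d F p"
      then have "\<forall>F\<in>\<F>. \<forall>p. 0 \<le> p \<and> p \<le> 2 * pi \<longrightarrow> d \<le> F (p + e') - F p"
        by (auto simp: Q_def not_less)
      then show False using neg that by blast
    qed
    then have "\<forall>n::nat. \<exists>F p. Q (1 / real (Suc n)) F p" by simp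
    then obtain F p where Fp: "\<And>n. Q (1 / real (Suc n)) (F n) (p n)" by metis
    have "\<forall>n. p n \<in> {0..2 * pi}" using Fp by (simp add: Q_def)
    then have "\<exists>l\<in>{0..2 * pi}. \<exists>r. strict_mono r \<and> (p \<circ> r) \<longlonglongrightarrow> l"
      by (intro compact_Icc[unfolded compact_def, rule_format]) simp
    then obtain l \<phi> where l: "strict_mono (\<phi> :: nat \<Rightarrow> nat)" "(p \<circ> \<phi>) \<longlonglongrightarrow> l" by auto
    have contracting
      unfolding contracting_def
    proof (intro exI conjI allI impI)
      show "l + e' / 3 < l + 2 * e' / 3" "l + 2 * e' / 3 < l + e' / 3 + 2 * pi" using e' by auto
      fix \<eta> :: real assume \<eta>: "\<eta> > 0"
      obtain N where N: "1 / real (Suc N) < \<eta>" using nat_approx_posE[OF \<eta>] by blast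
      have "\<forall>\<^sub>F n in sequentially. dist ((p \<circ> \<phi>) n) l < e' / 3" by (rule tendstoD[OF l(2)]) (use e' in simp)
      moreover have "\<forall>\<^sub>F n in sequentially. N \<le> n" by (rule eventually_ge_at_top)
      ultimately have "\<forall>\<^sub>F n in sequentially. dist ((p \<circ> \<phi>) n) l < e' / 3 \<and> N \<le> n" by (rule eventually_conj)
      then obtain n where n: "dist (p (\<phi> n)) l < e' / 3" "N \<le> n" by (auto simp: eventually_sequentially)
      have "N \<le> \<phi> n" using n(2) seq_suble[OF l(1), of n] by linarith
      then have "1 / real (Suc (\<phi> n)) \<le> 1 / real (Suc N)" by (intro divide_left_mono) auto
      then have small: "F (\<phi> n) (p (\<phi> n) + e') - F (\<phi> n) (p (\<phi> n)) < \<eta>" and F: "F (\<phi> n) \<in> \<F>"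
        using Fp[of "\<phi> n"] N by (auto simp: Q_def)
      have "F (\<phi> n) (l + 2 * e' / 3) \<le> F (\<phi> n) (p (\<phi> n) + e')" "F (\<phi> n) (p (\<phi> n)) \<le> F (\<phi> n) (l + e' / 3)"
        using n(1) unfolding circle_lift_le[OF lift[OF F]] dist_real_def by linarith+
      then show "\<exists>F\<in>\<F>. F (l + 2 * e' / 3) - F (l + e' / 3) < \<eta>"
        using small F by (intro bexI[OF _ F]) linarith
    qed
    then show False using nc by blast
  qed
  then obtain d where d: "d > 0" "\<And>F p. F \<in> \<F> \<Longrightarrow> 0 \<le> p \<Longrightarrow> p \<le> 2 * pi \<Longrightarrow> d \<le> F (p + e') - F p" by blast
  have "d \<le> F q - F p" if F: "F \<in> \<F>" and pq: "e \<le> q - p" for F p q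
  proof -
    obtain k :: int where k: "0 \<le> p - 2 * pi * of_int k" "p - 2 * pi * of_int k < 0 + 2 * pi"
      using cis_reduce .
    have "F (p + x) = F (p - 2 * pi * of_int k + x) + 2 * pi * of_int k" for x
      using circle_lift_period_int[OF lift[OF F], of "p - 2 * pi * of_int k + x" k] by (simp add: algebra_simps)
    from this[of e'] this[of 0] have "d \<le> F (p + e') - F p" using d(2)[OF F k(1)] k(2) by simp
    moreover have "F (p + e') \<le> F q" using circle_lift_le[OF lift[OF F]] pq e' by simp
    ultimately show ?thesis by simp
  qed
  then show thesis using that d(1) by blast
qed

text \<open>The weights at \<open>y\<close> and \<open>z\<close> cancel, so this is a quadratic
  density at \<open>x\<close> depending on two auxiliary points; \<open>lam_inv\<close> is its
  transformation rule.\<close>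

definition lam :: "real \<Rightarrow> real \<Rightarrow> real \<Rightarrow> real" where
  "lam x y z = W (x, y) * W (x, z) / W (y, z)"

lemma lam_inv:
  assumes F: "F \<in> \<F>" and O: "(x, y) \<in> Off" "(x, z) \<in> Off" "(y, z) \<in> Off"
  shows "lam (F x) (F y) (F z) * (deriv F x)\<^sup>2 = lam x y z"
proof -
  have nz: "deriv F t \<noteq> 0" for t using circle_lift_pos[OF lift[OF F], of t] by simp
  have "W (F y, F z) \<noteq> 0" using W_nz(2) O(3) Off_image[OF F] by blast
  then show ?thesis
    unfolding lam_def W_inv'[OF F O(1), symmetric] W_inv'[OF F O(2), symmetric] W_inv'[OF F O(3), symmetric]
    using nz by (simp add: field_simps power2_eq_square)
qed

definition t3 :: real where "t3 = 2 * pi / 3"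

lemma t3: "0 < t3" "3 * t3 = 2 * pi"
  by (simp_all add: t3_def)

lemma Off_less: "x < y \<Longrightarrow> y < x + 2 * pi \<Longrightarrow> (x, y) \<in> Off"
  using cis_less_2pi by (simp add: Off_iff)

lemma lam_bounds:
  assumes "0 < m" "m \<le> w1" "w1 \<le> M" "m \<le> w2" "w2 \<le> M" "m \<le> w3" "w3 \<le> (M::real)"
  shows "m * m / M \<le> w1 * w2 / w3" "w1 * w2 / w3 \<le> M * M / m"
  using assms by (auto intro!: frac_le mult_mono)

text \<open>\<open>noncontracting_uniform\<close> keeps the images of three equally spaced points
  apart, so \<open>lam\<close> lies between positive constants before and after applying
  \<open>F\<close>. By \<open>lam_inv\<close> the quotient of the two values is the square of the
  derivative.\<close>

lemma deriv_bounds: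
  assumes nc: "\<not> contracting"
  obtains a b where "0 < a" "\<And>F x. F \<in> \<F> \<Longrightarrow> a \<le> deriv F x" "\<And>F x. F \<in> \<F> \<Longrightarrow> deriv F x \<le> b"
proof -
  obtain d0 where d0: "d0 > 0" "\<And>F p q. F \<in> \<F> \<Longrightarrow> t3 \<le> q - p \<Longrightarrow> d0 \<le> F q - F p"
    using noncontracting_uniform[OF nc t3(1)] by blast
  define d where "d = min d0 t3"
  have d: "d > 0" "d \<le> d0" "d \<le> t3" using d0 t3 by (auto simp: d_def)
  obtain m M where m: "0 < m" "0 < M"
    "\<And>x y. d \<le> y - x \<Longrightarrow> y - x \<le> 2 * pi - d \<Longrightarrow> m \<le> W (x, y) \<and> W (x, y) \<le> M"
    using W_bounds[OF d(1)] by blast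
  define lo where "lo = m * m / M"
  define hi where "hi = M * M / m"
  have lo: "lo > 0" "hi > 0" using m by (simp_all add: lo_def hi_def)
  have lam: "lo \<le> lam x y z \<and> lam x y z \<le> hi"
    if "d \<le> y - x" "d \<le> z - y" "d \<le> x + 2 * pi - z" for x y z
  proof -
    have "m \<le> W (x, y) \<and> W (x, y) \<le> M" "m \<le> W (x, z) \<and> W (x, z) \<le> M" "m \<le> W (y, z) \<and> W (y, z) \<le> M"
      by (intro m(3); use that d in linarith)+
    then show ?thesis unfolding lam_def lo_def hi_def using lam_bounds[OF m(1)] by auto
  qed
  define A where "A = lo / hi"
  define B where "B = hi / lo"
  have A: "A > 0" using lo by (simp add: A_def)
  have sq: "A \<le> (deriv F x)\<^sup>2 \<and> (deriv F x)\<^sup>2 \<le> B" if F: "F \<in> \<F>" for F x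
  proof -
    let ?y = "x + t3" and ?z = "x + 2 * t3"
    have O: "(x, ?y) \<in> Off" "(x, ?z) \<in> Off" "(?y, ?z) \<in> Off"
      by (intro Off_less; use t3 in linarith)+
    have l1: "lo \<le> lam x ?y ?z" "lam x ?y ?z \<le> hi"
      using lam[where x = x and y = ?y and z = ?z] d t3 by auto
    have "d0 \<le> F ?y - F x" "d0 \<le> F ?z - F ?y" "d0 \<le> F (x + 2 * pi) - F ?z"
      by (intro d0(2)[OF F]; use t3 in linarith)+
    then have l2: "lo \<le> lam (F x) (F ?y) (F ?z)" "lam (F x) (F ?y) (F ?z) \<le> hi"
      using lam[where x = "F x" and y = "F ?y" and z = "F ?z"] d circle_lift_period[OF lift[OF F], of x] by auto
    have "(deriv F x)\<^sup>2 = lam x ?y ?z / lam (F x) (F ?y) (F ?z)"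
      using lam_inv[OF F O] l2(1) lo by (simp add: field_simps)
    then show ?thesis unfolding A_def B_def using l1 l2 lo by (auto intro!: frac_le)
  qed
  show thesis
  proof (rule that[of "sqrt A" "sqrt B"])
    show "0 < sqrt A" using A by simp
    fix F x assume F: "F \<in> \<F>"
    have "deriv F x > 0" using circle_lift_pos[OF lift[OF F]] .
    then show "sqrt A \<le> deriv F x" "deriv F x \<le> sqrt B"
      using sq[OF F, of x] by (auto intro: real_le_lsqrt real_le_rsqrt)
  qed
qed

lemma u_bound:
  assumes d: "0 < d" "d \<le> pi"
  obtains U where "\<And>x y. d \<le> y - x \<Longrightarrow> y - x \<le> 2 * pi - d \<Longrightarrow> \<bar>u (x, y)\<bar> \<le> U"
proof -
  define D where "D = (\<lambda>(x, r). (x, x + r)) ` ({0..2 * pi} \<times> {d..2 * pi - d})"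
  have cD: "compact D" unfolding D_def
    by (intro compact_continuous_image compact_Times compact_Icc)
      (auto simp: case_prod_beta intro!: continuous_intros)
  have "z \<in> Off" if "z \<in> D" for z
  proof -
    from that obtain x r where "z = (x, x + r)" "d \<le> r" "r \<le> 2 * pi - d" by (auto simp: D_def)
    then show ?thesis using d Off_less[of x "x + r"] by simp
  qed
  then have "continuous_on D u"
    using smooth_on_imp_continuous_on[OF smooth_on_u] by (rule_tac continuous_on_subset) auto
  then have "compact (u ` D)" using cD by (rule compact_continuous_image)
  then obtain U where U: "\<And>z. z \<in> D \<Longrightarrow> \<bar>u z\<bar> \<le> U"
    using compact_imp_bounded[of "u ` D"] by (auto simp: bounded_iff)
  have "\<bar>u (x, y)\<bar> \<le> U" if xy: "d \<le> y - x" "y - x \<le> 2 * pi - d" for x y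
  proof -
    obtain k :: int where k: "0 \<le> x - 2 * pi * of_int k" "x - 2 * pi * of_int k < 0 + 2 * pi"
      using cis_reduce .
    let ?F = "\<lambda>t. t + 2 * pi * of_int (- k)"
    have "(x, y) \<in> Off" using Off_less xy d by simp
    from u_inv[OF shift this, of "- k"] have "u (x, y) = u (?F x, ?F y)"
      by (simp only: circle_lift_shift(2) nonlin_shift)
    moreover have "(?F x, ?F y) \<in> D"
      unfolding D_def by (rule image_eqI[of _ _ "(?F x, y - x)"]) (use k xy in auto)
    ultimately show ?thesis using U by simp
  qed
  then show thesis using that by blast
qed

text \<open>The infimum of all derivatives is an invariant density. It is Lipschitz because the derivatives
  are uniformly Lipschitz: the nonlinearity of \<open>F\<close> is controlled by the connection form \<open>u\<close>.\<close>

lemma invariant_density: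
  assumes nc: "\<not> contracting"
  obtains m b where "continuous_on UNIV m" "\<And>x. m x > 0" "\<And>x. m x \<le> b"
    "\<And>F x. F \<in> \<F> \<Longrightarrow> m (F x) * deriv F x = m x"
proof -
  obtain a b where ab: "0 < a" "\<And>F x. F \<in> \<F> \<Longrightarrow> a \<le> deriv F x" "\<And>F x. F \<in> \<F> \<Longrightarrow> deriv F x \<le> b"
    using deriv_bounds[OF nc] by blast
  obtain d0 where d0: "d0 > 0" "\<And>F p q. F \<in> \<F> \<Longrightarrow> pi \<le> q - p \<Longrightarrow> d0 \<le> F q - F p"
    using noncontracting_uniform[OF nc pi_gt_zero] by blast
  define d where "d = min d0 pi"
  have d: "0 < d" "d \<le> pi" "d \<le> d0" using d0 by (auto simp: d_def)
  obtain U where U: "\<And>x y. d \<le> y - x \<Longrightarrow> y - x \<le> 2 * pi - d \<Longrightarrow> \<bar>u (x, y)\<bar> \<le> U"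
    using u_bound[OF d(1,2)] by blast
  \<comment> \<open>The opposite point \<open>x + pi\<close> serves as second argument in
    \<open>u_inv\<close>: its image stays away from the image of \<open>x\<close>, so both values of
    \<open>u\<close> are bounded.\<close>
  have nl: "\<bar>nonlin F x\<bar> \<le> U + U * b" if F: "F \<in> \<F>" for F x
  proof -
    let ?y = "x + pi"
    have "(x, ?y) \<in> Off" using Off_less by simp
    from u_inv[OF F this] have "nonlin F x = u (x, ?y) - u (F x, F ?y) * deriv F x" by simp
    moreover have 1: "\<bar>u (x, ?y)\<bar> \<le> U" by (rule U) (use d in auto)
    moreover have "d0 \<le> F ?y - F x" "d0 \<le> F (x + 2 * pi) - F ?y" by (intro d0(2)[OF F]; simp)+
    then have 2: "\<bar>u (F x, F ?y)\<bar> \<le> U"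
      using d circle_lift_period[OF lift[OF F], of x] by (intro U) auto
    moreover have "\<bar>u (F x, F ?y) * deriv F x\<bar> \<le> U * b"
      unfolding abs_mult using 2 ab(1) ab(2)[OF F, of x] ab(3)[OF F, of x] by (intro mult_mono) auto
    ultimately show ?thesis by linarith
  qed
  define L where "L = (U + U * b) * b"
  have bpos: "b > 0" using ab(1) ab(2)[OF identity, of 0] ab(3)[OF identity, of 0] by linarith
  have lip: "\<bar>deriv F x - deriv F y\<bar> \<le> L * \<bar>x - y\<bar>" if F: "F \<in> \<F>" for F x y
  proof -
    have *: "\<bar>deriv F x - deriv F y\<bar> \<le> L * \<bar>x - y\<bar>" if "x < y" for x y
    proof -
      have "\<exists>z. x < z \<and> z < y \<and> deriv F y - deriv F x = (y - x) * (nonlin F z * deriv F z)"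
        by (rule MVT2[OF that]) (rule deriv_DERIV[OF F])
      then obtain z where z: "deriv F y - deriv F x = (y - x) * (nonlin F z * deriv F z)" by blast
      have "\<bar>nonlin F z * deriv F z\<bar> \<le> (U + U * b) * b"
        unfolding abs_mult using nl[OF F, of z] ab(1) ab(2)[OF F, of z] ab(3)[OF F, of z] by (intro mult_mono) auto
      then have "(y - x) * \<bar>nonlin F z * deriv F z\<bar> \<le> (y - x) * L"
        using that unfolding L_def by (intro mult_left_mono) auto
      moreover have "\<bar>deriv F x - deriv F y\<bar> = (y - x) * \<bar>nonlin F z * deriv F z\<bar>"
        using z that abs_minus_commute[of "deriv F x" "deriv F y"] by (simp add: abs_mult)
      ultimately show ?thesis using that by (simp add: mult.commute)
    qed
    show ?thesis using *[of x y] *[of y x] by (cases x y rule: linorder_cases) (auto simp: abs_minus_commute)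
  qed
  define m where "m = (\<lambda>x. INF F\<in>\<F>. deriv F x)"
  have ne: "\<F> \<noteq> {}" using identity by blast
  have bdd: "bdd_below ((\<lambda>F. deriv F x) ` \<F>)" for x
    by (rule bdd_belowI[of _ a]) (use ab(2) in auto)
  have mle: "m x \<le> deriv F x" if "F \<in> \<F>" for F x
    unfolding m_def using bdd that by (rule cINF_lower)
  have mge: "c \<le> m x" if "\<And>F. F \<in> \<F> \<Longrightarrow> c \<le> deriv F x" for c x
    unfolding m_def using ne that by (rule cINF_greatest)
  have mlip: "\<bar>m x - m y\<bar> \<le> L * \<bar>x - y\<bar>" for x y
  proof -
    have "m x - L * \<bar>x - y\<bar> \<le> m y" for x y
    proof (rule mge)
      fix F assume F: "F \<in> \<F>"
      show "m x - L * \<bar>x - y\<bar> \<le> deriv F y" using mle[OF F, of x] lip[OF F, of x y] by linarith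
    qed
    from this[of x y] this[of y x] show ?thesis by (simp add: abs_minus_commute abs_le_iff)
  qed
  have "isCont m x" for x
    unfolding isCont_def
  proof (rule LIM_zero_cancel, rule Lim_null_comparison)
    show "\<forall>\<^sub>F y in at x. norm (m y - m x) \<le> L * \<bar>y - x\<bar>" using mlip by (intro always_eventually) simp
    show "(\<lambda>y. L * \<bar>y - x\<bar>) \<midarrow>x\<rightarrow> 0" by (intro tendsto_eq_intros) auto
  qed
  then have "continuous_on UNIV m" by (simp add: continuous_at_imp_continuous_on)
  moreover have "m x > 0" for x using mge[of a x] ab by force
  moreover have "m x \<le> b" for x using mle[OF identity, of x] ab(3)[OF identity, of x] by simp
  moreover have "m (F x) * deriv F x = m x" if F: "F \<in> \<F>" for F x
  proof -
    \<comment> \<open>Each composition of \<open>G\<close> with \<open>F\<close> competes in the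
      infimum at \<open>x\<close>, which gives one inequality; applied to the inverse of
      \<open>F\<close> it gives the other.\<close>
    have ineq: "m x \<le> m (F x) * deriv F x" if F: "F \<in> \<F>" for F x
    proof -
      have p: "deriv F x > 0" using circle_lift_pos[OF lift[OF F]] .
      have "m x / deriv F x \<le> m (F x)"
      proof (rule mge)
        fix G assume G: "G \<in> \<F>"
        have "m x \<le> deriv G (F x) * deriv F x"
          using mle[OF comp[OF G F], of x] circle_lift_compose(2)[OF lift[OF G] lift[OF F], of x] by simp
        then show "m x / deriv F x \<le> deriv G (F x)" using p by (simp add: pos_divide_le_eq)
      qed
      then show ?thesis using p by (simp add: pos_divide_le_eq)
    qed
    obtain G where G: "G \<in> \<F>" "\<And>t. G (F t) = t" "\<And>t. F (G t) = t" using inverse[OF F] by blast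
    have "deriv (\<lambda>t. G (F t)) x = deriv G (F x) * deriv F x"
      using circle_lift_compose(2)[OF lift[OF G(1)] lift[OF F]] .
    then have one: "deriv G (F x) * deriv F x = 1" by (simp add: G(2))
    have "m (F x) * deriv F x \<le> m (G (F x)) * deriv G (F x) * deriv F x"
      using ineq[OF G(1), of "F x"] circle_lift_pos[OF lift[OF F], of x] by (intro mult_right_mono) auto
    also have "\<dots> = m x" using one by (simp add: G(2) mult.assoc)
    finally show ?thesis using ineq[OF F, of x] by simp
  qed
  ultimately show thesis using that by blast
qed

section \<open>Smoothness of the invariant density\<close>

lemma open_triples: "open {(x, y, z). (x, y) \<in> Off \<and> (x, z) \<in> Off \<and> (y, z) \<in> Off}"
proof -
  let ?f = "\<lambda>p :: real \<times> real \<times> real. (fst p, fst (snd p))" and ?g = "\<lambda>p :: real \<times> real \<times> real. (fst p, snd (snd p))"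
    and ?h = "\<lambda>p :: real \<times> real \<times> real. (fst (snd p), snd (snd p))"
  have c: "continuous_on UNIV ?f" "continuous_on UNIV ?g" "continuous_on UNIV ?h"
    by (intro continuous_intros)+
  have "open (?f -` Off)" "open (?g -` Off)" "open (?h -` Off)"
    using c by (auto simp: continuous_on_open_vimage intro: open_Off)
  then have "open (?f -` Off \<inter> ?g -` Off \<inter> ?h -` Off)" by blast
  moreover have "{(x, y, z). (x, y) \<in> Off \<and> (x, z) \<in> Off \<and> (y, z) \<in> Off} = ?f -` Off \<inter> ?g -` Off \<inter> ?h -` Off"
    by auto
  ultimately show ?thesis by simp
qed

lemma Off_sym: "(x, y) \<in> Off \<Longrightarrow> (y, x) \<in> Off"
  by (auto simp: Off_iff)

lemma smooth_on_lam:
  assumes U: "open U" and f: "smooth_on U f" "smooth_on U g" "smooth_on U h"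
    and O: "\<And>p. p \<in> U \<Longrightarrow> (f p, g p) \<in> Off \<and> (f p, h p) \<in> Off \<and> (g p, h p) \<in> Off"
  shows "smooth_on U (\<lambda>p. lam (f p) (g p) (h p))"
proof -
  have W: "smooth_on U (\<lambda>p. W (f p, g p))" if "smooth_on U f" "smooth_on U g" "\<And>p. p \<in> U \<Longrightarrow> (f p, g p) \<in> Off" for f g
    by (rule smooth_on_compose[OF U open_Off smooth_on_W smooth_on_Pair[OF U that(1,2)] that(3)])
  show ?thesis unfolding lam_def
    by (intro smooth_on_divide smooth_on_mult U W f) (use O W_nz(2) in auto)
qed

lemma lam_pos: "(x, y) \<in> Off \<Longrightarrow> (x, z) \<in> Off \<Longrightarrow> (y, z) \<in> Off \<Longrightarrow> lam x y z > 0"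
  unfolding lam_def using W_nz(1) by simp

lemma lam_cong: "cis x = cis x' \<Longrightarrow> cis y = cis y' \<Longrightarrow> cis z = cis z' \<Longrightarrow> lam x y z = lam x' y' z'"
  unfolding lam_def using W_period[of x x' y y'] W_period[of x x' z z'] W_period[of y y' z z'] by simp

text \<open>In the coordinate \<open>H\<close> with density \<open>m\<close> the group acts by
  translations, and the translations \<open>\<psi> c\<close> of that coordinate commute with it. So
  \<open>l\<close>, the value of \<open>lam\<close> at \<open>x\<close> and its translates by one
  and two thirds of a turn, transforms like the square of \<open>m\<close>. The quotient
  \<open>M\<close> is invariant and continuous, hence constant along dense orbits.\<close>

lemma compatible_noncontracting:
  assumes nc: "\<not> contracting"
  shows "\<exists>H. compatible T H"
proof -
  obtain m0 b0 where m0: "continuous_on UNIV m0" "\<And>x. m0 x > 0" "\<And>x. m0 x \<le> b0"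
    "\<And>F x. F \<in> \<F> \<Longrightarrow> m0 (F x) * deriv F x = m0 x"
    using invariant_density[OF nc] by blast
  have m0c: "isCont m0 x" for x using m0(1) by (simp add: continuous_on_eq_continuous_at)
  have "\<exists>g. \<forall>x. - \<infinity> < ereal x \<longrightarrow> ereal x < \<infinity> \<longrightarrow> (g has_vector_derivative m0 x) (at x)"
    by (rule einterval_antiderivative) (use m0c in auto)
  then obtain H0 where H0: "\<And>x. (H0 has_real_derivative m0 x) (at x)"
    by (auto simp: has_real_derivative_iff_has_vector_derivative)
  have H0mono: "H0 x < H0 y" if "x < y" for x y
    by (rule DERIV_pos_imp_increasing[OF that]) (use H0 m0(2) in blast)
  define I where "I = H0 (2 * pi) - H0 0"
  have I: "I > 0" using H0mono[of 0 "2 * pi"] by (simp add: I_def)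
  \<comment> \<open>Normalises the total mass of the density to one turn.\<close>
  define \<kappa> where "\<kappa> = 2 * pi / I"
  have \<kappa>: "\<kappa> > 0" using I by (simp add: \<kappa>_def)
  define m where "m = (\<lambda>x. \<kappa> * m0 x)"
  define H where "H = (\<lambda>x. \<kappa> * H0 x)"
  have mc: "continuous_on UNIV m" unfolding m_def using m0(1) by (intro continuous_intros)
  have mpos: "m x > 0" for x using m0(2) \<kappa> by (simp add: m_def)
  have minv: "m (F x) * deriv F x = m x" if "F \<in> \<F>" for F x
    using m0(4)[OF that, of x] by (simp add: m_def mult.assoc)
  have dH: "(H has_real_derivative m x) (at x)" for x
    unfolding H_def m_def by (rule DERIV_cmult[OF H0])
  have Hless: "H x < H y \<longleftrightarrow> x < y" for x y
    using H0mono[of x y] H0mono[of y x] \<kappa> by (cases x y rule: linorder_cases) (auto simp: H_def)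
  have Heq: "H x = H y \<longleftrightarrow> x = y" for x y
    using Hless[of x y] Hless[of y x] by (cases x y rule: linorder_cases) auto
  have Hrot: "H (F x) - H x = H (F y) - H y" if F: "F \<in> \<F>" for F x y
  proof -
    have "((\<lambda>x. H (F x) - H x) has_real_derivative m (F x) * deriv F x - m x) (at x)" for x
      by (intro DERIV_diff DERIV_chain2[OF dH circle_lift_DERIV[OF lift[OF F]]] dH)
    then have "((\<lambda>x. H (F x) - H x) has_real_derivative 0) (at x)" for x
      by (simp add: minv[OF F])
    then show ?thesis using DERIV_isconst_all[of "\<lambda>x. H (F x) - H x" x y] by blast
  qed
  have Hper: "H (x + 2 * pi) = H x + 2 * pi" for x
  proof -
    have "H (x + 2 * pi) - H x = H (0 + 2 * pi) - H 0" using Hrot[OF shift[of 1], of x 0] by simp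
    also have "\<dots> = \<kappa> * I" by (simp add: H_def I_def right_diff_distrib)
    also have "\<dots> = 2 * pi" using I by (simp add: \<kappa>_def)
    finally show ?thesis by simp
  qed
  have Hperi: "H (x + 2 * pi * of_int k) = H x + 2 * pi * of_int k" for x k
    by (rule periodic_int) (rule Hper)
  have Hc: "isCont H x" for x using dH DERIV_isCont by blast
  have Hsurj: "\<exists>x. H x = y" for y
  proof -
    obtain k :: int where k: "H 0 \<le> y - 2 * pi * of_int k" "y - 2 * pi * of_int k < H 0 + 2 * pi"
      using cis_reduce .
    have "\<exists>t\<ge>0. t \<le> 2 * pi \<and> H t = y - 2 * pi * of_int k"
      by (rule IVT') (use k Hper[of 0] Hc in \<open>auto intro: continuous_at_imp_continuous_on\<close>)
    then obtain t where "H t = y - 2 * pi * of_int k" by blast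
    then have "H (t + 2 * pi * of_int k) = y" using Hperi[of t k] by simp
    then show ?thesis by blast
  qed
  define Q where "Q = inv_into UNIV H"
  have HQ: "H (Q y) = y" for y
    unfolding Q_def by (rule f_inv_into_f) (use Hsurj[of y] in auto)
  have QH: "Q (H x) = x" for x using HQ[of "H x"] Heq by blast
  have Qc: "isCont Q y" for y
    using isCont_inverse_function[of 1 "Q y" Q H] QH Hc HQ by auto
  have dQ: "(Q has_real_derivative inverse (m (Q y))) (at y)" for y
  proof (rule DERIV_inverse_function[where a = "y - 1" and b = "y + 1"])
    show "(H has_real_derivative m (Q y)) (at (Q y))" by (rule dH)
    show "m (Q y) \<noteq> 0" using mpos[of "Q y"] by simp
  qed (use HQ Qc in auto)
  define \<psi> where "\<psi> = (\<lambda>c x. Q (H x + c))"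
  have H\<psi>: "H (\<psi> c x) = H x + c" for c x by (simp add: \<psi>_def HQ)
  have \<psi>F: "\<psi> c (F x) = F (\<psi> c x)" if F: "F \<in> \<F>" for c F x
  proof -
    have "H (\<psi> c (F x)) = H (F (\<psi> c x))" using Hrot[OF F, of x "\<psi> c x"] by (simp add: H\<psi>)
    then show ?thesis using Heq by blast
  qed
  have \<psi>\<psi>: "\<psi> c (\<psi> c' x) = \<psi> (c + c') x" for c c' x by (simp add: \<psi>_def HQ algebra_simps)
  have \<psi>per: "\<psi> (c + 2 * pi) x = \<psi> c x + 2 * pi" for c x
  proof -
    have "H (\<psi> (c + 2 * pi) x) = H (\<psi> c x + 2 * pi)" by (simp add: H\<psi> Hper)
    then show ?thesis using Heq by blast
  qed
  have \<psi>0: "\<psi> 0 x = x" for x by (simp add: \<psi>_def QH)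
  have \<psi>less: "\<psi> c x < \<psi> c' x" if "c < c'" for c c' x
    using Hless[of "\<psi> c x" "\<psi> c' x"] that by (simp add: H\<psi>)
  have d\<psi>: "(\<psi> c has_real_derivative m x / m (\<psi> c x)) (at x)" for c x
  proof -
    have "((\<lambda>x. H x + c) has_real_derivative m x) (at x)"
      using DERIV_add[OF dH DERIV_const] by simp
    from DERIV_chain2[OF dQ this] show ?thesis by (simp add: \<psi>_def divide_inverse mult.commute)
  qed
  have \<psi>c: "continuous_on UNIV (\<psi> c)" for c
    using d\<psi> DERIV_isCont by (blast intro: continuous_at_imp_continuous_on)
  have ord: "x < \<psi> t3 x" "\<psi> t3 x < \<psi> (2 * t3) x" "\<psi> (2 * t3) x < x + 2 * pi" for x
    using \<psi>less[of 0 t3 x] \<psi>less[of t3 "2 * t3" x] \<psi>less[of "2 * t3" "3 * t3" x] \<psi>per[of 0 x] t3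
    by (simp_all add: \<psi>0)
  have O: "(x, \<psi> t3 x) \<in> Off" "(x, \<psi> (2 * t3) x) \<in> Off" "(\<psi> t3 x, \<psi> (2 * t3) x) \<in> Off" for x
    by (intro Off_less; use ord[of x] in linarith)+
  define l where "l = (\<lambda>x. lam x (\<psi> t3 x) (\<psi> (2 * t3) x))"
  have lpos: "l x > 0" for x unfolding l_def by (rule lam_pos[OF O])
  have lc: "continuous_on UNIV l"
  proof -
    have W: "continuous_on UNIV (\<lambda>x. W (f x, g x))"
      if "continuous_on UNIV f" "continuous_on UNIV g" "\<And>x. (f x, g x) \<in> Off" for f g :: "real \<Rightarrow> real"
      by (rule continuous_on_compose2[OF smooth_on_imp_continuous_on[OF smooth_on_W]
        continuous_on_Pair[OF that(1,2)]]) (use that(3) in auto)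
    show ?thesis unfolding l_def lam_def
      by (intro continuous_on_divide continuous_on_mult W \<psi>c continuous_on_id O ballI W_nz(2)[OF O(3)])
  qed
  have linv: "l (F x) * (deriv F x)\<^sup>2 = l x" if F: "F \<in> \<F>" for F x
    unfolding l_def \<psi>F[OF F] by (rule lam_inv[OF F O])
  define M where "M = (\<lambda>x. (m x)\<^sup>2 / l x)"
  have Minv: "M (F x) = M x" if F: "F \<in> \<F>" for F x
  proof -
    have "deriv F x \<noteq> 0" using circle_lift_pos[OF lift[OF F], of x] by simp
    then show ?thesis unfolding M_def minv[OF F, of x, symmetric] linv[OF F, of x, symmetric]
      by (simp add: power_mult_distrib)
  qed
  have Mc: "isCont M x" for x
  proof -
    have "continuous_on UNIV M" unfolding M_def
      using lpos by (intro continuous_on_divide continuous_on_power mc lc) (auto simp: less_imp_neq[THEN not_sym])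
    then show ?thesis by (simp add: continuous_on_eq_continuous_at)
  qed
  text \<open>The translation numbers form an infinite group modulo \<open>2\<pi>\<close>, so all orbits are dense.\<close>
  have dense: "\<exists>F\<in>\<F>. \<bar>H (F x) - H y\<bar> < \<delta>" if \<delta>: "\<delta> > 0" for x y \<delta>
  proof -
    define B where "B = \<kappa> * b0"
    have "b0 > 0" using m0(2)[of 0] m0(3)[of 0] by linarith
    then have B: "B > 0" "\<And>x. m x \<le> B" using \<kappa> m0(3) by (auto simp: B_def m_def)
    obtain F1 F2 where F: "F1 \<in> \<F>" "F2 \<in> \<F>" "F1 x < F2 x" "F2 x < F1 x + \<delta> / B"
      using orbit_close_pair[of "\<delta> / B" x] \<delta> B(1) by auto
    \<comment> \<open>\<open>G\<close> below translates the coordinate \<open>H\<close> by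
      \<open>r\<close>. The bound \<open>B\<close> on the density makes \<open>r < \<delta>\<close>,
      so multiples of \<open>r\<close>, corrected by full turns, come within \<open>\<delta>\<close>
      of every target.\<close>
    define r where "r = H (F2 x) - H (F1 x)"
    have "\<exists>z. F1 x < z \<and> z < F2 x \<and> H (F2 x) - H (F1 x) = (F2 x - F1 x) * m z"
      by (rule MVT2[OF F(3)]) (rule dH)
    then obtain z where z: "r = (F2 x - F1 x) * m z" by (auto simp: r_def)
    have "r \<le> (F2 x - F1 x) * B" unfolding z using F(3) B(2) by (intro mult_left_mono) auto
    also have "\<dots> < \<delta> / B * B" using F(4) B(1) by (intro mult_strict_right_mono) auto
    finally have r: "0 < r" "r < \<delta>" using B(1) Hless F(3) by (auto simp: r_def)
    obtain G1 where G1: "G1 \<in> \<F>" "\<And>t. G1 (F1 t) = t" "\<And>t. F1 (G1 t) = t" using inverse[OF F(1)] by blast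
    define G where "G = (\<lambda>t. F2 (G1 t))"
    have G: "G \<in> \<F>" unfolding G_def by (rule comp[OF F(2) G1(1)])
    have HG: "H (G t) = H t + r" for t
      using Hrot[OF G, of t "F1 x"] by (simp add: G_def G1(2) r_def)
    have HGn: "H ((G ^^ n) t) = H t + real n * r" for n t
      by (induction n) (simp_all add: HG algebra_simps)
    obtain k :: int where k: "H x \<le> H y - 2 * pi * of_int k" "H y - 2 * pi * of_int k < H x + 2 * pi"
      using cis_reduce .
    define q where "q = (H y - 2 * pi * of_int k - H x) / r"
    have q: "0 \<le> q" using k r by (simp add: q_def)
    define n where "n = nat \<lfloor>q\<rfloor>"
    have n: "real n \<le> q" "q < real n + 1" using q by (auto simp: n_def)
    have "real n * r \<le> q * r" "q * r < (real n + 1) * r" using n r by (auto intro: mult_right_mono mult_strict_right_mono)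
    moreover have "q * r = H y - 2 * pi * of_int k - H x" using r by (simp add: q_def)
    moreover have "(real n + 1) * r = real n * r + r" by (simp add: distrib_right)
    ultimately have "\<bar>H ((G ^^ n) x) + 2 * pi * of_int k - H y\<bar> < \<delta>"
      using r unfolding HGn by linarith
    moreover have "(\<lambda>t. (G ^^ n) t + 2 * pi * of_int k) \<in> \<F>" by (rule comp[OF shift funpow_in[OF G]])
    ultimately show ?thesis by (intro bexI[of _ "\<lambda>t. (G ^^ n) t + 2 * pi * of_int k"]) (simp_all add: Hperi)
  qed
  have Mconst: "M x = M y" for x y
  proof (rule ccontr)
    assume ne: "M x \<noteq> M y"
    have "isCont (\<lambda>v. M (Q v)) (H y)"
      by (rule isCont_o2[OF Qc Mc])
    then have "\<exists>\<delta>>0. \<forall>v. dist v (H y) < \<delta> \<longrightarrow> dist (M (Q v)) (M (Q (H y))) < \<bar>M x - M y\<bar>"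
      by (rule continuous_at_eps_delta[THEN iffD1, rule_format]) (use ne in simp)
    then obtain \<delta> where \<delta>: "\<delta> > 0" "\<And>v. dist v (H y) < \<delta> \<Longrightarrow> dist (M (Q v)) (M (Q (H y))) < \<bar>M x - M y\<bar>" by auto
    obtain F where F: "F \<in> \<F>" "\<bar>H (F x) - H y\<bar> < \<delta>" using dense[OF \<delta>(1)] by blast
    show False using \<delta>(2)[of "H (F x)"] F(2) by (simp add: QH Minv[OF F(1)] dist_real_def)
  qed
  define C where "C = M 0"
  have C: "C > 0" "(m x)\<^sup>2 = C * l x" for x
  proof -
    show "C > 0" using mpos[of 0] lpos[of 0] by (simp add: C_def M_def)
    have "(m x)\<^sup>2 = M x * l x" using lpos[of x] by (simp add: M_def)
    then show "(m x)\<^sup>2 = C * l x" using Mconst[of x 0] by (simp add: C_def)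
  qed
  have mm: "m x / m y = sqrt (l x / l y)" for x y
  proof -
    have "l x / l y = (m x / m y)\<^sup>2"
      using C(1) lpos[of y] by (simp add: power_divide C(2) field_simps)
    then show ?thesis using mpos by (simp add: less_imp_le)
  qed
  \<comment> \<open>A translation by a third of a turn permutes the three vertices cyclically up to
    full turns, so \<open>l\<close> at each vertex is \<open>lam\<close> of the same triple in
    rotated order.\<close>
  have l1: "l (\<psi> t3 x) = lam (\<psi> t3 x) (\<psi> (2 * t3) x) x" for x
    unfolding l_def \<psi>\<psi>
  proof (rule lam_cong)
    show "cis (\<psi> (2 * t3 + t3) x) = cis x"
      using \<psi>per[of 0 x] t3(2) cis_period(1)[of x 1] by (simp add: \<psi>0)
  qed (simp_all only: mult_2)
  have l2: "l (\<psi> (2 * t3) x) = lam (\<psi> (2 * t3) x) x (\<psi> t3 x)" for x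
    unfolding l_def \<psi>\<psi>
  proof (rule lam_cong)
    show "cis (\<psi> (t3 + 2 * t3) x) = cis x"
      using \<psi>per[of 0 x] t3(2) cis_period(1)[of x 1] by (simp add: \<psi>0)
    have e: "2 * t3 + 2 * t3 = t3 + 2 * pi" using t3(2) by simp
    show "cis (\<psi> (2 * t3 + 2 * t3) x) = cis (\<psi> t3 x)"
      unfolding e \<psi>per using cis_period(1)[of "\<psi> t3 x" 1] by simp
  qed simp
  define E where "E = {(x, y, z). (x, y) \<in> Off \<and> (x, z) \<in> Off \<and> (y, z) \<in> Off}"
  have oE: "open E" unfolding E_def by (rule open_triples)
  define L where "L = (\<lambda>p. lam (fst p) (fst (snd p)) (snd (snd p)))"
  define L1 where "L1 = (\<lambda>p. lam (fst (snd p)) (snd (snd p)) (fst p))"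
  define L2 where "L2 = (\<lambda>p. lam (snd (snd p)) (fst p) (fst (snd p)))"
  have bl: "smooth_on E (\<lambda>p. fst p)" "smooth_on E (\<lambda>p. fst (snd p))" "smooth_on E (\<lambda>p. snd (snd p))"
    by (intro smooth_on_bounded_linear oE bounded_linear_intros)+
  have sL: "smooth_on E L" "smooth_on E L1" "smooth_on E L2"
    unfolding L_def L1_def L2_def
    by (intro smooth_on_lam oE bl; use Off_sym in \<open>auto simp: E_def\<close>)+
  have Lpos: "L p > 0" "L1 p > 0" "L2 p > 0" if "p \<in> E" for p
    unfolding L_def L1_def L2_def using that Off_sym by (auto simp: E_def intro!: lam_pos)
  \<comment> \<open>The velocity of the triangle when its first vertex moves with unit speed. By
    \<open>mm\<close> the ratio of densities at two vertices is a square root of a quotient of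
    values of \<open>lam\<close>, hence a smooth function of the vertices alone.\<close>
  define V where "V = (\<lambda>p. (1 :: real, sqrt (L p / L1 p), sqrt (L p / L2 p)))"
  have sV: "smooth_on E V"
    unfolding V_def
    by (intro smooth_on_Pair smooth_on_sqrt smooth_on_divide smooth_on_const oE sL)
      (use Lpos in \<open>auto simp: less_imp_neq[THEN not_sym]\<close>)
  define Y where "Y = (\<lambda>x. (x, \<psi> t3 x, \<psi> (2 * t3) x))"
  have YE: "Y x \<in> E" for x using O[of x] by (simp add: Y_def E_def)
  have sY: "smooth_on UNIV Y"
  proof (rule smooth_on_ode[OF open_UNIV oE sV YE])
    fix x
    have "V (Y x) = (1, m x / m (\<psi> t3 x), m x / m (\<psi> (2 * t3) x))"
      by (simp add: V_def Y_def L_def L1_def L2_def mm l1 l2) (simp add: l_def)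
    moreover have "(Y has_vector_derivative (1, m x / m (\<psi> t3 x), m x / m (\<psi> (2 * t3) x))) (at x)"
      unfolding Y_def
      by (intro has_vector_derivative_Pair has_vector_derivative_id
        d\<psi>[unfolded has_real_derivative_iff_has_vector_derivative])
    ultimately show "(Y has_vector_derivative V (Y x)) (at x)" by simp
  qed
  have "smooth_on UNIV (\<lambda>x. sqrt (C * L (Y x)))"
  proof (intro smooth_on_sqrt smooth_on_mult smooth_on_const open_UNIV)
    show "smooth_on UNIV (\<lambda>x. L (Y x))" by (rule smooth_on_compose[OF open_UNIV oE sL(1) sY YE])
    show "0 < C * L (Y x)" for x using C(1) Lpos(1)[OF YE] by simp
  qed
  moreover have "sqrt (C * L (Y x)) = m x" for x
  proof -
    have "C * L (Y x) = (m x)\<^sup>2" by (simp add: C(2) l_def L_def Y_def)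
    then show ?thesis using mpos[of x] by simp
  qed
  ultimately have sm: "smooth_on UNIV m" by simp
  have mper: "m (x + 2 * pi) = m x" for x
    using minv[OF shift[of 1], of x] circle_lift_shift(2) by simp
  note CH = circle_liftI[OF sm mpos mper dH Hper[of 0]]
  have "compatible T H"
    unfolding compatible_def
  proof (intro conjI ballI CH(1))
    fix F x assume F: "F \<in> \<F>"
    \<comment> \<open>Conjugation by \<open>H\<close> turns every \<open>F\<close> into a rotation,
      which leaves the projective structure unchanged at all points.\<close>
    have "(\<lambda>s. H (F s)) = (\<lambda>s. H s + (H (F 0) - H 0))" using Hrot[OF F, of _ 0] by (auto simp: algebra_simps)
    then have "proj_sch (\<lambda>s. H (F s)) x = proj_sch H x" using proj_sch_add_const[OF CH(1)] by simp
    then show "proj_sch H (F x) * (deriv F x)\<^sup>2 + sch F x = proj_sch H x"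
      using proj_sch_compose[OF CH(1) lift[OF F]] by simp
  qed
  then show ?thesis by blast
qed

end

context volume_action
begin

lemma exists_compatible_lift:
  assumes T: "minimal_set T"
  shows "\<exists>H. compatible T H"
proof (cases contracting)
  case True
  then show ?thesis
    using compatible_minimal[OF True] compatible_gap[OF True T] T by (cases "T = UNIV") auto
next
  case False
  then show ?thesis by (rule compatible_noncontracting)
qed

end

section \<open>Transfer to the circle\<close>

lemma limit_set_eqI:
  assumes "closed_invariant G L" "\<And>K. closed_invariant G K \<Longrightarrow> L \<subseteq> K"
  shows "limit_set G = L"
  unfolding limit_set_def
proof (rule the_equality)
  show "closed_invariant G L \<and> (\<forall>K. closed_invariant G K \<and> K \<subseteq> L \<longrightarrow> K = L)" using assms by blast
  show "M = L" if "closed_invariant G M \<and> (\<forall>K. closed_invariant G K \<and> K \<subseteq> M \<longrightarrow> K = M)" for M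
    using that assms by blast
qed

locale circle_action = group \<Gamma> for \<Gamma> :: "('g, 'm) monoid_scheme" (structure) +
  fixes \<rho> :: "'g \<Rightarrow> complex \<Rightarrow> complex" and \<omega> :: "complex \<times> complex \<Rightarrow> real"
  assumes hom: "\<rho> \<in> hom \<Gamma> Diff_S1"
    and non_el: "non_elementary \<Gamma> \<rho>"
    and form: "smooth_volume_form \<omega>" "preserves_volume_form (\<rho> ` carrier \<Gamma>) \<omega>"
begin

lemma rho_Diff: "g \<in> carrier \<Gamma> \<Longrightarrow> \<rho> g \<in> carrier Diff_S1"
  using hom by (auto simp: hom_def)

lemma rho_Bij: "g \<in> carrier \<Gamma> \<Longrightarrow> \<rho> g \<in> Bij S1"
  using rho_Diff by (simp add: Diff_S1_def)

lemma rho_mult: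
  assumes "g \<in> carrier \<Gamma>" "h \<in> carrier \<Gamma>" "z \<in> S1"
  shows "\<rho> (g \<otimes> h) z = \<rho> g (\<rho> h z)"
proof -
  have "\<rho> (g \<otimes> h) = \<rho> g \<otimes>\<^bsub>Diff_S1\<^esub> \<rho> h" using hom assms by (simp add: hom_def)
  also have "\<dots> = compose S1 (\<rho> g) (\<rho> h)"
    using rho_Bij[OF assms(1)] rho_Bij[OF assms(2)] by (simp add: Diff_S1_def BijGroup_def)
  finally show ?thesis using assms(3) by (simp add: compose_def)
qed

lemma rho_one: "z \<in> S1 \<Longrightarrow> \<rho> \<one> z = z"
proof -
  assume z: "z \<in> S1"
  have b: "bij_betw (\<rho> \<one>) S1 S1" using rho_Bij[OF one_closed] by (simp add: Bij_def)
  have "\<rho> \<one> z \<in> S1" using b z by (meson bij_betwE)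
  moreover have "\<rho> \<one> (\<rho> \<one> z) = \<rho> \<one> z" using rho_mult[OF one_closed one_closed z] by simp
  ultimately show ?thesis using b z by (auto simp: bij_betw_def inj_on_def)
qed

text \<open>Each group element contributes all of its lifts; the translations required by
  \<open>shift\<close> are those of the identity.\<close>

definition lifts :: "(real \<Rightarrow> real) set" where
  "lifts = {F. circle_lift F \<and> (\<exists>g\<in>carrier \<Gamma>. \<forall>t. \<rho> g (cis t) = cis (F t))}"

lemma exists_lift:
  assumes "g \<in> carrier \<Gamma>"
  obtains F where "F \<in> lifts" "circle_lift F" "\<And>t. \<rho> g (cis t) = cis (F t)"
proof -
  obtain F where F: "circle_lift F" "\<And>t. \<rho> g (cis t) = cis (F t)"
    using Diff_S1_lift[OF rho_Diff[OF assms]] by blast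
  then have "F \<in> lifts" using assms by (auto simp: lifts_def)
  then show thesis using that F by blast
qed

lemma lifts_inverse:
  assumes "F \<in> lifts"
  shows "\<exists>G\<in>lifts. \<forall>t. G (F t) = t \<and> F (G t) = t"
proof -
  obtain g where F: "circle_lift F" and g: "g \<in> carrier \<Gamma>" "\<And>t. \<rho> g (cis t) = cis (F t)"
    using assms by (auto simp: lifts_def)
  obtain G where G: "circle_lift G" "\<And>t. G (F t) = t" "\<And>t. F (G t) = t"
    using circle_lift_inverse[OF F] by blast
  have "\<rho> (inv g) (cis t) = cis (G t)" for t
  proof -
    have "\<rho> (inv g) (\<rho> g (cis (G t))) = cis (G t)"
      using rho_mult[of "inv g" g "cis (G t)"] rho_one[of "cis (G t)"] g(1) by simp
    then show ?thesis by (simp add: g(2) G(3))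
  qed
  then have "G \<in> lifts" using G(1) inv_closed[OF g(1)] by (auto simp: lifts_def)
  then show ?thesis using G(2,3) by blast
qed

sublocale volume_action lifts "\<lambda>(s, t). \<omega> (cis s, cis t)"
proof
  show "circle_lift F" if "F \<in> lifts" for F using that by (simp add: lifts_def)
  show "(\<lambda>t. F (G t)) \<in> lifts" if FG: "F \<in> lifts" "G \<in> lifts" for F G
  proof -
    obtain f g where fg: "circle_lift F" "circle_lift G" "f \<in> carrier \<Gamma>" "g \<in> carrier \<Gamma>"
      "\<And>t. \<rho> f (cis t) = cis (F t)" "\<And>t. \<rho> g (cis t) = cis (G t)"
      using FG by (auto simp: lifts_def)
    have "\<rho> (f \<otimes> g) (cis t) = cis (F (G t))" for t
      using rho_mult[OF fg(3,4), of "cis t"] fg(5,6) by simp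
    then show ?thesis
      using circle_lift_compose(1)[OF fg(1,2)] m_closed[OF fg(3,4)] by (auto simp: lifts_def)
  qed
  show "\<exists>G\<in>lifts. \<forall>t. G (F t) = t \<and> F (G t) = t" if "F \<in> lifts" for F
    using lifts_inverse[OF that] .
  show "(\<lambda>t. t + 2 * pi * of_int k) \<in> lifts" for k
  proof -
    have "\<rho> \<one> (cis t) = cis (t + 2 * pi * of_int k)" for t using rho_one[of "cis t"] by simp
    then show ?thesis using circle_lift_shift(1) one_closed unfolding lifts_def by blast
  qed
  show "infinite ((\<lambda>F. cis (F s)) ` lifts)" for s
  proof
    assume fin: "finite ((\<lambda>F. cis (F s)) ` lifts)"
    have "orbit \<Gamma> \<rho> (cis s) \<subseteq> (\<lambda>F. cis (F s)) ` lifts"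
    proof
      fix z assume "z \<in> orbit \<Gamma> \<rho> (cis s)"
      then obtain g where g: "g \<in> carrier \<Gamma>" "z = \<rho> g (cis s)" by (auto simp: orbit_def)
      obtain F where "F \<in> lifts" "circle_lift F" "\<And>t. \<rho> g (cis t) = cis (F t)" using exists_lift[OF g(1)] by blast
      then show "z \<in> (\<lambda>F. cis (F s)) ` lifts" using g(2) by auto
    qed
    moreover have "infinite (orbit \<Gamma> \<rho> (cis s))" using non_el by (simp add: non_elementary_def)
    ultimately show False using fin finite_subset by blast
  qed
  show "smooth_on {(s, t). cis s \<noteq> cis t} (\<lambda>(s, t). \<omega> (cis s, cis t))"
    using form(1) by (simp add: smooth_volume_form_def)
  show "0 < (case (s, t) of (s, t) \<Rightarrow> \<omega> (cis s, cis t))" if "cis s \<noteq> cis t" for s t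
    using form(1) that by (simp add: smooth_volume_form_def)
  show "(case (s, t) of (s, t) \<Rightarrow> \<omega> (cis s, cis t)) = (case (s', t') of (s, t) \<Rightarrow> \<omega> (cis s, cis t))"
    if "cis s = cis s'" "cis t = cis t'" for s s' t t'
    using that by simp
  show "(case (F s, F t) of (s, t) \<Rightarrow> \<omega> (cis s, cis t)) * deriv F s * deriv F t =
      (case (s, t) of (s, t) \<Rightarrow> \<omega> (cis s, cis t))" if F: "F \<in> lifts" and st: "cis s \<noteq> cis t" for F s t
  proof -
    obtain g where g: "circle_lift F" "g \<in> carrier \<Gamma>" "\<And>t. \<rho> g (cis t) = cis (F t)"
      using F by (auto simp: lifts_def)
    have d: "circle_deriv (\<rho> g) (cis t) = deriv F t" for t
      by (rule circle_deriv_cis[OF circle_lift_DERIV[OF g(1)] g(3)])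
    have "\<omega> (\<rho> g (cis s), \<rho> g (cis t)) * circle_deriv (\<rho> g) (cis s) * circle_deriv (\<rho> g) (cis t) = \<omega> (cis s, cis t)"
      using form(2) g(2) st by (simp add: preserves_volume_form_def)
    then show ?thesis by (simp add: g(3) d)
  qed
qed

lemma closed_cis_image:
  assumes "closed T" "\<And>t k. t \<in> T \<Longrightarrow> t - 2 * pi * of_int k \<in> T"
  shows "closed (cis ` T)"
proof -
  have "cis ` T = cis ` (T \<inter> {0..2 * pi})"
  proof (intro equalityI subsetI)
    fix z assume "z \<in> cis ` T"
    then obtain t where t: "t \<in> T" "z = cis t" by blast
    obtain k :: int where k: "0 \<le> t - 2 * pi * of_int k" "t - 2 * pi * of_int k < 0 + 2 * pi"
      using cis_reduce .
    show "z \<in> cis ` (T \<inter> {0..2 * pi})"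
      by (rule image_eqI[of _ _ "t - 2 * pi * of_int k"]) (use t k assms(2) in auto)
  qed blast
  moreover have "compact (T \<inter> {0..2 * pi})" using assms(1) by (intro closed_Int_compact) auto
  then have "compact (cis ` (T \<inter> {0..2 * pi}))"
    by (intro compact_continuous_image continuous_on_cis continuous_on_id)
  ultimately show ?thesis using compact_imp_closed by simp
qed

text \<open>Any closed set invariant under the conjugated group pulls back through \<open>H\<close>
  to an invariant set on the line, which contains \<open>T\<close> by
  \<open>minimal_set_least\<close>. So the image of \<open>T\<close> is the least closed invariant
  set.\<close>

lemma conj_limit_set:
  assumes H: "circle_lift H" and T: "minimal_set T"
  shows "limit_set ((\<lambda>g. conj_by (circle_map H) (\<rho> g)) ` carrier \<Gamma>) = (\<lambda>t. cis (H t)) ` T"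
proof -
  let ?G = "(\<lambda>g. conj_by (circle_map H) (\<rho> g)) ` carrier \<Gamma>"
  have iT: "inv_set T" using T by (simp add: minimal_set_def)
  obtain J where J: "circle_lift J" "\<And>t. J (H t) = t" "\<And>t. H (J t) = t"
    using circle_lift_inverse[OF H] by blast
  have conj: "conj_by (circle_map H) (\<rho> g) (cis (H t)) = cis (H (F t))"
    if "g \<in> carrier \<Gamma>" "circle_lift F" "\<And>t. \<rho> g (cis t) = cis (F t)" for g F t
    using conj_by_cis[OF H that(2) rho_Bij[OF that(1)] that(3)] .
  show ?thesis
  proof (rule limit_set_eqI)
    have "closed ((\<lambda>t. cis (H t)) ` T)"
    proof -
      have "closed (H ` T)"
      proof -
        have "H ` T = J -` T" using J(2,3) by (auto simp: image_iff) (metis)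
        moreover have "closed (J -` T)"
          using iT circle_lift_isCont[OF J(1)]
          by (intro continuous_closed_vimage) (auto simp: inv_set_def)
        ultimately show ?thesis by simp
      qed
      moreover have "t - 2 * pi * of_int k \<in> H ` T" if t: "t \<in> H ` T" for t k
      proof -
        obtain s where s: "s \<in> T" "t = H s" using t by blast
        have "t - 2 * pi * of_int k = H (s - 2 * pi * of_int k)"
          using circle_lift_period_int[OF H, of s "- k"] s(2) by simp
        then show ?thesis using inv_set_shift'[OF iT s(1)] by blast
      qed
      ultimately have "closed (cis ` H ` T)" by (rule closed_cis_image)
      then show ?thesis by (simp add: image_image)
    qed
    moreover have "f ` (\<lambda>t. cis (H t)) ` T = (\<lambda>t. cis (H t)) ` T" if f: "f \<in> ?G" for f
    proof -
      obtain g where g: "g \<in> carrier \<Gamma>" "f = conj_by (circle_map H) (\<rho> g)" using f by blast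
      obtain F where F: "F \<in> lifts" "circle_lift F" "\<And>t. \<rho> g (cis t) = cis (F t)" using exists_lift[OF g(1)] by blast
      have fF: "f (cis (H t)) = cis (H (F t))" for t unfolding g(2) by (rule conj[OF g(1) F(2,3)])
      have "F ` T = T"
      proof (intro equalityI subsetI)
        show "t \<in> T" if "t \<in> F ` T" for t using that inv_set_iff[OF iT F(1)] by blast
        fix t assume t: "t \<in> T"
        obtain s where s: "F s = t" using circle_lift_surj[OF F(2)] by blast
        then have "s \<in> T" using inv_set_iff[OF iT F(1), of s] t by simp
        then show "t \<in> F ` T" using s by blast
      qed
      have "f ` (\<lambda>t. cis (H t)) ` T = (\<lambda>t. cis (H t)) ` F ` T"
        by (simp add: image_image fF)
      then show ?thesis by (simp only: \<open>F ` T = T\<close>)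
    qed
    moreover have "(\<lambda>t. cis (H t)) ` T \<noteq> {}" using iT by (simp add: inv_set_def)
    ultimately show "closed_invariant ?G ((\<lambda>t. cis (H t)) ` T)"
      unfolding closed_invariant_def by auto
    fix K assume K: "closed_invariant ?G K"
    let ?T' = "(\<lambda>t. cis (H t)) -` K"
    have "inv_set ?T'"
      unfolding inv_set_def
    proof (intro conjI ballI)
      have "isCont (\<lambda>t. cis (H t)) t" for t
        using smooth_on_imp_continuous_on[OF smooth_on_cis[OF open_UNIV circle_lift_smooth[OF H]]]
        by (simp add: continuous_on_eq_continuous_at)
      then show "closed ?T'" using K by (intro continuous_closed_vimage) (auto simp: closed_invariant_def)
      obtain z where z: "z \<in> K" using K unfolding closed_invariant_def by blast
      then have "z \<in> S1" using K unfolding closed_invariant_def by blast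
      then obtain t where "z = cis t" using S1_cis by blast
      then have "J t \<in> ?T'" using z J(3) by simp
      then show "?T' \<noteq> {}" by blast
      fix F t assume F: "F \<in> lifts" and t: "t \<in> ?T'"
      obtain g where g: "g \<in> carrier \<Gamma>" "circle_lift F" "\<And>t. \<rho> g (cis t) = cis (F t)"
        using F by (auto simp: lifts_def)
      have "conj_by (circle_map H) (\<rho> g) ` K = K" using K g(1) by (simp add: closed_invariant_def)
      then have "conj_by (circle_map H) (\<rho> g) (cis (H t)) \<in> K" using t by blast
      then show "F t \<in> ?T'" using conj[OF g, of t] by simp
    qed
    then have "T \<subseteq> ?T'" by (rule minimal_set_least[OF T])
    then show "(\<lambda>t. cis (H t)) ` T \<subseteq> K" by blast
  qed
qed

lemma conj_schwarzian_vanishes: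
  "\<exists>h\<in>carrier Diff_S1. \<forall>\<gamma>\<in>carrier \<Gamma>. \<forall>x\<in>limit_set ((\<lambda>g. conj_by h (\<rho> g)) ` carrier \<Gamma>).
     schwarzian_vanishes_at (conj_by h (\<rho> \<gamma>)) x"
proof -
  obtain T where T: "minimal_set T" using exists_minimal_set by blast
  obtain H where comp: "compatible T H" using exists_compatible_lift[OF T] by blast
  then have H: "circle_lift H" by (simp add: compatible_def)
  have iT: "inv_set T" using T by (simp add: minimal_set_def)
  show ?thesis
  proof (intro bexI ballI)
    show "circle_map H \<in> carrier Diff_S1" by (rule circle_map_Diff_S1[OF H])
    fix g x assume g: "g \<in> carrier \<Gamma>"
      and "x \<in> limit_set ((\<lambda>g. conj_by (circle_map H) (\<rho> g)) ` carrier \<Gamma>)"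
    then obtain t where t: "t \<in> T" "x = cis (H t)" unfolding conj_limit_set[OF H T] by blast
    obtain F where F: "F \<in> lifts" "circle_lift F" "\<And>t. \<rho> g (cis t) = cis (F t)" using exists_lift[OF g] by blast
    show "schwarzian_vanishes_at (conj_by (circle_map H) (\<rho> g)) x"
      unfolding t(2)
    proof (rule schwarzian_vanishes_at_conj[OF H F(2) rho_Bij[OF g] F(3)])
      fix r assume "cis r = cis t"
      then obtain k :: int where "r = t + 2 * pi * of_int k" using cis_eq_iff by blast
      then have "r \<in> T" using inv_set_shift[OF iT t(1)] by simp
      then show "proj_sch H (F r) * (deriv F r)\<^sup>2 + sch F r = proj_sch H r"
        using comp F(1) by (simp add: compatible_def)
    qed
  qed
qed

end

theorem theorem1p13:
  fixes \<Gamma> :: "('g, 'm) monoid_scheme" and \<rho> :: "'g \<Rightarrow> complex \<Rightarrow> complex"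
  assumes "group \<Gamma>"
    and "\<rho> \<in> hom \<Gamma> Diff_S1"
    and "non_elementary \<Gamma> \<rho>"
    and "\<exists>\<omega>. smooth_volume_form \<omega> \<and> preserves_volume_form (\<rho> ` carrier \<Gamma>) \<omega>"
  shows "\<exists>h\<in>carrier Diff_S1. \<forall>\<gamma>\<in>carrier \<Gamma>.
           \<forall>x\<in>limit_set ((\<lambda>g. conj_by h (\<rho> g)) ` carrier \<Gamma>).
             schwarzian_vanishes_at (conj_by h (\<rho> \<gamma>)) x"
proof -
  obtain \<omega> where "smooth_volume_form \<omega>" "preserves_volume_form (\<rho> ` carrier \<Gamma>) \<omega>"
    using assms(4) by blast
  then have "circle_action \<Gamma> \<rho> \<omega>"
    using assms(1-3) by (simp add: circle_action_def circle_action_axioms_def)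
  then show ?thesis by (rule circle_action.conj_schwarzian_vanishes)
qed

end
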